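(* Let $\mathfrak{h} = L^2(\mathrm{SU}(2),\mathbb{C}^2)$, let $\rho$ be the unitary representation of $\mathrm{SU}(2)\times\mathrm{SU}(2)$ on $\mathfrak{h}$ given by $(\rho(g_1,g_2)\psi)(g) = g_2\,\psi(g_1^{-1} g g_2)$, let $\partial\!\!\!/$ be the Dirac operator on $\mathfrak{h}$, let $\mathcal{H}$ be $\mathfrak{h}$ with the modified complex structure $j = iS$ where $S = \partial\!\!\!/ /|\partial\!\!\!/|$, let $\rho_{\mathcal{H}}$ be the representation $\rho$ regarded on $\mathcal{H}$, and let $F = I(p_+ + C p_-)\colon \mathfrak{h}\to\mathcal{H}$ (all as defined in the context). Then $F$ is a complex-linear unitary operator from $\mathfrak{h}$ to $\mathcal{H}$ satisfying $F\rho(g_1,g_2) = \rho_{\mathcal{H}}(g_1,g_2)F$ for all $(g_1,g_2)\in\mathrm{SU}(2)\times\mathrm{SU}(2)$, i.e. $F$ is a unitary equivalence between the representations $\rho$ and $\rho_{\mathcal{H}}$; moreover $F\partial\!\!\!/ = \partial\!\!\!/ F$ on the domain of $\partial\!\!\!/$.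
   Context: Identify the unit 3-sphere $S^3$ with $\mathrm{SU}(2)$ and let $\mathfrak{h} = L^2(S^3)\otimes\mathbb{C}^2$, the complex Hilbert space of square-integrable functions $\psi\colon \mathrm{SU}(2)\to\mathbb{C}^2$ (Haar measure), with its usual complex structure $i$. Let $\sigma_1,\sigma_2,\sigma_3$ be the Pauli matrices. For $j=1,2,3$ let $X_j$ be the left-invariant vector field on $\mathrm{SU}(2)$ whose value at the identity is $-i\sigma_j\in\mathfrak{su}(2)$, acting on functions by $(X_j\psi)(g) = \frac{d}{dt}\psi(g\exp(-it\sigma_j))|_{t=0}$ (componentwise on $\mathbb{C}^2$-valued functions). The Dirac operator is the self-adjoint operator $\partial\!\!\!/ = \sum_{j=1}^3 i\,\sigma_j X_j + \tfrac{3}{2}$ on $\mathfrak{h}$ (closure from smooth functions), where $\sigma_j$ acts on the $\mathbb{C}^2$ values. It has an orthonormal basis of eigenvectors with eigenvalues in $\mathbb{Z}+\tfrac12$, and $0$ is not an eigenvalue. Let $S = \partial\!\!\!/ /|\partial\!\!\!/|$ (functional calculus), which is $+1$ on eigenvectors with positive eigenvalue and $-1$ on those with negative eigenvalue, and let $p_+,p_-$ be the orthogonal projections onto the $+1$ and $-1$ eigenspaces of $S$. Let $\mathcal{H}$ denote the same real vector space with the same norm as $\mathfrak{h}$ but with complex structure $j = iS$ (complex inner product determined by the norm and $j$); $\partial\!\!\!/$ is also a self-adjoint complex-linear operator on $\mathcal{H}$. Let $I\colon\mathfrak{h}\to\mathcal{H}$ be the identity map on underlying sets. Let $C\colon\mathfrak{h}\to\mathfrak{h}$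 be the conjugate-linear map $(C\psi)(g) = \epsilon\,\overline{\psi(g)}$, where the bar is componentwise complex conjugation and $\epsilon = \begin{pmatrix}0&1\\-1&0\end{pmatrix}$. Define $F = I(p_+ + Cp_-)$. The representation $\rho$ is $(\rho(g_1,g_2)\psi)(g) = g_2\psi(g_1^{-1}gg_2)$; the operators $\rho(g_1,g_2)$ commute with $\partial\!\!\!/$, hence with $j$, and $\rho_{\mathcal{H}}(g_1,g_2) = I\rho(g_1,g_2)I^{-1}$ is the resulting complex-linear unitary representation on $\mathcal{H}$. *)

theory Defs
  imports "HOL-Probability.Probability"
begin

(* SU(2) realised as complex 2x2 matrices; spinor fields are functions SU(2) -> C^2.
   Elements of L^2 are represented by functions; equality in L^2 is Haar-a.e. equality. *)

type_synonym mat2 = "complex^2^2"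
type_synonym spinor = "complex^2"
type_synonym sfield = "mat2 \<Rightarrow> spinor"

definition cadj :: "mat2 \<Rightarrow> mat2" where
  "cadj A = (\<chi> a b. cnj (A$b$a))"

definition msc :: "complex \<Rightarrow> mat2 \<Rightarrow> mat2" where
  "msc c A = (\<chi> a b. c * A$a$b)"

definition SU2 :: "mat2 set" where
  "SU2 = {g. g ** cadj g = mat 1 \<and> det g = 1}"

(* matrix exponential, by its power series *)
definition mexp :: "mat2 \<Rightarrow> mat2" where
  "mexp A = (\<Sum>n. (1 / (fact n :: real)) *\<^sub>R (((**) A) ^^ n) (mat 1))"

(* Pauli matrices sigma_1, sigma_2, sigma_3 *)
definition pauli :: "nat \<Rightarrow> mat2" where
  "pauli j =
    (if j = 1 then (\<chi> a b. if a = b then 0 else 1)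
     else if j = 2 then (\<chi> a b. if a = b then 0 else if a = 1 then - \<i> else \<i>)
     else (\<chi> a b. if a \<noteq> b then 0 else if a = 1 then 1 else -1))"

(* epsilon = [[0,1],[-1,0]] *)
definition epsm :: mat2 where
  "epsm = (\<chi> a b. if a = b then 0 else if a = 1 then 1 else -1)"

(* normalised Haar measure on SU(2): the left-invariant Borel probability measure *)
definition haar :: "mat2 measure" where
  "haar = (THE M. sets M = sets (restrict_space borel SU2) \<and> prob_space M \<and>
      (\<forall>g\<in>SU2. \<forall>A\<in>sets M. emeasure M ((\<lambda>x. g ** x) ` A) = emeasure M A))"

definition L2 :: "sfield set" where
  "L2 = {\<psi>. \<psi> \<in> borel_measurable haar \<and> integrable haar (\<lambda>g. (norm (\<psi> g))\<^sup>2)}"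

definition l2norm :: "sfield \<Rightarrow> real" where
  "l2norm \<psi> = sqrt (\<integral>g. (norm (\<psi> g))\<^sup>2 \<partial>haar)"

(* inner product of h, conjugate-linear in the first argument *)
definition hinner :: "sfield \<Rightarrow> sfield \<Rightarrow> complex" where
  "hinner \<phi> \<psi> = (\<integral>g. (\<Sum>k\<in>UNIV. cnj (\<phi> g $ k) * \<psi> g $ k) \<partial>haar)"

(* equality as elements of L^2 *)
definition aeq :: "sfield \<Rightarrow> sfield \<Rightarrow> bool" where
  "aeq \<phi> \<psi> \<longleftrightarrow> (AE g in haar. \<phi> g = \<psi> g)"

definition l2lim :: "(nat \<Rightarrow> sfield) \<Rightarrow> sfield \<Rightarrow> bool" where
  "l2lim u \<psi> \<longleftrightarrow> (\<lambda>n. l2norm (\<lambda>g. u n g - \<psi> g)) \<longlonglongrightarrow> 0"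

(* left-invariant vector field X_j: (X_j psi)(g) = d/dt psi(g exp(-i t sigma_j)) at t = 0 *)
definition Xd :: "nat \<Rightarrow> sfield \<Rightarrow> sfield" where
  "Xd j \<psi> g = vector_derivative (\<lambda>t::real. \<psi> (g ** mexp (msc (- \<i> * complex_of_real t) (pauli j)))) (at 0)"

fun Xit :: "nat list \<Rightarrow> sfield \<Rightarrow> sfield" where
  "Xit [] \<psi> = \<psi>"
| "Xit (j # js) \<psi> = Xd j (Xit js \<psi>)"

(* smooth functions on SU(2): all iterated left-invariant derivatives exist and are continuous *)
definition smooth_su2 :: "sfield \<Rightarrow> bool" where
  "smooth_su2 \<psi> \<longleftrightarrow> (\<forall>js. continuous_on SU2 (Xit js \<psi>) \<and>
     (\<forall>j\<in>{1,2,3}. \<forall>g\<in>SU2.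
        ((\<lambda>t::real. Xit js \<psi> (g ** mexp (msc (- \<i> * complex_of_real t) (pauli j))))
           has_vector_derivative Xd j (Xit js \<psi>) g) (at 0)))"

(* Dirac operator on smooth functions: sum_j i sigma_j X_j + 3/2 *)
definition Dsm :: "sfield \<Rightarrow> sfield" where
  "Dsm \<psi> g = (\<Sum>j\<in>{1,2,3::nat}. msc \<i> (pauli j) *v Xd j \<psi> g) + (3/2 :: complex) *s \<psi> g"

(* graph of the closure of Dsm in L^2:  dirac psi phi  means psi in dom, Dirac psi = phi *)
definition dirac :: "sfield \<Rightarrow> sfield \<Rightarrow> bool" where
  "dirac \<psi> \<phi> \<longleftrightarrow> \<psi> \<in> L2 \<and> \<phi> \<in> L2 \<and>
     (\<exists>u. (\<forall>n. smooth_su2 (u n)) \<and> l2lim u \<psi> \<and> l2lim (\<lambda>n. Dsm (u n)) \<phi>)"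

(* eigenvectors with positive / negative eigenvalue *)
definition EigPos :: "sfield set" where
  "EigPos = {e. \<exists>r::real. r > 0 \<and> dirac e (\<lambda>g. complex_of_real r *s e g)}"

definition EigNeg :: "sfield set" where
  "EigNeg = {e. \<exists>r::real. r < 0 \<and> dirac e (\<lambda>g. complex_of_real r *s e g)}"

(* closed linear span in L^2 *)
definition cspan :: "sfield set \<Rightarrow> sfield set" where
  "cspan E = {\<phi>. \<phi> \<in> L2 \<and> (\<exists>u. l2lim u \<phi> \<and>
      (\<forall>m. \<exists>n (c::nat \<Rightarrow> complex) e. (\<forall>k<n. e k \<in> E) \<and>
             u m = (\<lambda>g. \<Sum>k<n. c k *s e k g)))}"

(* orthogonal projection onto the closed span of E *)
definition proj :: "sfield set \<Rightarrow> sfield \<Rightarrow> sfield" where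
  "proj E \<psi> = (SOME \<phi>. \<phi> \<in> cspan E \<and> (\<forall>e\<in>E. hinner e (\<lambda>g. \<psi> g - \<phi> g) = 0))"

definition pplus :: "sfield \<Rightarrow> sfield" where "pplus = proj EigPos"
definition pminus :: "sfield \<Rightarrow> sfield" where "pminus = proj EigNeg"

(* S = Dirac / |Dirac| = p_+ - p_- *)
definition Sop :: "sfield \<Rightarrow> sfield" where
  "Sop \<psi> g = pplus \<psi> g - pminus \<psi> g"

(* scalar multiplication of H: c .j u = Re c u + Im c (i S u) *)
definition jmul :: "complex \<Rightarrow> sfield \<Rightarrow> sfield" where
  "jmul c u g = complex_of_real (Re c) *s u g + (complex_of_real (Im c) * \<i>) *s Sop u g"

(* charge conjugation C *)
definition Cop :: "sfield \<Rightarrow> sfield" where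
  "Cop \<psi> g = epsm *v (\<chi> k. cnj (\<psi> g $ k))"

(* F = I (p_+ + C p_-); I is the identity on underlying sets *)
definition Fop :: "sfield \<Rightarrow> sfield" where
  "Fop \<psi> g = pplus \<psi> g + Cop (pminus \<psi>) g"

definition rho :: "mat2 \<Rightarrow> mat2 \<Rightarrow> sfield \<Rightarrow> sfield" where
  "rho g1 g2 \<psi> g = g2 *v \<psi> (cadj g1 ** g ** g2)"

(* rho_H(g1,g2) = I rho(g1,g2) I^{-1}: the same map on the underlying set *)
definition rhoH :: "mat2 \<Rightarrow> mat2 \<Rightarrow> sfield \<Rightarrow> sfield" where
  "rhoH g1 g2 = rho g1 g2"

end

(*
  A real Hilbert space with a closed symmetric graph whose nonzero eigenvectors are total splits into the
  closed spans of the eigenvectors with positive and with negative eigenvalue, and every isometry preserving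
  the graph commutes with both projections; applied to charge conjugation C, to multiplication by i and to
  the operators rho this gives all assertions about F = p_+ + C p_-.  The graph of the Dirac operator is
  symmetric because integrals of derivatives along left-invariant fields vanish.  Its eigenvectors are total
  because polynomials in the matrix entries are dense (Stone-Weierstrass) and split into eigenspinors: with
  T = sum_j i sigma_j X_j one has T^2 + 2T = L, the Laplacian, so a function with L f = m(m+2) f gives
  eigenspinors of T for m and -m-2, and pairing such a spinor with a row of the group element gives a
  Laplace eigenfunction for m+1 or m-1.  Hence multiplication by an entry preserves sums of Laplace
  eigenfunctions, and the Dirac operator T + 3/2 has eigenvalues m + 3/2 and -m - 1/2, never 0.
*)

theory Submission
  imports Defs "HOL-Library.Function_Algebras"
begin

section \<open>Symmetric graphs with a total set of eigenvectors\<close>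

text \<open>The space is taken over the reals because \<open>C\<close> is conjugate-linear: over the
  reals \<open>C\<close>, multiplication by \<open>i\<close> and the operators \<open>rho\<close>
  are all bounded linear maps that preserve the graph, and one commutation argument serves them all.
  \<open>F\<close> turns \<open>i\<close> into \<open>j\<close> because \<open>C\<close>
  anticommutes with \<open>i\<close> while \<open>j\<close> is \<open>- i\<close> on the range of
  \<open>p_-\<close>. That \<open>C\<close> preserves the graph reflects that
  \<open>i sigma_j\<close> lies in the Lie algebra of SU(2), with which the quaternionic structure
  of \<open>C^2\<close> commutes.

  The definitions speak of functions: \<open>haar\<close> is a definite description and
  \<open>proj\<close> a choice among representatives. So Haar measure has to be constructed and
  proved unique, and the abstract argument runs on classes modulo a.e. equality.

  The delicate point of totality is \<open>m = 0\<close>. There the eigenspinors split off for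
  \<open>- m - 2\<close> would lead to the parameter \<open>m - 1 = -1\<close>, a Laplace eigenvalue
  \<open>-1\<close> outside the induction. They vanish a.e. on SU(2), since \<open>L f = 0\<close>
  forces \<open>X_j f = 0\<close> for all \<open>j\<close>.

  Since the closed graph is the closed span of its eigenpairs, its invariance under \<open>F\<close>
  can be tested on eigenvectors, where \<open>F\<close> is the identity or \<open>C\<close>.\<close>

definition oproj :: "'a::real_inner set \<Rightarrow> 'a \<Rightarrow> 'a" where
  "oproj S x = (SOME y. y \<in> S \<and> (\<forall>z\<in>S. inner (x - y) z = 0))"

text \<open>A minimising sequence for the distance to \<open>x\<close> is Cauchy by the
  parallelogram law; its limit has the orthogonality property because moving it along
  \<open>z\<close> cannot decrease the distance.\<close>

lemma orthogonal_decomposition_exists: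
  fixes S :: "'a::{real_inner,complete_space} set"
  assumes S: "subspace S" "closed S"
  shows "\<exists>y\<in>S. \<forall>z\<in>S. inner (x - y) z = 0"
proof -
  define d where "d = Inf ((\<lambda>y. (norm (x - y))\<^sup>2) ` S)"
  have S0: "0 \<in> S" using S subspace_0 by blast
  have bdd: "bdd_below ((\<lambda>y. (norm (x - y))\<^sup>2) ` S)"
    by (rule bdd_belowI[of _ 0]) auto
  have dle: "d \<le> (norm (x - y))\<^sup>2" if "y \<in> S" for y
    unfolding d_def using that bdd by (intro cInf_lower) auto
  have "\<exists>y\<in>S. (norm (x - y))\<^sup>2 < d + inverse (Suc n)" for n
  proof -
    have "Inf ((\<lambda>y. (norm (x - y))\<^sup>2) ` S) < d + inverse (Suc n)" unfolding d_def by simp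
    then show ?thesis using cInf_lessD S0 by (metis (no_types, lifting) empty_iff image_iff)
  qed
  then obtain u where uS: "\<And>n. u n \<in> S" and u: "\<And>n. (norm (x - u n))\<^sup>2 < d + inverse (Suc n)"
    by metis
  have par: "(norm (u m - u n))\<^sup>2 \<le> 2 * inverse (Suc m) + 2 * inverse (Suc n)" for m n
  proof -
    have mid: "(1/2) *\<^sub>R (u m + u n) \<in> S" using uS S by (simp add: subspace_add subspace_scale)
    \<comment> \<open>The midpoint of two members of \<open>S\<close> lies in \<open>S\<close>, so
      its distance to \<open>x\<close> is bounded below by \<open>d\<close>; this is what makes the
      parallelogram law bound the difference of the two members.\<close>
    have "4 * d \<le> (norm ((x - u m) + (x - u n)))\<^sup>2"
    proof -
      have "(x - u m) + (x - u n) = 2 *\<^sub>R (x - (1/2) *\<^sub>R (u m + u n))"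
        by (simp add: algebra_simps scaleR_2)
      then have "(norm ((x - u m) + (x - u n)))\<^sup>2 = 4 * (norm (x - (1/2) *\<^sub>R (u m + u n)))\<^sup>2"
        by (simp add: power2_eq_square)
      then show ?thesis using dle[OF mid] by simp
    qed
    moreover have "(norm (u m - u n))\<^sup>2 = 2 * (norm (x - u m))\<^sup>2 + 2 * (norm (x - u n))\<^sup>2
        - (norm ((x - u m) + (x - u n)))\<^sup>2"
      by (simp add: power2_norm_eq_inner inner_diff_left inner_diff_right inner_add_left inner_add_right inner_commute algebra_simps)
    ultimately show ?thesis using u[of m] u[of n] by linarith
  qed
  have "Cauchy u"
  proof (rule metric_CauchyI)
    fix e :: real assume e: "e > 0"
    obtain N where N: "inverse (real (Suc N)) < e\<^sup>2 / 4"
      using reals_Archimedean[of "e\<^sup>2/4"] e by auto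
    have "dist (u m) (u n) < e" if "m \<ge> N" "n \<ge> N" for m n
    proof -
      have "inverse (real (Suc m)) \<le> inverse (real (Suc N))" "inverse (real (Suc n)) \<le> inverse (real (Suc N))"
        using that by (auto simp: le_imp_inverse_le)
      then have "(norm (u m - u n))\<^sup>2 < e\<^sup>2" using par[of m n] N by linarith
      then show ?thesis using e by (simp add: dist_norm power2_less_imp_less)
    qed
    then show "\<exists>M. \<forall>m\<ge>M. \<forall>n\<ge>M. dist (u m) (u n) < e" by blast
  qed
  then obtain y where y: "u \<longlonglongrightarrow> y" using Cauchy_convergent_iff convergent_def by blast
  have yS: "y \<in> S" using closed_sequentially[OF S(2)] uS y by blast
  have dy: "(norm (x - y))\<^sup>2 \<le> d"
  proof (rule LIMSEQ_le)
    show "(\<lambda>n. (norm (x - u n))\<^sup>2) \<longlonglongrightarrow> (norm (x - y))\<^sup>2" by (intro tendsto_intros y)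
    show "(\<lambda>n. d + inverse (real (Suc n))) \<longlonglongrightarrow> d"
      using tendsto_add[OF tendsto_const LIMSEQ_inverse_real_of_nat, of d] by simp
    show "\<exists>N. \<forall>n\<ge>N. (norm (x - u n))\<^sup>2 \<le> d + inverse (real (Suc n))" using u less_imp_le by blast
  qed
  have "inner (x - y) z = 0" if z: "z \<in> S" for z
  proof (cases "z = 0")
    case False
    \<comment> \<open>The minimiser of the quadratic in \<open>t\<close> that gives the squared
      distance from \<open>x\<close> to \<open>y + t *\<^sub>R z\<close>.\<close>
    define t where "t = inner (x - y) z / (norm z)\<^sup>2"
    have nz: "(norm z)\<^sup>2 > 0" using False by simp
    have "y + t *\<^sub>R z \<in> S" using yS z S by (simp add: subspace_add subspace_scale)
    from order_trans[OF dy dle[OF this]] have "(norm (x - y))\<^sup>2 \<le> (norm ((x - y) - t *\<^sub>R z))\<^sup>2"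
      unfolding diff_diff_eq .
    also have "\<dots> = (norm (x - y))\<^sup>2 - 2 * t * inner (x - y) z + t\<^sup>2 * (norm z)\<^sup>2"
      unfolding power2_norm_eq_inner by (simp add: inner_diff_left inner_diff_right inner_commute algebra_simps power2_eq_square)
    also have "\<dots> = (norm (x - y))\<^sup>2 - (inner (x - y) z)\<^sup>2 / (norm z)\<^sup>2"
      using nz unfolding t_def by (simp add: power2_eq_square field_simps)
    finally have "(inner (x - y) z)\<^sup>2 / (norm z)\<^sup>2 \<le> 0" by simp
    then show ?thesis using nz by (simp add: divide_le_0_iff)
  qed simp
  with yS show ?thesis by blast
qed

lemma
  fixes S :: "'a::{real_inner,complete_space} set"
  assumes S: "subspace S" "closed S"
  shows oproj_in: "oproj S x \<in> S"
    and oproj_orth: "z \<in> S \<Longrightarrow> inner (x - oproj S x) z = 0"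
proof -
  have "oproj S x \<in> S \<and> (\<forall>z\<in>S. inner (x - oproj S x) z = 0)"
    unfolding oproj_def by (rule someI_ex) (use orthogonal_decomposition_exists[OF S, of x] in blast)
  then show "oproj S x \<in> S" "z \<in> S \<Longrightarrow> inner (x - oproj S x) z = 0" by auto
qed

lemma oproj_unique:
  fixes S :: "'a::{real_inner,complete_space} set"
  assumes S: "subspace S" "closed S" and y: "y \<in> S" "\<And>z. z \<in> S \<Longrightarrow> inner (x - y) z = 0"
  shows "oproj S x = y"
proof -
  have "oproj S x - y \<in> S" using oproj_in[OF S] y(1) S by (simp add: subspace_diff)
  then have "inner (x - y) (oproj S x - y) = 0" "inner (x - oproj S x) (oproj S x - y) = 0"
    using y(2) oproj_orth[OF S] by auto
  then have "inner (oproj S x - y) (oproj S x - y) = 0"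
    by (simp add: inner_diff_left)
  then show ?thesis by simp
qed

lemma subspace_closure_span: "subspace (closure (span E))" for E :: "'a::real_normed_vector set"
proof (rule subspaceI)
  show "0 \<in> closure (span E)" using closure_subset span_zero by blast
next
  fix x y assume "x \<in> closure (span E)" "y \<in> closure (span E)"
  then obtain u v where "\<And>n. u n \<in> span E" "u \<longlonglongrightarrow> x" "\<And>n. v n \<in> span E" "v \<longlonglongrightarrow> y"
    unfolding closure_sequential by auto
  then have "\<forall>n. u n + v n \<in> span E" "(\<lambda>n. u n + v n) \<longlonglongrightarrow> x + y"
    by (auto intro: span_add tendsto_add)
  then show "x + y \<in> closure (span E)" unfolding closure_sequential
    by (intro exI[of _ "\<lambda>n. u n + v n"]) simp
next
  fix c :: real and x assume "x \<in> closure (span E)"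
  then obtain u where "\<And>n. u n \<in> span E" "u \<longlonglongrightarrow> x" unfolding closure_sequential by auto
  then have "\<forall>n. c *\<^sub>R u n \<in> span E" "(\<lambda>n. c *\<^sub>R u n) \<longlonglongrightarrow> c *\<^sub>R x"
    by (auto intro: span_scale tendsto_scaleR)
  then show "c *\<^sub>R x \<in> closure (span E)" unfolding closure_sequential
    by (intro exI[of _ "\<lambda>n. c *\<^sub>R u n"]) simp
qed

lemma inner_zero_closure_span:
  fixes x :: "'a::real_inner"
  assumes "\<And>e. e \<in> E \<Longrightarrow> inner x e = 0" and z: "z \<in> closure (span E)"
  shows "inner x z = 0"
proof -
  have sp: "inner x w = 0" if "w \<in> span E" for w
    using that
  proof (induction rule: span_induct_alt)
    case base then show ?case by simp
  next
    case (step c a y) then show ?case using assms(1) by (simp add: inner_add_right)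
  qed
  have "closed {z. inner x z = 0}" by (intro closed_Collect_eq continuous_intros)
  moreover have "span E \<subseteq> {z. inner x z = 0}" using sp by auto
  ultimately have "closure (span E) \<subseteq> {z. inner x z = 0}" by (rule closure_minimal[rotated])
  then show ?thesis using z by auto
qed

lemma closure_span_eq_UNIV:
  fixes E :: "'a::{real_inner,complete_space} set"
  assumes "\<And>x. (\<And>e. e \<in> E \<Longrightarrow> inner x e = 0) \<Longrightarrow> x = 0"
  shows "closure (span E) = UNIV"
proof -
  let ?S = "closure (span E)"
  have S: "subspace ?S" "closed ?S" by (auto intro: subspace_closure_span)
  have "x \<in> ?S" for x
  proof -
    have "x - oproj ?S x = 0"
    proof (rule assms)
      fix e assume "e \<in> E"
      then have "e \<in> ?S" using closure_subset span_base by blast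
      then show "inner (x - oproj ?S x) e = 0" by (rule oproj_orth[OF S])
    qed
    then show ?thesis using oproj_in[OF S] by (metis eq_iff_diff_eq_0)
  qed
  then show ?thesis by auto
qed

lemma linear_image_closure_span_subset:
  assumes "bounded_linear U" "\<And>e. e \<in> E \<Longrightarrow> U e \<in> closure (span E')" "x \<in> closure (span E)"
  shows "U x \<in> closure (span E')"
proof -
  interpret bounded_linear U by fact
  have S: "subspace (closure (span E'))" by (auto intro: subspace_closure_span)
  have "U ` span E \<subseteq> closure (span E')"
  proof safe
    fix y assume "y \<in> span E"
    then show "U y \<in> closure (span E')"
    proof (induction rule: span_induct_alt)
      case base then show ?case using S by (simp add: zero subspace_0)
    next
      case (step c a y) then show ?case using assms(2) S by (simp add: add scaleR subspace_add subspace_scale)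
    qed
  qed
  then have "U ` closure (span E) \<subseteq> closure (closure (span E'))"
    by (metis closure_bounded_linear_image_subset[OF assms(1)] closure_mono subset_trans)
  then show ?thesis using assms(3) by auto
qed

text \<open>An unbounded operator is represented by its graph, matching the relational form of
  \<open>dirac\<close>; closing the operator is then ordinary closure in the product space. Only
  nonzero eigenvalues count in \<open>total\<close>, so the positive and the negative part must
  exhaust the space.\<close>

locale symmetric_graph =
  fixes G :: "('a::{real_inner,complete_space} \<times> 'a) set"
  assumes subspace_G: "subspace G" and closed_G: "closed G"
    and symmetric: "(x, x') \<in> G \<Longrightarrow> (y, y') \<in> G \<Longrightarrow> inner x y' = inner x' y"
    and total: "closure (span {x. \<exists>r. r \<noteq> 0 \<and> (x, r *\<^sub>R x) \<in> G}) = UNIV"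
begin

definition "Epos = {x. \<exists>r>0. (x, r *\<^sub>R x) \<in> G}"
definition "Eneg = {x. \<exists>r<0. (x, r *\<^sub>R x) \<in> G}"
definition "Hpos = closure (span Epos)"
definition "Hneg = closure (span Eneg)"
definition "Ppos = oproj Hpos"
definition "Pneg = oproj Hneg"

lemma subspace_H: "subspace Hpos" "subspace Hneg" and closed_H: "closed Hpos" "closed Hneg"
  unfolding Hpos_def Hneg_def by (auto intro: subspace_closure_span)

lemma E_subset: "Epos \<subseteq> Hpos" "Eneg \<subseteq> Hneg"
  unfolding Hpos_def Hneg_def using closure_subset span_superset by (metis subset_trans)+

lemma Epos_orth_Eneg: assumes "x \<in> Epos" "y \<in> Eneg" shows "inner x y = 0"
proof -
  obtain r s where "r > 0" "(x, r *\<^sub>R x) \<in> G" "s < 0" "(y, s *\<^sub>R y) \<in> G"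
    using assms unfolding Epos_def Eneg_def by auto
  then have "s * inner x y = r * inner x y" "r > s" using symmetric by fastforce+
  then show ?thesis by simp
qed

lemma Hpos_orth_Hneg: assumes "x \<in> Hpos" "y \<in> Hneg" shows "inner x y = 0"
proof (rule inner_zero_closure_span)
  show "y \<in> closure (span Eneg)" using assms unfolding Hneg_def by simp
  fix e assume e: "e \<in> Eneg"
  have "inner e x = 0"
    by (rule inner_zero_closure_span[of Epos])
      (use assms e Epos_orth_Eneg in \<open>auto simp: Hpos_def inner_commute\<close>)
  then show "inner x e = 0" by (simp add: inner_commute)
qed

lemma P_in: "Ppos x \<in> Hpos" "Pneg x \<in> Hneg"
  unfolding Ppos_def Pneg_def using oproj_in subspace_H closed_H by blast+

lemma P_orth: "z \<in> Hpos \<Longrightarrow> inner (x - Ppos x) z = 0" "z \<in> Hneg \<Longrightarrow> inner (x - Pneg x) z = 0"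
  unfolding Ppos_def Pneg_def using oproj_orth subspace_H closed_H by blast+

text \<open>The residual is orthogonal to both families of eigenvectors; since these are total,
  there is no third summand for a kernel.\<close>

lemma P_sum: "Ppos x + Pneg x = x"
proof -
  have "inner (x - Ppos x - Pneg x) z = 0" if "z \<in> Epos \<union> Eneg" for z
  proof (cases "z \<in> Epos")
    case True
    then have "z \<in> Hpos" using E_subset by blast
    then show ?thesis using P_orth(1) Hpos_orth_Hneg[OF _ P_in(2)]
      by (metis diff_zero inner_commute inner_diff_left)
  next
    case False
    then have "z \<in> Hneg" using E_subset that by blast
    then have "inner (x - Pneg x) z = 0" "inner (Ppos x) z = 0"
      using P_orth(2) Hpos_orth_Hneg[OF P_in(1)] by auto
    then show ?thesis by (simp add: inner_diff_left)
  qed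
  moreover have "{x. \<exists>r. r \<noteq> 0 \<and> (x, r *\<^sub>R x) \<in> G} = Epos \<union> Eneg"
    unfolding Epos_def Eneg_def by (auto simp: neq_iff)
  ultimately have "inner (x - Ppos x - Pneg x) z = 0" for z
    using inner_zero_closure_span[of "Epos \<union> Eneg"] total by auto
  then have "x - Ppos x - Pneg x = 0" using inner_eq_zero_iff by blast
  then show ?thesis by (simp add: algebra_simps)
qed

text \<open>The device for computing with the projections: linearity, commutation and the formulas
  for \<open>F\<close> are read off from a decomposition into the two orthogonal subspaces.\<close>

lemma decomposition_unique:
  assumes "a \<in> Hpos" "b \<in> Hneg"
  shows "Ppos (a + b) = a" "Pneg (a + b) = b"
proof -
  show "Ppos (a + b) = a" unfolding Ppos_def
    by (rule oproj_unique) (use assms subspace_H closed_H Hpos_orth_Hneg in \<open>auto simp: inner_commute\<close>)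
  then show "Pneg (a + b) = b" using P_sum[of "a + b"] by simp
qed

lemma P_linear: "linear Ppos" "linear Pneg"
proof -
  have *: "Ppos (x + y) = Ppos x + Ppos y \<and> Pneg (x + y) = Pneg x + Pneg y" for x y
  proof -
    have "x + y = (Ppos x + Ppos y) + (Pneg x + Pneg y)"
      using P_sum[of x] P_sum[of y] by (metis add.assoc add.left_commute)
    then show ?thesis using decomposition_unique subspace_H P_in subspace_add by metis
  qed
  have **: "Ppos (c *\<^sub>R x) = c *\<^sub>R Ppos x \<and> Pneg (c *\<^sub>R x) = c *\<^sub>R Pneg x" for c x
  proof -
    have "c *\<^sub>R x = c *\<^sub>R Ppos x + c *\<^sub>R Pneg x"
      using P_sum[of x] by (metis scaleR_add_right)
    then show ?thesis using decomposition_unique subspace_H P_in subspace_scale by metis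
  qed
  show "linear Ppos" "linear Pneg" using * ** by (auto intro!: linearI)
qed

lemma norm_P: "(norm x)\<^sup>2 = (norm (Ppos x))\<^sup>2 + (norm (Pneg x))\<^sup>2"
proof -
  have "(norm (Ppos x + Pneg x))\<^sup>2 = (norm (Ppos x))\<^sup>2 + (norm (Pneg x))\<^sup>2"
    using Hpos_orth_Hneg[OF P_in, of x x]
    by (simp add: power2_norm_eq_inner inner_add_left inner_add_right inner_commute)
  then show ?thesis by (simp add: P_sum)
qed

lemma bounded_linear_P: "bounded_linear Ppos" "bounded_linear Pneg"
proof -
  have "(norm (Ppos x))\<^sup>2 \<le> (norm x)\<^sup>2" "(norm (Pneg x))\<^sup>2 \<le> (norm x)\<^sup>2" for x
    using norm_P[of x] by auto
  then have *: "norm (Ppos x) \<le> norm x * 1" "norm (Pneg x) \<le> norm x * 1" for x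
    by (auto intro: power2_le_imp_le)
  show "bounded_linear Ppos" using P_linear(1) *
    by (intro bounded_linear_intro[where K=1]) (auto simp: linear_add linear_scale)
  show "bounded_linear Pneg" using P_linear(2) *
    by (intro bounded_linear_intro[where K=1]) (auto simp: linear_add linear_scale)
qed

lemma eigen_image:
  assumes "linear U" "\<And>x y. (x, y) \<in> G \<Longrightarrow> (U x, U y) \<in> G"
  shows "x \<in> Epos \<Longrightarrow> U x \<in> Epos" "x \<in> Eneg \<Longrightarrow> U x \<in> Eneg"
  using assms unfolding Epos_def Eneg_def by (force simp: linear_scale)+

lemma H_image:
  assumes "bounded_linear U" "\<And>x y. (x, y) \<in> G \<Longrightarrow> (U x, U y) \<in> G"
  shows "x \<in> Hpos \<Longrightarrow> U x \<in> Hpos" "x \<in> Hneg \<Longrightarrow> U x \<in> Hneg"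
proof -
  note e = eigen_image[OF bounded_linear.linear[OF assms(1)] assms(2)]
  show "x \<in> Hpos \<Longrightarrow> U x \<in> Hpos" unfolding Hpos_def
    by (rule linear_image_closure_span_subset[OF assms(1)]) (use e E_subset in \<open>auto simp: Hpos_def\<close>)
  show "x \<in> Hneg \<Longrightarrow> U x \<in> Hneg" unfolding Hneg_def
    by (rule linear_image_closure_span_subset[OF assms(1)]) (use e E_subset in \<open>auto simp: Hneg_def\<close>)
qed

text \<open>\<open>U\<close> maps each spectral subspace into itself, so it carries the
  decomposition of \<open>x\<close> to that of \<open>U x\<close>.\<close>

lemma P_commute:
  assumes "bounded_linear U" "\<And>x y. (x, y) \<in> G \<Longrightarrow> (U x, U y) \<in> G"
  shows "Ppos (U x) = U (Ppos x)" "Pneg (U x) = U (Pneg x)"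
proof -
  have "U x = U (Ppos x) + U (Pneg x)"
    using P_sum[of x] linear_add[OF bounded_linear.linear[OF assms(1)]] by metis
  then show "Ppos (U x) = U (Ppos x)" "Pneg (U x) = U (Pneg x)"
    using decomposition_unique H_image[OF assms] P_in by metis+
qed

text \<open>An element of \<open>G\<close> orthogonal to all \<open>(e, r e)\<close> is \<open>(x, y)\<close> with \<open>(1 + r\<^sup>2) (x, e) = 0\<close>, by symmetry;
  hence the eigenvectors determine \<open>G\<close>.\<close>

lemma graph_eq_closure_eigenpairs:
  assumes E: "\<And>e. e \<in> E \<Longrightarrow> \<exists>r. (e, r *\<^sub>R e) \<in> G" and tot: "closure (span E) = UNIV"
  shows "G = closure (span {(e, r *\<^sub>R e) | e r. e \<in> E \<and> (e, r *\<^sub>R e) \<in> G})"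
proof -
  let ?B = "{(e, r *\<^sub>R e) | e r. e \<in> E \<and> (e, r *\<^sub>R e) \<in> G}"
  let ?S = "closure (span ?B)"
  have S: "subspace ?S" "closed ?S" by (auto intro: subspace_closure_span)
  have "span ?B \<subseteq> G" by (rule span_minimal) (auto intro: subspace_G)
  then have sub: "?S \<subseteq> G" by (rule closure_minimal) (rule closed_G)
  have "z \<in> ?S" if z: "z \<in> G" for z
  proof -
    define w where "w = z - oproj ?S z"
    have "w \<in> G" unfolding w_def using oproj_in[OF S] sub z subspace_G by (blast intro: subspace_diff)
    then obtain x y where w: "w = (x, y)" and xy: "(x, y) \<in> G" by (metis surj_pair)
    have *: "inner x e = 0 \<and> inner y e = 0" if e: "e \<in> E" for e
    proof -
      obtain r where r: "(e, r *\<^sub>R e) \<in> G" using E e by blast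
      have "(e, r *\<^sub>R e) \<in> ?S"
        by (rule subsetD[OF closure_subset], rule span_base) (use e r in blast)
      then have "inner w (e, r *\<^sub>R e) = 0" unfolding w_def by (rule oproj_orth[OF S])
      then have "inner x e + r * inner y e = 0" by (simp add: w)
      moreover have "inner y e = r * inner x e" using symmetric[OF xy r] by simp
      ultimately have "(1 + r\<^sup>2) * inner x e = 0" by (simp add: algebra_simps power2_eq_square)
      moreover have "1 + r\<^sup>2 > 0" by (simp add: add_pos_nonneg)
      ultimately show ?thesis using \<open>inner y e = r * inner x e\<close> by simp
    qed
    have "inner x v = 0" "inner y v = 0" for v
      using inner_zero_closure_span[of E] * tot by auto
    then have "x = 0" "y = 0" using inner_eq_zero_iff by blast+
    then have "z = oproj ?S z" using w by (simp add: w_def zero_prod_def[symmetric])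
    then show ?thesis using oproj_in[OF S, of z] by metis
  qed
  with sub show ?thesis by blast
qed

text \<open>The graph is the closed span of its eigenpairs, hence a bounded map need only be tested
  there. This serves \<open>F\<close> and \<open>rho\<close>, whose effect on suitable eigenvectors
  is explicit.\<close>

lemma graph_invariant_if_eigenpairs:
  assumes E: "\<And>e. e \<in> E \<Longrightarrow> \<exists>r. (e, r *\<^sub>R e) \<in> G" and tot: "closure (span E) = UNIV"
    and U: "bounded_linear U" "\<And>e r. e \<in> E \<Longrightarrow> (e, r *\<^sub>R e) \<in> G \<Longrightarrow> (U e, U (r *\<^sub>R e)) \<in> G"
    and xy: "(x, y) \<in> G"
  shows "(U x, U y) \<in> G"
proof -
  let ?B = "{(e, r *\<^sub>R e) | e r. e \<in> E \<and> (e, r *\<^sub>R e) \<in> G}"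
  define V where "V z = (U (fst z), U (snd z))" for z
  have V: "bounded_linear V" unfolding V_def
    using U(1) by (intro bounded_linear_Pair bounded_linear_compose[OF U(1)] bounded_linear_fst bounded_linear_snd)
  have "closure (span G) = G" using subspace_G closed_G by (metis closure_closed span_eq_iff)
  moreover have "V (x, y) \<in> closure (span G)"
    by (rule linear_image_closure_span_subset[OF V, of ?B])
      (use U(2) xy graph_eq_closure_eigenpairs[OF E tot] \<open>closure (span G) = G\<close> in \<open>auto simp: V_def\<close>)
  ultimately show ?thesis by (simp add: V_def)
qed

end

text \<open>\<open>C\<close> plays the role of charge conjugation and \<open>J\<close> that of multiplication by \<open>\<i>\<close>.\<close>

locale conjugated_graph = symmetric_graph G for G :: "('a::{real_inner,complete_space} \<times> 'a) set" +
  fixes C J :: "'a \<Rightarrow> 'a"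
  assumes C: "bounded_linear C" "\<And>x. norm (C x) = norm x" "\<And>x. C (C x) = - x"
    "\<And>x y. (x, y) \<in> G \<Longrightarrow> (C x, C y) \<in> G"
    and J: "bounded_linear J" "\<And>x y. (x, y) \<in> G \<Longrightarrow> (J x, J y) \<in> G" "\<And>x. C (J x) = - J (C x)"
begin

definition "F x = Ppos x + C (Pneg x)"

lemma P_F: "Ppos (F x) = Ppos x" "Pneg (F x) = C (Pneg x)"
  unfolding F_def using decomposition_unique P_in H_image[OF C(1,4)] by auto

lemma bounded_linear_F: "bounded_linear F"
  unfolding F_def using bounded_linear_P C(1)
  by (intro bounded_linear_add bounded_linear_compose[OF C(1)])

lemma norm_F: "norm (F x) = norm x"
proof -
  have "(norm (F x))\<^sup>2 = (norm x)\<^sup>2" using norm_P[of "F x"] norm_P[of x] C(2) by (simp add: P_F)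
  then show ?thesis by simp
qed

text \<open>\<open>C\<close> squares to -1, so its inverse is \<open>- C\<close>; the argument of
  \<open>F\<close> is the resulting preimage of \<open>x\<close>.\<close>

lemma surj_F: "F (Ppos x - C (Pneg x)) = x"
proof -
  have "- C (Pneg x) \<in> Hneg" using P_in H_image[OF C(1,4)] subspace_H subspace_neg by blast
  then have "Ppos (Ppos x - C (Pneg x)) = Ppos x" "Pneg (Ppos x - C (Pneg x)) = - C (Pneg x)"
    using decomposition_unique[OF P_in(1)] by fastforce+
  then show ?thesis unfolding F_def
    using C(3) linear_neg[OF bounded_linear.linear[OF C(1)]] P_sum by simp
qed

text \<open>The sign from \<open>C J = - J C\<close> arises only on the negative part, where
  \<open>S = -1\<close> absorbs it; hence \<open>F\<close> is linear from the complex structure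
  \<open>J\<close> to the structure \<open>J S\<close>.\<close>

lemma F_J: "F (J x) = J (Ppos (F x) - Pneg (F x))"
  unfolding P_F by (simp add: F_def P_commute[OF J(1,2)] C(3) J(3) linear_diff[OF bounded_linear.linear[OF J(1)]])

lemma F_commute:
  assumes "bounded_linear U" "\<And>x y. (x, y) \<in> G \<Longrightarrow> (U x, U y) \<in> G" "\<And>x. C (U x) = U (C x)"
  shows "F (U x) = U (F x)"
  unfolding F_def by (simp add: P_commute[OF assms(1,2)] assms(3) linear_add[OF bounded_linear.linear[OF assms(1)]])

lemma F_graph:
  assumes "(x, y) \<in> G"
  shows "(F x, F y) \<in> G"
proof (rule graph_invariant_if_eigenpairs[OF _ _ bounded_linear_F _ assms])
  let ?E = "Epos \<union> Eneg"
  show "closure (span ?E) = UNIV"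
    using total unfolding Epos_def Eneg_def
    by (simp add: neq_iff conj_disj_distribR ex_disj_distrib Collect_disj_eq Un_commute)
  show "\<exists>r. (e, r *\<^sub>R e) \<in> G" if "e \<in> ?E" for e
    using that unfolding Epos_def Eneg_def by auto
  fix e r assume e: "e \<in> ?E" and r: "(e, r *\<^sub>R e) \<in> G"
  have lin: "F (r *\<^sub>R e) = r *\<^sub>R F e" using linear_scale[OF bounded_linear.linear[OF bounded_linear_F]] .
  \<comment> \<open>On each eigenvector one of the two projections vanishes, so \<open>F\<close>
    acts there as a map already known to preserve the graph.\<close>
  have "F e = e \<or> F e = C e"
  proof (cases "e \<in> Epos")
    case True
    then have "e \<in> Hpos" "0 \<in> Hneg" using E_subset subspace_0[OF subspace_H(2)] by auto
    then show ?thesis using decomposition_unique[of e 0] linear_0[OF bounded_linear.linear[OF C(1)]]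
      by (simp add: F_def)
  next
    case False
    then have "e \<in> Hneg" "0 \<in> Hpos" using e E_subset subspace_0[OF subspace_H(1)] by auto
    then show ?thesis using decomposition_unique[of 0 e] by (simp add: F_def)
  qed
  then show "(F e, F (r *\<^sub>R e)) \<in> G"
    using r C(4)[OF r] linear_scale[OF bounded_linear.linear[OF C(1)]] unfolding lin by auto
qed

end

section \<open>Square-integrable functions\<close>

text \<open>Completeness of \<open>L^2\<close> along a rapidly Cauchy sequence: the increments are
  summable in \<open>L^1\<close>, so the sequence converges a.e., and Fatou's lemma transfers the
  bound to the limit.\<close>

lemma (in prob_space) Riesz_Fischer_subsequence:
  fixes u :: "nat \<Rightarrow> 'a \<Rightarrow> 'b::{banach, second_countable_topology}"
  assumes u[measurable]: "\<And>n. u n \<in> borel_measurable M"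
    and le: "\<And>m n. n \<le> m \<Longrightarrow> (\<integral>\<^sup>+x. ennreal ((norm (u m x - u n x))\<^sup>2) \<partial>M) \<le> ennreal ((1/4)^n)"
  obtains f where "f \<in> borel_measurable M"
    "\<And>n. (\<integral>\<^sup>+x. ennreal ((norm (f x - u n x))\<^sup>2) \<partial>M) \<le> ennreal ((1/4)^n)"
proof -
  define f where "f x = lim (\<lambda>n. u n x)" for x
  have f[measurable]: "f \<in> borel_measurable M" unfolding f_def by measurable
  have L1: "(\<integral>\<^sup>+x. ennreal (norm (u (Suc n) x - u n x)) \<partial>M) \<le> ennreal ((1/2)^n)" for n
  proof -
    have "(\<integral>\<^sup>+x. ennreal (norm (u (Suc n) x - u n x)) \<partial>M)
        \<le> (\<integral>\<^sup>+x. ennreal (2^n/2) * ennreal ((norm (u (Suc n) x - u n x))\<^sup>2) + ennreal ((1/2)^n/2) \<partial>M)"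
    proof (rule nn_integral_mono)
      fix x
      let ?a = "norm (u (Suc n) x - u n x)"
      \<comment> \<open>The inequality of arithmetic and geometric means with weight
        \<open>2^n\<close>, chosen so that the square, of integral at most \<open>(1/4)^n\<close>,
        and the constant each contribute \<open>(1/2)^n / 2\<close>.\<close>
      have "?a \<le> 2^n/2 * ?a\<^sup>2 + (1/2)^n/2"
      proof -
        have "0 \<le> (2^n * ?a - 1)\<^sup>2 / (2 * 2^n)" by simp
        also have "\<dots> = 2^n/2 * ?a\<^sup>2 + (1/2)^n/2 - ?a"
          by (simp add: power2_eq_square field_simps power_one_over)
        finally show ?thesis by simp
      qed
      then show "ennreal ?a \<le> ennreal (2^n/2) * ennreal (?a\<^sup>2) + ennreal ((1/2)^n/2)"
        by (simp flip: ennreal_mult ennreal_plus del: ennreal_half)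
    qed
    also have "\<dots> = ennreal (2^n/2) * (\<integral>\<^sup>+x. ennreal ((norm (u (Suc n) x - u n x))\<^sup>2) \<partial>M) + ennreal ((1/2)^n/2)"
      by (subst nn_integral_add) (auto simp: nn_integral_cmult emeasure_space_1)
    also have "\<dots> \<le> ennreal (2^n/2) * ennreal ((1/4)^n) + ennreal ((1/2)^n/2)"
      using le[of n "Suc n"] by (intro add_mono mult_left_mono) auto
    also have "\<dots> = ennreal ((1/2)^n)"
    proof -
      have "(2::real)^n * (1/4)^n = (1/2)^n"
        by (subst power_mult_distrib[symmetric]) simp
      then have e: "2^n/2 * (1/4)^n + (1/2)^n/2 = ((1/2)^n :: real)" by simp
      have "ennreal (2^n/2) * ennreal ((1/4)^n) + ennreal ((1/2)^n/2) = ennreal (2^n/2 * (1/4)^n + (1/2)^n/2)"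
        by (simp only: ennreal_mult[symmetric] ennreal_plus[symmetric] divide_nonneg_nonneg zero_le_power zero_le_numeral zero_le_one mult_nonneg_nonneg)
      then show ?thesis unfolding e .
    qed
    finally show ?thesis .
  qed
  have "(\<integral>\<^sup>+x. (\<Sum>n. ennreal (norm (u (Suc n) x - u n x))) \<partial>M)
      = (\<Sum>n. \<integral>\<^sup>+x. ennreal (norm (u (Suc n) x - u n x)) \<partial>M)"
    by (intro nn_integral_suminf) simp
  also have "\<dots> \<le> (\<Sum>n. ennreal ((1/2)^n))" by (intro suminf_le L1) auto
  also have "\<dots> = ennreal (\<Sum>n. (1/2)^n)" by (intro suminf_ennreal_eq) (auto intro: summable_sums)
  also have "\<dots> < \<infinity>" by simp
  finally have "AE x in M. (\<Sum>n. ennreal (norm (u (Suc n) x - u n x))) \<noteq> \<infinity>"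
    by (intro nn_integral_PInf_AE) auto
  then have conv: "AE x in M. (\<lambda>n. u n x) \<longlonglongrightarrow> f x"
  proof eventually_elim
    case (elim x)
    then have "summable (\<lambda>n. norm (u (Suc n) x - u n x))"
      by (intro summable_suminf_not_top) auto
    then have "summable (\<lambda>n. u (Suc n) x - u n x)" by (rule summable_norm_cancel)
    then have "(\<lambda>n. u 0 x + (\<Sum>i<n. u (Suc i) x - u i x)) \<longlonglongrightarrow> u 0 x + (\<Sum>i. u (Suc i) x - u i x)"
      by (intro tendsto_add tendsto_const summable_LIMSEQ)
    then have "convergent (\<lambda>n. u n x)" by (auto simp: sum_lessThan_telescope[of "\<lambda>n. u n x"] convergent_def)
    then show ?case unfolding f_def by (simp add: convergent_LIMSEQ_iff)
  qed
  have "(\<integral>\<^sup>+x. ennreal ((norm (f x - u n x))\<^sup>2) \<partial>M) \<le> ennreal ((1/4)^n)" for n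
  proof -
    have "(\<integral>\<^sup>+x. ennreal ((norm (f x - u n x))\<^sup>2) \<partial>M)
        = (\<integral>\<^sup>+x. liminf (\<lambda>m. ennreal ((norm (u m x - u n x))\<^sup>2)) \<partial>M)"
    proof (rule nn_integral_cong_AE)
      show "AE x in M. ennreal ((norm (f x - u n x))\<^sup>2) = liminf (\<lambda>m. ennreal ((norm (u m x - u n x))\<^sup>2))"
        using conv
      proof eventually_elim
        case (elim x)
        then have "(\<lambda>m. ennreal ((norm (u m x - u n x))\<^sup>2)) \<longlonglongrightarrow> ennreal ((norm (f x - u n x))\<^sup>2)"
          by (intro tendsto_intros)
        then show ?case using lim_imp_Liminf trivial_limit_sequentially by metis
      qed
    qed
    also have "\<dots> \<le> liminf (\<lambda>m. \<integral>\<^sup>+x. ennreal ((norm (u m x - u n x))\<^sup>2) \<partial>M)"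
      by (rule nn_integral_liminf) simp
    also have "\<dots> \<le> ennreal ((1/4)^n)"
    proof -
      have "liminf (\<lambda>m. \<integral>\<^sup>+x. ennreal ((norm (u m x - u n x))\<^sup>2) \<partial>M) \<le> liminf (\<lambda>m. ennreal ((1/4)^n))"
        by (rule Liminf_mono) (use le in \<open>auto simp: eventually_sequentially intro!: exI[of _ n]\<close>)
      then show ?thesis by (simp add: Liminf_const)
    qed
    finally show ?thesis .
  qed
  with f show ?thesis by (rule that)
qed

text \<open>Polynomials are uniformly dense in the continuous functions, the indicator of a closed set is a limit of
  continuous functions, and closed sets generate the Borel sets.\<close>

lemma AE_zero_if_orthogonal_to_polynomials:
  fixes w :: "'a::euclidean_space \<Rightarrow> real"
  assumes M: "finite_measure M" "sets M = sets (restrict_space borel K)" and K: "compact K"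
    and w: "integrable M w"
    and poly: "\<And>p. real_polynomial_function p \<Longrightarrow> (\<integral>x. p x * w x \<partial>M) = 0"
  shows "AE x in M. w x = 0"
proof -
  interpret finite_measure M by fact
  have sp: "space M = K" using sets_eq_imp_space_eq[OF M(2)] by (simp add: space_restrict_space)
  have meas: "f \<in> borel_measurable M" if "continuous_on K f" for f :: "'a \<Rightarrow> real"
    using borel_measurable_continuous_on_restrict[OF that] measurable_cong_sets[OF M(2) refl] by blast
  have int: "integrable M (\<lambda>x. f x * w x)" if f: "continuous_on K f" for f
  proof -
    have "bounded (f ` K)" using compact_continuous_image[OF f K] compact_imp_bounded by blast
    then obtain B where B: "\<And>x. x \<in> K \<Longrightarrow> \<bar>f x\<bar> \<le> B" unfolding bounded_iff by auto
    show ?thesis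
    proof (rule Bochner_Integration.integrable_bound[of _ "\<lambda>x. B * w x"])
      show "integrable M (\<lambda>x. B * w x)" using w by simp
      show "(\<lambda>x. f x * w x) \<in> borel_measurable M" using meas[OF f] w by measurable
      show "AE x in M. norm (f x * w x) \<le> norm (B * w x)"
        using B by (intro AE_I2) (fastforce simp: sp abs_mult intro: mult_right_mono)
    qed
  qed
  have cont: "(\<integral>x. f x * w x \<partial>M) = 0" if f: "continuous_on K f" for f
  proof -
    have "\<bar>\<integral>x. f x * w x \<partial>M\<bar> \<le> e * (\<integral>x. \<bar>w x\<bar> \<partial>M)" if e: "e > 0" for e
    proof -
      obtain p where p: "real_polynomial_function p" "\<And>x. x \<in> K \<Longrightarrow> \<bar>f x - p x\<bar> < e"
        using Stone_Weierstrass_real_polynomial_function[OF K f e] by auto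
      have cp: "continuous_on K p" using p(1) continuous_on_polymonial_function real_polynomial_function_eq by blast
      have "(\<integral>x. f x * w x \<partial>M) = (\<integral>x. f x * w x \<partial>M) - (\<integral>x. p x * w x \<partial>M)" using poly[OF p(1)] by simp
      also have "\<dots> = (\<integral>x. (f x - p x) * w x \<partial>M)"
        by (simp add: int[OF f] int[OF cp] left_diff_distrib)
      finally have "\<bar>\<integral>x. f x * w x \<partial>M\<bar> \<le> (\<integral>x. \<bar>(f x - p x) * w x\<bar> \<partial>M)" by simp
      also have "\<dots> \<le> (\<integral>x. e * \<bar>w x\<bar> \<partial>M)"
      proof (rule integral_mono)
        show "integrable M (\<lambda>x. \<bar>(f x - p x) * w x\<bar>)"
          using int[OF continuous_on_diff[OF f cp]] by simp
        show "integrable M (\<lambda>x. e * \<bar>w x\<bar>)" using w by simp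
        show "\<bar>(f x - p x) * w x\<bar> \<le> e * \<bar>w x\<bar>" if "x \<in> space M" for x
          using p(2)[of x] that by (auto simp: sp abs_mult intro!: mult_right_mono)
      qed
      finally show ?thesis by simp
    qed
    then have "\<bar>\<integral>x. f x * w x \<partial>M\<bar> \<le> 0 * (\<integral>x. \<bar>w x\<bar> \<partial>M)"
    proof (intro tendsto_lowerbound[of "\<lambda>e. e * (\<integral>x. \<bar>w x\<bar> \<partial>M)" _ "at_right 0"])
      show "((\<lambda>e. e * (\<integral>x. \<bar>w x\<bar> \<partial>M)) \<longlongrightarrow> 0 * (\<integral>x. \<bar>w x\<bar> \<partial>M)) (at_right 0)" by (intro tendsto_intros)
    qed (auto simp: eventually_at_right_less eventually_at_filter)
    then show ?thesis by simp
  qed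
  have clos: "(\<integral>x. indicator C x * w x \<partial>M) = 0" if C: "closed C" for C
  \<comment> \<open>\<open>infdist\<close> to the empty set is 0 by convention, so the cut-off
    functions below would be constantly 1 for empty \<open>C\<close> instead of tending to its
    indicator.\<close>
  proof (cases "C = {}")
    case False
    define f where "f n x = max 0 (1 - real n * infdist x C)" for n x
    have cf: "continuous_on K (f n)" for n unfolding f_def by (intro continuous_intros)
    have "(\<lambda>n. \<integral>x. f n x * w x \<partial>M) \<longlonglongrightarrow> (\<integral>x. indicator C x * w x \<partial>M)"
    proof (rule integral_dominated_convergence[where w="\<lambda>x. \<bar>w x\<bar>"])
      have C': "C \<inter> K \<in> sets M" unfolding M(2) using C by (auto simp: sets_restrict_space)
      have "(\<lambda>x. indicator (C \<inter> K) x * w x) \<in> borel_measurable M" using C' w by measurable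
      then show "(\<lambda>x. indicator C x * w x) \<in> borel_measurable M"
        by (rule measurable_cong[THEN iffD1, rotated]) (auto simp: sp indicator_def)
      show "(\<lambda>x. f n x * w x) \<in> borel_measurable M" for n using int[OF cf] by blast
      show "integrable M (\<lambda>x. \<bar>w x\<bar>)" using w by simp
      show "AE x in M. (\<lambda>n. f n x * w x) \<longlonglongrightarrow> indicator C x * w x"
      proof (intro AE_I2 tendsto_mult tendsto_const)
        fix x
        show "(\<lambda>n. f n x) \<longlonglongrightarrow> indicator C x"
        proof (cases "x \<in> C")
          case True then show ?thesis by (simp add: f_def)
        next
          case x: False
          then have pos: "infdist x C > 0" using C False infdist_pos_not_in_closed by blast
          obtain N where N: "1 < real N * infdist x C" using reals_Archimedean3[OF pos] by blast
          have "f n x = 0" if "n \<ge> N" for n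
          proof -
            have "real N * infdist x C \<le> real n * infdist x C" using that pos by (intro mult_right_mono) auto
            then show ?thesis using N by (simp add: f_def)
          qed
          then have "\<forall>\<^sub>F n in sequentially. f n x = 0" unfolding eventually_sequentially by blast
          then show ?thesis using x by (simp add: tendsto_eventually)
        qed
      qed
      show "AE x in M. norm (f n x * w x) \<le> \<bar>w x\<bar>" for n
      proof (rule AE_I2)
        fix x
        have "\<bar>f n x\<bar> \<le> 1" unfolding f_def by (auto simp: max_def infdist_nonneg)
        then show "norm (f n x * w x) \<le> \<bar>w x\<bar>" by (simp add: abs_mult mult_left_le_one_le)
      qed
    qed
    then show ?thesis using cont[OF cf] LIMSEQ_unique[OF tendsto_const] by fastforce
  qed simp
  have sub: "B \<inter> K \<in> sets M" if "B \<in> sets borel" for B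
    unfolding M(2) using that by (auto simp: sets_restrict_space)
  have indint: "integrable M (\<lambda>x. indicator B x * w x)" if B: "B \<in> sets borel" for B
  proof -
    have "integrable M (\<lambda>x. indicator (B \<inter> K) x * w x)"
      using integrable_mult_indicator[OF sub[OF B] w] by (simp add: mult.commute)
    then show ?thesis by (rule Bochner_Integration.integrable_cong[THEN iffD1, rotated 2]) (auto simp: sp indicator_def)
  qed
  have all: "(\<integral>x. indicator B x * w x \<partial>M) = 0" if B: "B \<in> sets borel" for B
  proof -
    \<comment> \<open>Closed sets are stable under intersection and generate the Borel sets. The
      sets over which \<open>w\<close> integrates to zero are stable under disjoint countable
      unions, and under complements because \<open>UNIV\<close> is itself closed.\<close>
    have "Int_stable (Collect (closed :: 'a set \<Rightarrow> bool))" "Collect (closed :: 'a set \<Rightarrow> bool) \<subseteq> Pow UNIV"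
      "B \<in> sigma_sets UNIV (Collect closed)" using B by (auto simp: borel_eq_closed Int_stable_def)
    then show ?thesis
    proof (induction rule: sigma_sets_induct_disjoint)
      case (basic A) then show ?case using clos by simp
    next
      case (compl A)
      then have A: "A \<in> sets borel" by (simp add: borel_eq_closed)
      have "(\<integral>x. indicator (UNIV - A) x * w x \<partial>M) = (\<integral>x. w x - indicator A x * w x \<partial>M)"
        by (intro Bochner_Integration.integral_cong) (auto simp: indicator_def)
      also have "\<dots> = (\<integral>x. indicator UNIV x * w x \<partial>M) - (\<integral>x. indicator A x * w x \<partial>M)" using w indint[OF A] by simp
      finally show ?case using compl clos[of UNIV] by simp
    next
      case empty show ?case by simp
    next
      case (union A)
      then have A: "\<And>i. A i \<in> sets borel" by (auto simp: borel_eq_closed)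
      have "(\<lambda>n. \<integral>x. indicator (\<Union>i<n. A i) x * w x \<partial>M) \<longlonglongrightarrow> (\<integral>x. indicator (\<Union>i. A i) x * w x \<partial>M)"
      proof (rule integral_dominated_convergence[where w="\<lambda>x. \<bar>w x\<bar>"])
        show "AE x in M. (\<lambda>n. indicator (\<Union>i<n. A i) x * w x) \<longlonglongrightarrow> indicator (\<Union>i. A i) x * w x"
          by (intro AE_I2 tendsto_mult tendsto_const LIMSEQ_indicator_UN)
        show "(\<lambda>x. indicator (\<Union>i. A i) x * w x) \<in> borel_measurable M"
          "(\<lambda>x. indicator (\<Union>i<n. A i) x * w x) \<in> borel_measurable M" for n
          using indint A by (blast intro: borel_measurable_integrable sets.countable_UN sets.finite_UN)+
      qed (use w in \<open>auto simp: indicator_def\<close>)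
      moreover have "(\<integral>x. indicator (\<Union>i<n. A i) x * w x \<partial>M) = 0" for n
      proof -
        have "(\<integral>x. indicator (\<Union>i<n. A i) x * w x \<partial>M) = (\<integral>x. (\<Sum>i<n. indicator (A i) x * w x) \<partial>M)"
        proof (intro Bochner_Integration.integral_cong refl)
          fix x
          have "indicator (\<Union>i<n. A i) x = (\<Sum>i<n. indicator (A i) x :: real)"
            by (rule indicator_UN_disjoint) (use union(1) in \<open>auto intro: disjoint_family_on_mono\<close>)
          then show "indicator (\<Union>i<n. A i) x * w x = (\<Sum>i<n. indicator (A i) x * w x)"
            by (simp add: sum_distrib_right)
        qed
        also have "\<dots> = 0" by (subst Bochner_Integration.integral_sum) (use indint A union in auto)
        finally show ?thesis .
      qed
      ultimately show ?case using LIMSEQ_unique[OF tendsto_const] by fastforce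
    qed
  qed
  show ?thesis
  proof (rule density_zero[OF w])
    fix A assume "A \<in> sets M"
    then obtain B where B: "B \<in> sets borel" "A = K \<inter> B" unfolding M(2) by (auto simp: sets_restrict_space)
    have "set_lebesgue_integral M A w = (\<integral>x. indicator B x * w x \<partial>M)"
      unfolding set_lebesgue_integral_def B(2)
      by (intro Bochner_Integration.integral_cong) (auto simp: sp indicator_def)
    then show "set_lebesgue_integral M A w = 0" using all[OF B(1)] by simp
  qed
qed

section \<open>The group \<open>SU(2)\<close> and its Haar measure\<close>

lemma mat2_eq_iff: "(A :: mat2) = B \<longleftrightarrow> A$1$1 = B$1$1 \<and> A$1$2 = B$1$2 \<and> A$2$1 = B$2$1 \<and> A$2$2 = B$2$2"
  by (simp add: vec_eq_iff forall_2)

lemma mat2_mult_nth: "((A :: mat2) ** B) $ i $ j = A$i$1 * B$1$j + A$i$2 * B$2$j"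
  by (simp add: matrix_matrix_mult_def sum_2)

lemma mat2_mult_vec_nth: "((A :: mat2) *v x) $ i = A$i$1 * x$1 + A$i$2 * x$2"
  by (simp add: matrix_vector_mult_def sum_2)

lemma mat2_1_nth: "(mat 1 :: mat2) $ i $ j = (if i = j then 1 else 0)"
  by (simp add: mat_def)

lemmas scaleR_complex = scaleR_conv_of_real[where 'a = complex]

lemma cadj_nth: "cadj A $ i $ j = cnj (A$j$i)"
  by (simp add: cadj_def)

lemma cadj_mult: "cadj (A ** B) = cadj B ** cadj A"
  by (simp add: mat2_eq_iff cadj_nth mat2_mult_nth mult.commute)

lemma cadj_cadj [simp]: "cadj (cadj A) = A"
  by (simp add: mat2_eq_iff cadj_nth)

lemma cadj_1 [simp]: "cadj (mat 1) = mat 1"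
  by (simp add: mat2_eq_iff cadj_nth mat2_1_nth)

lemma det_cadj: "det (cadj A) = cnj (det A)"
  by (simp add: det_2 cadj_nth mult.commute)

lemma SU2_mult: "g \<in> SU2 \<Longrightarrow> h \<in> SU2 \<Longrightarrow> g ** h \<in> SU2"
  unfolding SU2_def by (auto simp: cadj_mult det_mul) (metis matrix_mul_assoc matrix_mul_rid)

lemma SU2_cancel:
  assumes "g \<in> SU2"
  shows "g ** cadj g = mat 1" "cadj g ** g = mat 1"
  using assms matrix_left_right_inverse[of g "cadj g"] by (auto simp: SU2_def)

lemma SU2_cadj: "g \<in> SU2 \<Longrightarrow> cadj g \<in> SU2"
  using SU2_cancel[of g] by (simp add: SU2_def det_cadj)

lemma SU2_1: "mat 1 \<in> SU2"
  by (simp add: SU2_def mat2_eq_iff cadj_nth mat2_mult_nth mat2_1_nth det_2)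

text \<open>For determinant 1 the inverse is the adjugate, and unitarity says that it is the
  adjoint. The proof writes each difference as a combination of the defining equations.\<close>

lemma SU2_entries:
  assumes "g \<in> SU2"
  shows "g$2$2 = cnj (g$1$1)" "g$2$1 = - cnj (g$1$2)"
proof -
  let ?a = "g$1$1" and ?b = "g$1$2" and ?c = "g$2$1" and ?d = "g$2$2"
  have 1: "?a * cnj ?a + ?b * cnj ?b = 1" and 2: "?c * cnj ?a + ?d * cnj ?b = 0" and 3: "?a * ?d - ?b * ?c = 1"
    using assms by (auto simp: SU2_def mat2_eq_iff cadj_nth mat2_mult_nth mat2_1_nth det_2)
  have "?d - cnj ?a = ?d * (1 - (?a * cnj ?a + ?b * cnj ?b)) + cnj ?a * (?a * ?d - ?b * ?c - 1)
      + ?b * (?c * cnj ?a + ?d * cnj ?b)" by (simp add: algebra_simps)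
  then show "?d = cnj ?a" using 1 2 3 by simp
  have "?c + cnj ?b = ?c * (1 - (?a * cnj ?a + ?b * cnj ?b)) - cnj ?b * (?a * ?d - ?b * ?c - 1)
      + ?a * (?c * cnj ?a + ?d * cnj ?b)" by (simp add: algebra_simps)
  then show "?c = - cnj ?b" using 1 2 3 by (simp add: eq_neg_iff_add_eq_0)
qed

lemma continuous_on_mat2_mult [continuous_intros]:
  fixes f g :: "'a::topological_space \<Rightarrow> mat2"
  assumes "continuous_on S f" "continuous_on S g"
  shows "continuous_on S (\<lambda>x. f x ** g x)"
  unfolding matrix_matrix_mult_def by (intro continuous_intros assms)

subsection \<open>Quaternions\<close>

text \<open>The quaternions as 2x2 matrices, in coordinates of \<open>R^4\<close>. The determinant
  is the squared norm, so \<open>SU2\<close> is the unit sphere and multiplication by its elements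
  is an orthogonal map.\<close>

definition quat :: "real^4 \<Rightarrow> mat2" where
  "quat x = (\<chi> i j. if i = 1 then (if j = 1 then Complex (x$1) (x$2) else Complex (x$3) (x$4))
                    else (if j = 1 then - cnj (Complex (x$3) (x$4)) else cnj (Complex (x$1) (x$2))))"

definition quat_inv :: "mat2 \<Rightarrow> real^4" where
  "quat_inv A = vector [Re (A$1$1), Im (A$1$1), Re (A$1$2), Im (A$1$2)]"

lemma vector_4_nth: "(vector [a, b, c, d] :: real^4) $ 1 = a" "(vector [a, b, c, d] :: real^4) $ 2 = b"
    "(vector [a, b, c, d] :: real^4) $ 3 = c" "(vector [a, b, c, d] :: real^4) $ 4 = d"
  unfolding vector_def by simp_all

lemma quat_nth: "quat x $ 1 $ 1 = Complex (x$1) (x$2)" "quat x $ 1 $ 2 = Complex (x$3) (x$4)"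
    "quat x $ 2 $ 1 = - cnj (Complex (x$3) (x$4))" "quat x $ 2 $ 2 = cnj (Complex (x$1) (x$2))"
  by (simp_all add: quat_def)

lemma quat_quat_inv: "A$2$2 = cnj (A$1$1) \<Longrightarrow> A$2$1 = - cnj (A$1$2) \<Longrightarrow> quat (quat_inv A) = A"
  by (simp add: mat2_eq_iff quat_nth quat_inv_def vector_4_nth complex_eq_iff)

lemma linear_quat_inv: "linear quat_inv"
  by (auto intro!: linearI simp: quat_inv_def vec_eq_iff forall_4 vector_4_nth)

lemma linear_quat: "linear quat"
  by (auto intro!: linearI simp: mat2_eq_iff quat_nth complex_eq_iff)

lemma det_quat: "det (quat x) = complex_of_real ((norm x)\<^sup>2)"
  by (simp add: det_2 quat_nth norm_vec_def L2_set_def sum_4 complex_eq_iff power2_eq_square)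

lemma quat_SU2: "norm x = 1 \<Longrightarrow> quat x \<in> SU2"
proof -
  assume "norm x = 1"
  then have d: "det (quat x) = 1" using det_quat[of x] by simp
  then have "quat x ** cadj (quat x) = mat 1"
    by (simp add: det_2 mat2_eq_iff mat2_mult_nth cadj_nth mat2_1_nth quat_nth algebra_simps)
  with d show ?thesis by (simp add: SU2_def)
qed

lemma SU2_eq: "SU2 = quat ` sphere 0 1"
proof safe
  fix g assume g: "g \<in> SU2"
  have q: "quat (quat_inv g) = g" using SU2_entries[OF g] by (rule quat_quat_inv)
  have "(norm (quat_inv g))\<^sup>2 = 1"
    using det_quat[of "quat_inv g"] g by (simp add: q SU2_def flip: of_real_power)
  then have "quat_inv g \<in> sphere 0 1" using power2_eq_1_iff[of "norm (quat_inv g)"] norm_ge_zero[of "quat_inv g"] by auto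
  then show "g \<in> quat ` sphere 0 1" using q by (metis image_eqI)
qed (simp add: quat_SU2)

lemma continuous_on_quat: "continuous_on S quat"
  using linear_continuous_on linear_conv_bounded_linear linear_quat by blast

lemma compact_SU2: "compact SU2"
  unfolding SU2_eq by (intro compact_continuous_image continuous_on_quat compact_sphere)

abbreviation bSU2 :: "mat2 measure" where
  "bSU2 \<equiv> restrict_space borel SU2"

lemma measurable_SU2_mult: "(\<lambda>(x, y). x ** y) \<in> measurable (bSU2 \<Otimes>\<^sub>M bSU2) bSU2"
proof (rule measurable_restrict_space2)
  show "(\<lambda>(x, y). x ** y) \<in> space (bSU2 \<Otimes>\<^sub>M bSU2) \<rightarrow> SU2"
    by (auto simp: space_pair_measure space_restrict_space SU2_mult)
  have id: "(\<lambda>x. x) \<in> borel_measurable bSU2" by (rule measurable_restrict_space1) simp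
  have "(\<lambda>z. fst z ** snd z) \<in> borel_measurable (bSU2 \<Otimes>\<^sub>M bSU2)"
    by (rule borel_measurable_continuous_Pair)
      (auto intro!: continuous_intros measurable_compose[OF measurable_fst id] measurable_compose[OF measurable_snd id])
  then show "(\<lambda>(x, y). x ** y) \<in> borel_measurable (bSU2 \<Otimes>\<^sub>M bSU2)" by (simp add: case_prod_beta)
qed

lemma measurable_SU2_translate:
  assumes "g \<in> SU2" "h \<in> SU2"
  shows "(\<lambda>x. g ** x ** h) \<in> measurable bSU2 bSU2"
proof (rule measurable_restrict_space2)
  show "(\<lambda>x. g ** x ** h) \<in> space bSU2 \<rightarrow> SU2" using assms by (auto simp: space_restrict_space SU2_mult)
  show "(\<lambda>x. g ** x ** h) \<in> borel_measurable bSU2"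
    by (intro borel_measurable_continuous_on_restrict continuous_intros)
qed

lemma SU2_translate_inverse:
  assumes "g \<in> SU2" "h \<in> SU2"
  shows "cadj g ** (g ** x ** h) ** cadj h = x" "g ** (cadj g ** x ** cadj h) ** h = x"
  using SU2_cancel[OF assms(1)] SU2_cancel[OF assms(2)]
  by (metis matrix_mul_assoc matrix_mul_lid matrix_mul_rid)+

lemma SU2_translate_image:
  assumes "g \<in> SU2" "h \<in> SU2" and A: "A \<in> sets bSU2"
  shows "(\<lambda>x. g ** x ** h) ` A = (\<lambda>x. cadj g ** x ** cadj h) -` A \<inter> SU2" "(\<lambda>x. g ** x ** h) ` A \<in> sets bSU2"
proof -
  have "A \<subseteq> SU2" using sets.sets_into_space[OF A] by (simp add: space_restrict_space)
  then show *: "(\<lambda>x. g ** x ** h) ` A = (\<lambda>x. cadj g ** x ** cadj h) -` A \<inter> SU2"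
    using SU2_translate_inverse[OF assms(1,2)] assms(1,2) SU2_mult
    by (auto simp: image_iff subset_iff) metis+
  show "(\<lambda>x. g ** x ** h) ` A \<in> sets bSU2" unfolding *
    using measurable_sets[OF measurable_SU2_translate[OF SU2_cadj SU2_cadj] A] assms(1,2)
    by (simp add: space_restrict_space)
qed

subsection \<open>Existence and uniqueness of Haar measure\<close>

definition punctured_ball :: "(real^4) set" where "punctured_ball = ball 0 1 - {0}"

text \<open>Radial projection to the unit sphere. Its value at 0, the identity matrix, is a
  convention that makes it map everywhere into \<open>SU2\<close>; the punctured ball avoids that
  point.\<close>

definition quat_dir :: "real^4 \<Rightarrow> mat2" where
  "quat_dir x = quat (if x = 0 then axis 1 1 else x /\<^sub>R norm x)"

text \<open>The cone measure: the share of the unit ball that lies over a set. It is invariant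
  because SU(2) acts on \<open>R^4\<close> from both sides by orthogonal maps, which preserve volume
  and commute with radial projection.\<close>

definition radial_haar :: "mat2 measure" where
  "radial_haar = distr (uniform_measure lborel punctured_ball) bSU2 quat_dir"

lemma quat_dir_SU2: "quat_dir x \<in> SU2"
  unfolding quat_dir_def by (rule quat_SU2) simp

lemma measurable_quat_dir: "quat_dir \<in> measurable borel bSU2"
proof (rule measurable_restrict_space2)
  show "quat_dir \<in> space borel \<rightarrow> SU2" using quat_dir_SU2 by auto
  have q: "quat \<in> borel_measurable borel" by (intro borel_measurable_continuous_onI continuous_on_quat)
  have "(\<lambda>x::real^4. if x = 0 then axis 1 1 else x /\<^sub>R norm x) \<in> borel_measurable borel" by measurable
  from measurable_compose[OF this q] show "quat_dir \<in> borel_measurable borel" unfolding quat_dir_def .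
qed

lemma punctured_ball_measure:
  "punctured_ball \<in> sets borel" "emeasure lborel punctured_ball \<noteq> 0" "emeasure lborel punctured_ball \<noteq> \<infinity>"
proof -
  show "punctured_ball \<in> sets borel" by (simp add: punctured_ball_def)
  have "emeasure lborel punctured_ball = emeasure lborel (ball (0::real^4) 1)"
    unfolding punctured_ball_def by (subst emeasure_Diff) auto
  moreover have "emeasure lborel (ball (0::real^4) 1) \<noteq> \<infinity>"
    using emeasure_lborel_ball_finite[of "0::real^4" 1] by auto
  moreover have "emeasure lborel (ball (0::real^4) 1) \<noteq> 0"
    using open_not_negligible[of "ball (0::real^4) 1"]
    by (auto simp: negligible_iff_null_sets null_sets_def)
  ultimately show "emeasure lborel punctured_ball \<noteq> 0" "emeasure lborel punctured_ball \<noteq> \<infinity>" by auto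
qed

lemma prob_radial_haar: "prob_space radial_haar"
  unfolding radial_haar_def
  by (intro prob_space.prob_space_distr prob_space_uniform_measure punctured_ball_measure)
    (use measurable_quat_dir measurable_cong_sets[of "uniform_measure lborel punctured_ball" borel] in auto)

lemma sets_radial_haar: "sets radial_haar = sets bSU2"
  by (simp add: radial_haar_def)

lemma emeasure_radial_haar:
  assumes "A \<in> sets bSU2"
  shows "emeasure radial_haar A = emeasure lborel (punctured_ball \<inter> quat_dir -` A) / emeasure lborel punctured_ball"
proof -
  have "quat_dir -` A \<in> sets borel" using measurable_sets[OF measurable_quat_dir assms] by simp
  then show ?thesis unfolding radial_haar_def using assms measurable_quat_dir punctured_ball_measure
    by (subst emeasure_distr) (auto simp: measurable_cong_sets[of "uniform_measure lborel punctured_ball" borel])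
qed

text \<open>Multiplication from both sides is an orthogonal map \<open>L\<close> of
  \<open>R^4\<close>: it is linear and preserves the determinant, which is the squared norm.
  Uniqueness of Haar measure and the operators \<open>rho\<close> both rely on the two-sided
  form.\<close>

lemma radial_haar_invariant:
  assumes g: "g \<in> SU2" and h: "h \<in> SU2" and A: "A \<in> sets bSU2"
  shows "emeasure radial_haar ((\<lambda>x. g ** x ** h) ` A) = emeasure radial_haar A"
proof -
  define L where "L x = quat_inv (g ** quat x ** h)" for x
  have q: "quat (L x) = g ** quat x ** h" for x
    unfolding L_def using SU2_entries[OF g] SU2_entries[OF h]
    by (intro quat_quat_inv) (simp_all add: mat2_mult_nth quat_nth algebra_simps)
  have nL: "norm (L x) = norm x" for x
  proof -
    have "det (quat (L x)) = det (quat x)" using g h unfolding q by (simp add: det_mul SU2_def)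
    then have "(norm (L x))\<^sup>2 = (norm x)\<^sup>2" unfolding det_quat by (simp only: of_real_eq_iff)
    then show ?thesis by simp
  qed
  have linL: "linear L"
  proof (rule linearI)
    have m: "g ** (X + Y) ** h = g ** X ** h + g ** Y ** h" "g ** (c *\<^sub>R X) ** h = c *\<^sub>R (g ** X ** h)" for X Y c
      by (simp_all add: mat2_eq_iff mat2_mult_nth algebra_simps)
    show "L (x + y) = L x + L y" "L (c *\<^sub>R x) = c *\<^sub>R L x" for x y c
      unfolding L_def linear_add[OF linear_quat] linear_scale[OF linear_quat] m
      by (simp_all add: linear_add[OF linear_quat_inv] linear_scale[OF linear_quat_inv])
  qed
  have orth: "orthogonal_transformation L" using linL nL by (simp add: orthogonal_transformation)
  have dirL: "quat_dir (L x) = g ** quat_dir x ** h" if "x \<noteq> 0" for x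
  proof -
    have "L x \<noteq> 0" using nL that by (metis norm_eq_zero)
    then have "quat_dir (L x) = quat (L (x /\<^sub>R norm x))"
      unfolding quat_dir_def by (simp add: nL linear_scale[OF linL])
    then show ?thesis using that by (simp add: q quat_dir_def)
  qed
  let ?gA = "(\<lambda>x. g ** x ** h) ` A"
  let ?S = "punctured_ball \<inter> quat_dir -` A"
  note gA = SU2_translate_image[OF g h A]
  have S: "?S \<in> sets borel" using measurable_sets[OF measurable_quat_dir A] punctured_ball_measure by auto
  have S': "punctured_ball \<inter> quat_dir -` ?gA \<in> sets borel"
    using measurable_sets[OF measurable_quat_dir gA(2)] punctured_ball_measure by auto
  have img: "punctured_ball \<inter> quat_dir -` ?gA = L ` ?S"
  proof (intro set_eqI iffI)
    fix y assume y: "y \<in> punctured_ball \<inter> quat_dir -` ?gA"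
    obtain x where x: "y = L x" using orthogonal_transformation_surj[OF orth] by blast
    then have x': "x \<in> punctured_ball" using y nL by (auto simp: punctured_ball_def linear_0[OF linL])
    have "quat_dir y \<in> ?gA" using y by simp
    then have "g ** quat_dir x ** h \<in> ?gA" using dirL x x' by (auto simp: punctured_ball_def)
    then have "quat_dir x \<in> A" using SU2_translate_inverse[OF g h] by (auto simp: image_iff) (metis)
    with x x' show "y \<in> L ` ?S" by auto
  next
    fix y assume "y \<in> L ` ?S"
    then obtain x where "y = L x" "x \<in> punctured_ball" "quat_dir x \<in> A" by auto
    then show "y \<in> punctured_ball \<inter> quat_dir -` ?gA"
      using dirL nL by (auto simp: punctured_ball_def) (metis norm_eq_zero)
  qed
  have "?S \<in> lmeasurable"
    by (rule bounded_set_imp_lmeasurable)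
      (use S in \<open>auto simp: punctured_ball_def intro: bounded_subset[OF bounded_ball[of 0 1]]\<close>)
  then have "L ` ?S \<in> lmeasurable" "measure lebesgue (L ` ?S) = measure lebesgue ?S"
    using measurable_orthogonal_image[OF orth] measure_orthogonal_image[OF orth] by auto
  then have "emeasure lebesgue (L ` ?S) = emeasure lebesgue ?S"
    using \<open>?S \<in> lmeasurable\<close> by (simp add: emeasure_eq_measure2 fmeasurableD2)
  then have "emeasure lborel (punctured_ball \<inter> quat_dir -` ?gA) = emeasure lborel ?S"
    using S S' unfolding img by simp
  then show ?thesis by (simp add: emeasure_radial_haar A gA(2))
qed

text \<open>The two ways of integrating the convolution with the bi-invariant measure \<open>radial_haar\<close> agree.\<close>

lemma haar_unique:
  assumes M: "prob_space M" "sets M = sets bSU2"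
    and inv: "\<And>g A. g \<in> SU2 \<Longrightarrow> A \<in> sets M \<Longrightarrow> emeasure M ((\<lambda>x. g ** x) ` A) = emeasure M A"
  shows "M = radial_haar"
proof (rule measure_eqI)
  show "sets M = sets radial_haar" by (simp add: M sets_radial_haar)
  fix A assume "A \<in> sets M"
  then have A: "A \<in> sets bSU2" by (simp add: M)
  interpret M: prob_space M by fact
  interpret R: prob_space radial_haar by (rule prob_radial_haar)
  interpret pair_sigma_finite radial_haar M ..
  have sp: "space M = SU2" "space radial_haar = SU2"
    using sets_eq_imp_space_eq[OF M(2)] sets_eq_imp_space_eq[OF sets_radial_haar] by (auto simp: space_restrict_space)
  have pm: "(\<lambda>(x, y). x ** y) \<in> measurable (radial_haar \<Otimes>\<^sub>M M) bSU2"
    using measurable_SU2_mult measurable_cong_sets[OF sets_pair_measure_cong[OF sets_radial_haar M(2)] refl] by blast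
  have meas: "(\<lambda>(x, y). indicator A (x ** y) :: ennreal) \<in> borel_measurable (radial_haar \<Otimes>\<^sub>M M)"
    using measurable_compose[OF pm borel_measurable_indicator[OF A]] by (simp add: split_beta')
  have "(\<integral>\<^sup>+y. indicator A (x ** y) \<partial>M) = emeasure M A" if x: "x \<in> SU2" for x
  proof -
    have "emeasure M ((\<lambda>y. cadj x ** y ** mat 1) ` A) = emeasure M A"
      using inv[OF SU2_cadj[OF x]] A by (simp add: M)
    moreover have "(\<integral>\<^sup>+y. indicator A (x ** y) \<partial>M) = (\<integral>\<^sup>+y. indicator ((\<lambda>y. cadj x ** y ** mat 1) ` A) y \<partial>M)"
      using SU2_translate_image(1)[OF SU2_cadj[OF x] SU2_1 A]
      by (intro nn_integral_cong) (auto simp: sp indicator_def)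
    moreover have "(\<lambda>y. cadj x ** y ** mat 1) ` A \<in> sets M"
      unfolding M using SU2_translate_image(2)[OF SU2_cadj[OF x] SU2_1 A] .
    ultimately show ?thesis by simp
  qed
  then have "(\<integral>\<^sup>+x. \<integral>\<^sup>+y. indicator A (x ** y) \<partial>M \<partial>radial_haar) = (\<integral>\<^sup>+x. emeasure M A \<partial>radial_haar)"
    by (intro nn_integral_cong) (simp add: sp)
  also have "\<dots> = emeasure M A" by (simp add: R.emeasure_space_1)
  finally have 1: "(\<integral>\<^sup>+x. \<integral>\<^sup>+y. indicator A (x ** y) \<partial>M \<partial>radial_haar) = emeasure M A" .
  \<comment> \<open>Here right invariance enters, and for \<open>radial_haar\<close>; of
    \<open>M\<close> only left invariance is known.\<close>
  have "(\<integral>\<^sup>+x. indicator A (x ** y) \<partial>radial_haar) = emeasure radial_haar A" if y: "y \<in> SU2" for y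
  proof -
    have "emeasure radial_haar ((\<lambda>x. mat 1 ** x ** cadj y) ` A) = emeasure radial_haar A"
      by (rule radial_haar_invariant[OF SU2_1 SU2_cadj[OF y] A])
    moreover have "(\<integral>\<^sup>+x. indicator A (x ** y) \<partial>radial_haar)
        = (\<integral>\<^sup>+x. indicator ((\<lambda>x. mat 1 ** x ** cadj y) ` A) x \<partial>radial_haar)"
      using SU2_translate_image(1)[OF SU2_1 SU2_cadj[OF y] A]
      by (intro nn_integral_cong) (auto simp: sp indicator_def)
    moreover have "(\<lambda>x. mat 1 ** x ** cadj y) ` A \<in> sets radial_haar"
      unfolding sets_radial_haar using SU2_translate_image(2)[OF SU2_1 SU2_cadj[OF y] A] .
    ultimately show ?thesis by simp
  qed
  then have "(\<integral>\<^sup>+y. \<integral>\<^sup>+x. indicator A (x ** y) \<partial>radial_haar \<partial>M) = (\<integral>\<^sup>+y. emeasure radial_haar A \<partial>M)"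
    by (intro nn_integral_cong) (simp add: sp)
  also have "\<dots> = emeasure radial_haar A" by (simp add: M.emeasure_space_1)
  finally show "emeasure M A = emeasure radial_haar A" using 1 Fubini'[OF meas] by simp
qed

text \<open>Resolves the definite description; \<open>haar\<close> thereby inherits the right
  invariance that its definition does not mention.\<close>

lemma haar_eq: "haar = radial_haar"
  unfolding haar_def
proof (rule the_equality)
  have "emeasure radial_haar ((\<lambda>x. g ** x) ` A) = emeasure radial_haar A"
    if "g \<in> SU2" "A \<in> sets radial_haar" for g A
    using radial_haar_invariant[OF that(1) SU2_1] that(2) by (simp add: sets_radial_haar)
  then show "sets radial_haar = sets bSU2 \<and> prob_space radial_haar \<and>
      (\<forall>g\<in>SU2. \<forall>A\<in>sets radial_haar. emeasure radial_haar ((\<lambda>x. g ** x) ` A) = emeasure radial_haar A)"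
    by (simp add: sets_radial_haar prob_radial_haar)
qed (use haar_unique in blast)

lemma sets_haar: "sets haar = sets bSU2"
  by (simp add: haar_eq sets_radial_haar)

lemma space_haar: "space haar = SU2"
  using sets_eq_imp_space_eq[OF sets_haar] by (simp add: space_restrict_space)

global_interpretation haar: prob_space haar
  unfolding haar_eq by (rule prob_radial_haar)

lemma borel_measurable_haar: "continuous_on SU2 f \<Longrightarrow> f \<in> borel_measurable haar"
  using borel_measurable_continuous_on_restrict measurable_cong_sets[OF sets_haar refl] by blast

lemma measurable_haar_translate:
  "g \<in> SU2 \<Longrightarrow> h \<in> SU2 \<Longrightarrow> (\<lambda>x. g ** x ** h) \<in> measurable haar haar"
  using measurable_SU2_translate measurable_cong_sets[OF sets_haar sets_haar] by blast

lemma distr_haar_translate: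
  assumes g: "g \<in> SU2" and h: "h \<in> SU2"
  shows "distr haar haar (\<lambda>x. g ** x ** h) = haar"
proof (rule measure_eqI)
  fix A assume "A \<in> sets (distr haar haar (\<lambda>x. g ** x ** h))"
  then have A: "A \<in> sets haar" by simp
  then have "emeasure (distr haar haar (\<lambda>x. g ** x ** h)) A = emeasure haar ((\<lambda>x. g ** x ** h) -` A \<inter> SU2)"
    using measurable_haar_translate[OF assms] by (simp add: emeasure_distr space_haar)
  also have "(\<lambda>x. g ** x ** h) -` A \<inter> SU2 = (\<lambda>x. cadj g ** x ** cadj h) ` A"
    using SU2_translate_image(1)[OF SU2_cadj[OF g] SU2_cadj[OF h]] A by (simp add: sets_haar)
  also have "emeasure haar \<dots> = emeasure haar A"
    using radial_haar_invariant[OF SU2_cadj[OF g] SU2_cadj[OF h]] A by (simp add: haar_eq sets_radial_haar)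
  finally show "emeasure (distr haar haar (\<lambda>x. g ** x ** h)) A = emeasure haar A" .
qed simp

lemma integrable_haar:
  fixes f :: "mat2 \<Rightarrow> 'b::{banach, second_countable_topology}"
  assumes "continuous_on SU2 f"
  shows "integrable haar f"
proof -
  have "bounded (f ` SU2)" using compact_continuous_image[OF assms compact_SU2] compact_imp_bounded by blast
  then obtain B where "\<And>x. x \<in> SU2 \<Longrightarrow> norm (f x) \<le> B" unfolding bounded_iff by auto
  then show ?thesis using borel_measurable_haar[OF assms]
    by (intro haar.integrable_const_bound[of _ B] AE_I2) (auto simp: space_haar)
qed

lemma integral_haar_translate:
  fixes f :: "mat2 \<Rightarrow> 'b::{banach, second_countable_topology}"
  assumes "g \<in> SU2" "h \<in> SU2" "f \<in> borel_measurable haar"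
  shows "(\<integral>x. f (g ** x ** h) \<partial>haar) = (\<integral>x. f x \<partial>haar)"
  using integral_distr[OF measurable_haar_translate[OF assms(1,2)] assms(3)]
  by (simp add: distr_haar_translate[OF assms(1,2)])

subsection \<open>One-parameter subgroups\<close>

text \<open>The value of \<open>X_j\<close> at the identity. As \<open>pauli\<close> returns
  \<open>sigma_3\<close> at every index other than 1 and 2, \<open>gen j\<close> is
  \<open>gen 3\<close> there.\<close>

definition gen :: "nat \<Rightarrow> mat2" where "gen j = msc (- \<i>) (pauli j)"

definition expc :: "nat \<Rightarrow> real \<Rightarrow> mat2" where "expc j t = cos t *\<^sub>R mat 1 + sin t *\<^sub>R gen j"

lemma gen_nth:
  "gen j $ 1 $ 1 = (if j = 1 \<or> j = 2 then 0 else - \<i>)"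
  "gen j $ 1 $ 2 = (if j = 1 then - \<i> else if j = 2 then - 1 else 0)"
  "gen j $ 2 $ 1 = (if j = 1 then - \<i> else if j = 2 then 1 else 0)"
  "gen j $ 2 $ 2 = (if j = 1 \<or> j = 2 then 0 else \<i>)"
  by (auto simp: gen_def msc_def pauli_def)

lemma gen_square: "gen j ** gen j = - mat 1"
  by (simp add: mat2_eq_iff mat2_mult_nth mat2_1_nth gen_nth)

text \<open>Since \<open>gen j\<close> squares to -1, even powers give the cosine series and odd
  powers the sine series. The coefficients \<open>cos_coeff\<close> and \<open>sin_coeff\<close>
  vanish at the wrong parity, so the exponential series is matched term by term.\<close>

lemma mexp_gen: "mexp (msc (- \<i> * complex_of_real t) (pauli j)) = expc j t"
proof -
  let ?A = "msc (- \<i> * complex_of_real t) (pauli j)"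
  have A: "?A = t *\<^sub>R gen j" by (simp add: mat2_eq_iff msc_def gen_def scaleR_complex)
  have coeffs: "(1 / fact n) *\<^sub>R (((**) ?A) ^^ n) (mat 1)
      = (cos_coeff n *\<^sub>R t ^ n) *\<^sub>R mat 1 + (sin_coeff n *\<^sub>R t ^ n) *\<^sub>R gen j" for n
  proof (induction n)
    case 0 show ?case by simp
  next
    case (Suc n)
    have lin: "?A ** (c *\<^sub>R X) = c *\<^sub>R (?A ** X)" for c :: real and X :: mat2
      by (simp add: mat2_eq_iff mat2_mult_nth scaleR_complex algebra_simps)
    have "(1 / fact (Suc n)) *\<^sub>R (((**) ?A) ^^ Suc n) (mat 1)
        = (1 / real (Suc n)) *\<^sub>R (?A ** ((1 / fact n) *\<^sub>R (((**) ?A) ^^ n) (mat 1)))"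
      unfolding lin by (simp add: field_simps)
    also have "\<dots> = (1 / real (Suc n)) *\<^sub>R (?A ** ((cos_coeff n *\<^sub>R t ^ n) *\<^sub>R mat 1 + (sin_coeff n *\<^sub>R t ^ n) *\<^sub>R gen j))"
      unfolding Suc.IH ..
    also have "?A ** ((cos_coeff n *\<^sub>R t ^ n) *\<^sub>R mat 1 + (sin_coeff n *\<^sub>R t ^ n) *\<^sub>R gen j)
        = (cos_coeff n * t ^ Suc n) *\<^sub>R gen j + (sin_coeff n * t ^ Suc n) *\<^sub>R (gen j ** gen j)"
      unfolding A by (simp add: mat2_eq_iff mat2_mult_nth mat2_1_nth scaleR_complex algebra_simps)
    also have "(1 / real (Suc n)) *\<^sub>R \<dots> = (cos_coeff (Suc n) *\<^sub>R t ^ Suc n) *\<^sub>R mat 1 + (sin_coeff (Suc n) *\<^sub>R t ^ Suc n) *\<^sub>R gen j"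
      unfolding gen_square sin_coeff_Suc cos_coeff_Suc by (simp add: scaleR_right_diff_distrib)
    finally show ?case .
  qed
  have "(\<lambda>n. (cos_coeff n *\<^sub>R t ^ n) *\<^sub>R (mat 1 :: mat2) + (sin_coeff n *\<^sub>R t ^ n) *\<^sub>R gen j) sums expc j t"
    unfolding expc_def
    by (intro sums_add bounded_linear.sums[OF bounded_linear_scaleR_left] cos_converges sin_converges)
  then show ?thesis unfolding mexp_def coeffs by (rule sums_unique[symmetric])
qed

lemma expc_0: "expc j 0 = mat 1"
  by (simp add: expc_def)

lemma expc_add: "expc j (s + t) = expc j s ** expc j t"
proof -
  have "expc j s ** expc j t = (cos s * cos t) *\<^sub>R mat 1 + (sin s * cos t + cos s * sin t) *\<^sub>R gen j + (sin s * sin t) *\<^sub>R (gen j ** gen j)"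
    unfolding expc_def by (simp add: mat2_eq_iff mat2_mult_nth mat2_1_nth scaleR_complex algebra_simps)
  then show ?thesis unfolding gen_square
    by (simp add: expc_def cos_add sin_add scaleR_left_diff_distrib)
qed

lemma expc_SU2: "expc j t \<in> SU2"
proof -
  have e: "complex_of_real (cos t) * complex_of_real (cos t) + complex_of_real (sin t) * complex_of_real (sin t) = 1"
    unfolding of_real_mult[symmetric] of_real_add[symmetric] by (simp only: power2_eq_square[symmetric] sin_cos_squared_add2 of_real_1)
  show ?thesis
    unfolding SU2_def mem_Collect_eq mat2_eq_iff mat2_mult_nth cadj_nth det_2 expc_def
    using e by (auto simp: mat2_1_nth gen_nth scaleR_complex algebra_simps)
qed

lemma has_vector_derivative_expc: "((\<lambda>t. (g :: mat2) ** expc j t) has_vector_derivative g ** gen j) (at 0)"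
proof -
  have "(\<lambda>t. g ** expc j t) = (\<lambda>t. cos t *\<^sub>R g + sin t *\<^sub>R (g ** gen j))"
    unfolding expc_def fun_eq_iff by (simp add: mat2_eq_iff mat2_mult_nth mat2_1_nth scaleR_complex algebra_simps)
  then show ?thesis by (auto intro!: derivative_eq_intros simp: has_vector_derivative_def)
qed

lemma Xd_eq: "Xd j \<psi> g = vector_derivative (\<lambda>t. \<psi> (g ** expc j t)) (at 0)"
  unfolding Xd_def mexp_gen ..

section \<open>The real Hilbert space of classes of \<open>L\<^sup>2\<close> spinor fields\<close>

lemma L2_measurable: "\<psi> \<in> L2 \<Longrightarrow> \<psi> \<in> borel_measurable haar"
  by (simp add: L2_def)

lemma L2_integrable_inner:
  assumes "\<psi> \<in> L2" "\<phi> \<in> L2"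
  shows "integrable haar (\<lambda>g. inner (\<psi> g) (\<phi> g))"
proof (rule Bochner_Integration.integrable_bound)
  show "integrable haar (\<lambda>g. (norm (\<psi> g))\<^sup>2 + (norm (\<phi> g))\<^sup>2)" using assms by (auto simp: L2_def)
  show "(\<lambda>g. inner (\<psi> g) (\<phi> g)) \<in> borel_measurable haar"
    using assms[THEN L2_measurable] by measurable
  have "\<bar>inner (\<psi> g) (\<phi> g)\<bar> \<le> (norm (\<psi> g))\<^sup>2 + (norm (\<phi> g))\<^sup>2" for g
  proof -
    have "\<bar>inner (\<psi> g) (\<phi> g)\<bar> \<le> norm (\<psi> g) * norm (\<phi> g)" by (rule Cauchy_Schwarz_ineq2)
    also have "\<dots> \<le> (norm (\<psi> g))\<^sup>2 + (norm (\<phi> g))\<^sup>2"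
      using sum_squares_bound[of "norm (\<psi> g)" "norm (\<phi> g)"] mult_nonneg_nonneg[of "norm (\<psi> g)" "norm (\<phi> g)"]
        norm_ge_zero[of "\<psi> g"] norm_ge_zero[of "\<phi> g"] by linarith
    finally show ?thesis .
  qed
  then show "AE g in haar. norm (inner (\<psi> g) (\<phi> g)) \<le> norm ((norm (\<psi> g))\<^sup>2 + (norm (\<phi> g))\<^sup>2)" by simp
qed

lemma L2_scaleR: "\<psi> \<in> L2 \<Longrightarrow> (\<lambda>g. c *\<^sub>R \<psi> g) \<in> L2"
  by (auto simp: L2_def power_mult_distrib)

lemma L2_add:
  assumes "\<psi> \<in> L2" "\<phi> \<in> L2"
  shows "(\<lambda>g. \<psi> g + \<phi> g) \<in> L2"
proof -
  have "(norm (\<psi> g + \<phi> g))\<^sup>2 = (norm (\<psi> g))\<^sup>2 + 2 * inner (\<psi> g) (\<phi> g) + (norm (\<phi> g))\<^sup>2" for g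
    by (simp add: power2_norm_eq_inner inner_add_left inner_add_right inner_commute)
  then show ?thesis using assms L2_integrable_inner[OF assms] by (auto simp: L2_def)
qed

lemma L2_diff: "\<psi> \<in> L2 \<Longrightarrow> \<phi> \<in> L2 \<Longrightarrow> (\<lambda>g. \<psi> g - \<phi> g) \<in> L2"
  using L2_add[OF _ L2_scaleR[of _ "-1"], of \<psi> \<phi>] by simp

lemma L2_zero: "(\<lambda>g. 0) \<in> L2"
  by (simp add: L2_def)

lemma L2_continuous: "continuous_on SU2 \<psi> \<Longrightarrow> \<psi> \<in> L2"
  unfolding L2_def by (auto intro!: borel_measurable_haar integrable_haar continuous_intros)

text \<open>Reflexive exactly on \<open>L2\<close>, so the partial quotient consists of classes of
  square-integrable functions only.\<close>

definition l2rel :: "sfield \<Rightarrow> sfield \<Rightarrow> bool" where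
  "l2rel \<psi> \<phi> \<longleftrightarrow> \<psi> \<in> L2 \<and> \<phi> \<in> L2 \<and> aeq \<psi> \<phi>"

lemma aeq_refl: "aeq \<psi> \<psi>" by (simp add: aeq_def)
lemma aeq_sym: "aeq \<psi> \<phi> \<Longrightarrow> aeq \<phi> \<psi>" unfolding aeq_def by (auto elim: eventually_mono)
lemma aeq_trans: "aeq \<psi> \<phi> \<Longrightarrow> aeq \<phi> \<omega> \<Longrightarrow> aeq \<psi> \<omega>" unfolding aeq_def by (auto elim: eventually_elim2)

quotient_type spinor_l2 = sfield / partial: l2rel
proof (rule part_equivpI)
  show "\<exists>x. l2rel x x" using L2_zero aeq_refl unfolding l2rel_def by blast
  show "symp l2rel" by (rule sympI) (auto simp: l2rel_def intro: aeq_sym)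
  show "transp l2rel" by (rule transpI) (auto simp: l2rel_def intro: aeq_trans)
qed

instantiation spinor_l2 :: real_inner
begin

lift_definition zero_spinor_l2 :: spinor_l2 is "\<lambda>g. 0"
  by (simp add: l2rel_def L2_zero aeq_refl)

lift_definition plus_spinor_l2 :: "spinor_l2 \<Rightarrow> spinor_l2 \<Rightarrow> spinor_l2" is "\<lambda>\<psi> \<phi> g. \<psi> g + \<phi> g"
  unfolding l2rel_def aeq_def by (auto intro: L2_add)

lift_definition minus_spinor_l2 :: "spinor_l2 \<Rightarrow> spinor_l2 \<Rightarrow> spinor_l2" is "\<lambda>\<psi> \<phi> g. \<psi> g - \<phi> g"
  unfolding l2rel_def aeq_def by (auto intro: L2_diff)

lift_definition uminus_spinor_l2 :: "spinor_l2 \<Rightarrow> spinor_l2" is "\<lambda>\<psi> g. - \<psi> g"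
  unfolding l2rel_def aeq_def using L2_scaleR[of _ "-1"] by auto

lift_definition scaleR_spinor_l2 :: "real \<Rightarrow> spinor_l2 \<Rightarrow> spinor_l2" is "\<lambda>c \<psi> g. c *\<^sub>R \<psi> g"
  unfolding l2rel_def aeq_def by (auto intro: L2_scaleR)

text \<open>This is the real part of \<open>hinner\<close>; the imaginary part is recovered later by
  inserting multiplication by \<open>i\<close>.\<close>

lift_definition inner_spinor_l2 :: "spinor_l2 \<Rightarrow> spinor_l2 \<Rightarrow> real" is "\<lambda>\<psi> \<phi>. \<integral>g. inner (\<psi> g) (\<phi> g) \<partial>haar"
proof (clarsimp simp: l2rel_def)
  fix \<psi> \<psi>' \<phi> \<phi>' assume a: "\<psi> \<in> L2" "\<psi>' \<in> L2" "aeq \<psi> \<psi>'" "\<phi> \<in> L2" "\<phi>' \<in> L2" "aeq \<phi> \<phi>'"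
  show "(\<integral>g. inner (\<psi> g) (\<phi> g) \<partial>haar) = (\<integral>g. inner (\<psi>' g) (\<phi>' g) \<partial>haar)"
  proof (rule integral_cong_AE)
    show "AE g in haar. inner (\<psi> g) (\<phi> g) = inner (\<psi>' g) (\<phi>' g)"
      using a(3,6) unfolding aeq_def by eventually_elim simp
  qed (use a in \<open>auto intro: borel_measurable_integrable L2_integrable_inner\<close>)
qed

definition "norm (x :: spinor_l2) = sqrt (inner x x)"
definition "dist (x :: spinor_l2) y = norm (x - y)"
definition "sgn (x :: spinor_l2) = scaleR (inverse (norm x)) x"
definition "uniformity = (INF e\<in>{0 <..}. principal {(x :: spinor_l2, y). dist x y < e})"
definition "open (U :: spinor_l2 set) \<longleftrightarrow> (\<forall>x\<in>U. \<forall>\<^sub>F (x', y) in uniformity. x' = x \<longrightarrow> y \<in> U)"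

instance
proof
  fix x y z :: spinor_l2 and a b :: real
  show "x + y + z = x + (y + z)" "x + y = y + x" "0 + x = x" "- x + x = 0" "x - y = x + - y"
    "a *\<^sub>R (x + y) = a *\<^sub>R x + a *\<^sub>R y" "(a + b) *\<^sub>R x = a *\<^sub>R x + b *\<^sub>R x" "a *\<^sub>R b *\<^sub>R x = (a * b) *\<^sub>R x" "1 *\<^sub>R x = x"
    by (transfer; simp add: l2rel_def L2_add L2_scaleR L2_diff L2_zero aeq_refl aeq_def algebra_simps;
        metis (no_types, lifting) L2_add L2_scaleR L2_diff L2_zero)+
  show "inner x y = inner y x" by transfer (simp add: inner_commute)
  show "inner (x + y) z = inner x z + inner y z"
    by transfer (simp add: l2rel_def inner_add_left L2_integrable_inner)
  show "inner (a *\<^sub>R x) y = a * inner x y"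
    by transfer (simp add: l2rel_def)
  show "0 \<le> inner x x" by transfer simp
  show "inner x x = 0 \<longleftrightarrow> x = 0"
  proof (transfer, clarsimp simp: l2rel_def)
    fix \<psi> assume p: "\<psi> \<in> L2"
    have "(\<integral>g. inner (\<psi> g) (\<psi> g) \<partial>haar) = 0 \<longleftrightarrow> (AE g in haar. inner (\<psi> g) (\<psi> g) = 0)"
      by (intro integral_nonneg_eq_0_iff_AE L2_integrable_inner p) simp
    then show "((\<integral>g. inner (\<psi> g) (\<psi> g) \<partial>haar) = 0) = ((\<lambda>g. 0) \<in> L2 \<and> aeq \<psi> (\<lambda>g. 0))"
      by (simp add: L2_zero aeq_def)
  qed
qed (auto simp: norm_spinor_l2_def dist_spinor_l2_def sgn_spinor_l2_def uniformity_spinor_l2_def open_spinor_l2_def)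

end

definition cls :: "sfield \<Rightarrow> spinor_l2" where "cls = abs_spinor_l2"

lemma cls_eq_iff: "\<psi> \<in> L2 \<Longrightarrow> \<phi> \<in> L2 \<Longrightarrow> cls \<psi> = cls \<phi> \<longleftrightarrow> aeq \<psi> \<phi>"
  using Quotient3_rel[OF Quotient3_spinor_l2, of \<psi> \<phi>] by (auto simp: cls_def l2rel_def aeq_refl)

definition rep :: "spinor_l2 \<Rightarrow> sfield" where "rep = rep_spinor_l2"

lemma rep: "rep x \<in> L2" "cls (rep x) = x"
  using Quotient3_rep_reflp[OF Quotient3_spinor_l2, of x] Quotient3_abs_rep[OF Quotient3_spinor_l2, of x]
  by (auto simp: l2rel_def cls_def rep_def)

lemma rep_cls: "\<psi> \<in> L2 \<Longrightarrow> aeq (rep (cls \<psi>)) \<psi>"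
  using cls_eq_iff rep by blast

lemma cls_zero: "cls (\<lambda>g. 0) = 0"
  by (simp add: cls_def zero_spinor_l2_def)

lemma cls_add: "\<psi> \<in> L2 \<Longrightarrow> \<phi> \<in> L2 \<Longrightarrow> cls (\<lambda>g. \<psi> g + \<phi> g) = cls \<psi> + cls \<phi>"
  by (simp add: cls_def plus_spinor_l2.abs_eq l2rel_def aeq_refl)

lemma cls_diff: "\<psi> \<in> L2 \<Longrightarrow> \<phi> \<in> L2 \<Longrightarrow> cls (\<lambda>g. \<psi> g - \<phi> g) = cls \<psi> - cls \<phi>"
  by (simp add: cls_def minus_spinor_l2.abs_eq l2rel_def aeq_refl)

lemma cls_uminus: "\<psi> \<in> L2 \<Longrightarrow> cls (\<lambda>g. - \<psi> g) = - cls \<psi>"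
  by (simp add: cls_def uminus_spinor_l2.abs_eq l2rel_def aeq_refl)

lemma cls_scaleR: "\<psi> \<in> L2 \<Longrightarrow> cls (\<lambda>g. c *\<^sub>R \<psi> g) = c *\<^sub>R cls \<psi>"
  by (simp add: cls_def scaleR_spinor_l2.abs_eq l2rel_def aeq_refl)

lemma inner_cls: "\<psi> \<in> L2 \<Longrightarrow> \<phi> \<in> L2 \<Longrightarrow> inner (cls \<psi>) (cls \<phi>) = (\<integral>g. inner (\<psi> g) (\<phi> g) \<partial>haar)"
  by (simp add: cls_def inner_spinor_l2.abs_eq l2rel_def aeq_refl)

lemma norm_cls: "\<psi> \<in> L2 \<Longrightarrow> norm (cls \<psi>) = l2norm \<psi>"
  by (simp add: norm_eq_sqrt_inner inner_cls l2norm_def power2_norm_eq_inner)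

lemma l2lim_iff: "(\<And>n. u n \<in> L2) \<Longrightarrow> \<psi> \<in> L2 \<Longrightarrow> l2lim u \<psi> \<longleftrightarrow> (\<lambda>n. cls (u n)) \<longlonglongrightarrow> cls \<psi>"
  unfolding l2lim_def tendsto_iff by (simp add: dist_norm cls_diff[symmetric] norm_cls L2_diff l2norm_def)

text \<open>A subsequence with geometrically small differences is handed to the Riesz-Fischer lemma;
  the Cauchy property then carries the whole sequence to the same limit.\<close>

instance spinor_l2 :: complete_space
proof
  fix X :: "nat \<Rightarrow> spinor_l2" assume X: "Cauchy X"
  have "\<exists>N. \<forall>m\<ge>N. \<forall>n\<ge>N. norm (X m - X n) < (1/2)^k" for k
    using metric_CauchyD[OF X, of "(1/2)^k"] by (simp add: dist_norm)
  then obtain N where N: "\<And>k m n. m \<ge> N k \<Longrightarrow> n \<ge> N k \<Longrightarrow> norm (X m - X n) < (1/2)^k" by metis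
  \<comment> \<open>The maximum over all earlier thresholds makes \<open>r m\<close> admissible for
    every \<open>n \<le> m\<close> at once.\<close>
  define r where "r k = Max (N ` {..k}) + k" for k
  have Nr: "N n \<le> r m" if "n \<le> m" for n m
    unfolding r_def using that by (simp add: Max_ge trans_le_add1)
  define u where "u k = rep (X (r k))" for k
  have u: "u k \<in> L2" "cls (u k) = X (r k)" for k by (simp_all add: u_def rep)
  have nn: "(\<integral>\<^sup>+g. ennreal ((norm (\<psi> g))\<^sup>2) \<partial>haar) = ennreal ((norm (cls \<psi>))\<^sup>2)" if "\<psi> \<in> L2" for \<psi>
    using that by (simp add: norm_cls l2norm_def L2_def nn_integral_eq_integral)
  have le: "(\<integral>\<^sup>+g. ennreal ((norm (u m g - u n g))\<^sup>2) \<partial>haar) \<le> ennreal ((1/4)^n)" if "n \<le> m" for m n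
  proof -
    have "norm (X (r m) - X (r n)) \<le> (1/2)^n" using N Nr[OF that] Nr[of n n] less_imp_le by blast
    then have "(norm (X (r m) - X (r n)))\<^sup>2 \<le> ((1/2)^n)\<^sup>2" by (intro power_mono) auto
    also have "((1/2)^n)\<^sup>2 = ((1/4)^n :: real)" by (simp add: power2_eq_square power_mult_distrib[symmetric])
    finally show ?thesis using nn[OF L2_diff[OF u(1) u(1)], of m n] by (simp add: cls_diff u ennreal_leI)
  qed
  obtain f where f: "f \<in> borel_measurable haar"
      "\<And>n. (\<integral>\<^sup>+g. ennreal ((norm (f g - u n g))\<^sup>2) \<partial>haar) \<le> ennreal ((1/4)^n)"
    using haar.Riesz_Fischer_subsequence[OF L2_measurable[OF u(1)] le] by blast
  have d: "(\<lambda>g. f g - u n g) \<in> L2" for n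
  proof -
    have m: "(\<lambda>g. f g - u n g) \<in> borel_measurable haar" using f(1) L2_measurable[OF u(1)] by measurable
    moreover have "integrable haar (\<lambda>g. (norm (f g - u n g))\<^sup>2)"
      using m f(2)[of n] by (intro integrableI_bounded) (auto intro: le_less_trans)
    ultimately show ?thesis by (simp add: L2_def)
  qed
  then have fL: "f \<in> L2" using L2_add[OF d u(1), of 0 0] by simp
  have "norm (cls f - X (r n)) \<le> (1/2)^n" for n
  proof -
    have "ennreal ((norm (cls f - X (r n)))\<^sup>2) \<le> ennreal ((1/4)^n)"
      using nn[OF d, of n] f(2)[of n] by (simp add: cls_diff fL u)
    then have "(norm (cls f - X (r n)))\<^sup>2 \<le> (1/4)^n" by (subst (asm) ennreal_le_iff) auto
    also have "(1/4)^n = (((1/2)^n)\<^sup>2 :: real)" by (simp add: power2_eq_square power_mult_distrib[symmetric])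
    finally show ?thesis by (rule power2_le_imp_le) simp
  qed
  note fX = this
  have "X \<longlonglongrightarrow> cls f"
  proof (rule LIMSEQ_I)
    fix e :: real assume e: "e > 0"
    obtain k where k: "(1/2)^k < e/2" using real_arch_pow_inv[of "e/2" "1/2"] e by auto
    show "\<exists>no. \<forall>n\<ge>no. norm (X n - cls f) < e"
    proof (intro exI allI impI)
      fix n assume "n \<ge> r k"
      then have "norm (X n - X (r k)) < (1/2)^k" using N Nr[of k k] by (meson order_refl order_trans)
      moreover have "norm (X n - cls f) \<le> norm (X n - X (r k)) + norm (cls f - X (r k))"
        using norm_triangle_ineq4[of "X n - X (r k)" "cls f - X (r k)"] by simp
      ultimately show "norm (X n - cls f) < e" using fX[of k] k by linarith
    qed
  qed
  then show "convergent X" by (auto simp: convergent_def)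
qed

text \<open>Works through a chosen representative; for maps that respect a.e. equality the choice
  does not matter.\<close>

definition lift_op :: "(sfield \<Rightarrow> sfield) \<Rightarrow> spinor_l2 \<Rightarrow> spinor_l2" where
  "lift_op \<Phi> x = cls (\<Phi> (rep x))"

lemma
  assumes L2: "\<And>\<psi>. \<psi> \<in> L2 \<Longrightarrow> \<Phi> \<psi> \<in> L2"
    and cong: "\<And>\<psi> \<phi>. \<psi> \<in> L2 \<Longrightarrow> \<phi> \<in> L2 \<Longrightarrow> aeq \<psi> \<phi> \<Longrightarrow> aeq (\<Phi> \<psi>) (\<Phi> \<phi>)"
  shows lift_op_cls: "\<psi> \<in> L2 \<Longrightarrow> lift_op \<Phi> (cls \<psi>) = cls (\<Phi> \<psi>)"
    and bounded_linear_lift_op: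
      "(\<And>\<psi> \<phi> g. \<Phi> (\<lambda>g. \<psi> g + \<phi> g) g = \<Phi> \<psi> g + \<Phi> \<phi> g) \<Longrightarrow> (\<And>c \<psi> g. \<Phi> (\<lambda>g. c *\<^sub>R \<psi> g) g = c *\<^sub>R \<Phi> \<psi> g) \<Longrightarrow>
       (\<And>\<psi>. \<psi> \<in> L2 \<Longrightarrow> l2norm (\<Phi> \<psi>) = l2norm \<psi>) \<Longrightarrow> bounded_linear (lift_op \<Phi>)"
    and norm_lift_op: "(\<And>\<psi>. \<psi> \<in> L2 \<Longrightarrow> l2norm (\<Phi> \<psi>) = l2norm \<psi>) \<Longrightarrow> norm (lift_op \<Phi> x) = norm x"
proof -
  show *: "lift_op \<Phi> (cls \<psi>) = cls (\<Phi> \<psi>)" if "\<psi> \<in> L2" for \<psi>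
    unfolding lift_op_def using that by (simp add: cls_eq_iff L2 rep cong rep_cls)
  show n: "norm (lift_op \<Phi> x) = norm x" if "\<And>\<psi>. \<psi> \<in> L2 \<Longrightarrow> l2norm (\<Phi> \<psi>) = l2norm \<psi>" for x
    unfolding lift_op_def using rep[of x] by (metis norm_cls L2 that)
  assume a: "\<And>\<psi> \<phi> g. \<Phi> (\<lambda>g. \<psi> g + \<phi> g) g = \<Phi> \<psi> g + \<Phi> \<phi> g" "\<And>c \<psi> g. \<Phi> (\<lambda>g. c *\<^sub>R \<psi> g) g = c *\<^sub>R \<Phi> \<psi> g"
    "\<And>\<psi>. \<psi> \<in> L2 \<Longrightarrow> l2norm (\<Phi> \<psi>) = l2norm \<psi>"
  have a': "\<Phi> (\<lambda>g. \<psi> g + \<phi> g) = (\<lambda>g. \<Phi> \<psi> g + \<Phi> \<phi> g)" "\<Phi> (\<lambda>g. c *\<^sub>R \<psi> g) = (\<lambda>g. c *\<^sub>R \<Phi> \<psi> g)" for \<psi> \<phi> c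
    using a by auto
  show "bounded_linear (lift_op \<Phi>)"
  proof (rule bounded_linear_intro[where K=1])
    fix x y :: spinor_l2 and c :: real
    show "lift_op \<Phi> (x + y) = lift_op \<Phi> x + lift_op \<Phi> y"
      using *[OF L2_add[OF rep(1)[of x] rep(1)[of y]]] *[OF rep(1)[of x]] *[OF rep(1)[of y]]
      by (simp add: a' cls_add rep L2)
    show "lift_op \<Phi> (c *\<^sub>R x) = c *\<^sub>R lift_op \<Phi> x"
      using *[OF L2_scaleR[OF rep(1)[of x]]] *[OF rep(1)[of x]]
      by (simp add: a' cls_scaleR rep L2)
    show "norm (lift_op \<Phi> x) \<le> norm x * 1" using n[OF a(3)] by simp
  qed
qed

section \<open>The Dirac operator on smooth fields\<close>

text \<open>Differentiability along \<open>X_j\<close> together with a candidate derivative, so that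
  derivative rules can be chained before \<open>Xd\<close> is evaluated. Only points of
  \<open>SU2\<close> count, since fields are arbitrary elsewhere.\<close>

definition ddir :: "nat \<Rightarrow> (mat2 \<Rightarrow> 'b::real_normed_vector) \<Rightarrow> (mat2 \<Rightarrow> 'b) \<Rightarrow> bool" where
  "ddir j f f' \<longleftrightarrow> (\<forall>g\<in>SU2. ((\<lambda>t. f (g ** expc j t)) has_vector_derivative f' g) (at 0))"

text \<open>The one-parameter group law moves the point of differentiation from \<open>t\<close> to
  0, at the translated base point.\<close>

lemma ddir_at:
  assumes "ddir j f f'" "g \<in> SU2"
  shows "((\<lambda>t. f (g ** expc j t)) has_vector_derivative f' (g ** expc j t)) (at t)"
proof -
  have "((\<lambda>s. f ((g ** expc j t) ** expc j s)) has_vector_derivative f' (g ** expc j t)) (at (t - t))"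
    using assms SU2_mult[OF assms(2) expc_SU2] unfolding ddir_def by simp
  moreover have "((\<lambda>s. s - t) has_vector_derivative 1) (at t)"
    by (auto intro!: derivative_eq_intros)
  ultimately have "((\<lambda>s. f ((g ** expc j t) ** expc j s)) \<circ> (\<lambda>s. s - t) has_vector_derivative 1 *\<^sub>R f' (g ** expc j t)) (at t)"
    by (intro vector_diff_chain_at)
  moreover have "(\<lambda>s. f ((g ** expc j t) ** expc j s)) \<circ> (\<lambda>s. s - t) = (\<lambda>s. f (g ** expc j s))"
    by (auto simp: fun_eq_iff matrix_mul_assoc[symmetric] expc_add[symmetric])
  ultimately show ?thesis by simp
qed

lemma bounded_SU2:
  fixes f :: "mat2 \<Rightarrow> 'b::real_normed_vector"
  assumes "continuous_on SU2 f"
  obtains B where "\<And>x. x \<in> SU2 \<Longrightarrow> norm (f x) \<le> B"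
  using compact_imp_bounded[OF compact_continuous_image[OF assms compact_SU2]] unfolding bounded_iff by auto

text \<open>By right invariance the difference quotients have integral zero.\<close>

lemma integral_ddir_eq_0:
  fixes f :: "mat2 \<Rightarrow> real"
  assumes f: "continuous_on SU2 f" and f': "continuous_on SU2 f'" and d: "ddir j f f'"
  shows "(\<integral>g. f' g \<partial>haar) = 0"
proof -
  obtain B where B: "\<And>x. x \<in> SU2 \<Longrightarrow> norm (f' x) \<le> B" using bounded_SU2[OF f'] by blast
  define t where "t n = inverse (real (Suc n))" for n
  have t: "t n > 0" for n by (simp add: t_def)
  have "t \<longlonglongrightarrow> 0" using LIMSEQ_inverse_real_of_nat by (simp add: t_def[abs_def])
  then have t0: "filterlim t (at 0) sequentially"
    unfolding filterlim_at using t by (auto simp: less_imp_neq[symmetric])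
  define h where "h n g = (f (g ** expc j (t n)) - f g) / t n" for n g
  have ft: "continuous_on SU2 (\<lambda>g. f (g ** expc j s))" for s
    by (rule continuous_on_compose2[OF f]) (auto intro!: continuous_intros SU2_mult expc_SU2)
  have h0: "(\<integral>g. h n g \<partial>haar) = 0" for n
  proof -
    have "(\<integral>g. f (g ** expc j (t n)) \<partial>haar) = (\<integral>g. f g \<partial>haar)"
      using integral_haar_translate[OF SU2_1 expc_SU2 borel_measurable_haar[OF f]] by simp
    then show ?thesis unfolding h_def using integrable_haar[OF ft] integrable_haar[OF f] by simp
  qed
  have "(\<lambda>n. \<integral>g. h n g \<partial>haar) \<longlonglongrightarrow> (\<integral>g. f' g \<partial>haar)"
  proof (rule integral_dominated_convergence[where w="\<lambda>_. B"])
    show "f' \<in> borel_measurable haar" "h n \<in> borel_measurable haar" for n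
      unfolding h_def by (intro borel_measurable_haar f' continuous_intros ft f; use t in \<open>auto simp: less_imp_neq[symmetric]\<close>)+
    show "AE g in haar. (\<lambda>n. h n g) \<longlonglongrightarrow> f' g"
    proof (rule AE_I2)
      fix g assume "g \<in> space haar"
      then have "((\<lambda>s. f (g ** expc j s)) has_vector_derivative f' g) (at 0)" using d by (simp add: ddir_def space_haar)
      then have "((\<lambda>s. (f (g ** expc j s) - f (g ** expc j 0)) / (s - 0)) \<longlongrightarrow> f' g) (at 0)"
        by (simp only: has_real_derivative_iff_has_vector_derivative[symmetric] has_field_derivative_iff)
      from filterlim_compose[OF this t0] show "(\<lambda>n. h n g) \<longlonglongrightarrow> f' g"
        by (simp add: h_def expc_0)
    qed
    show "AE g in haar. norm (h n g) \<le> B" for n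
    proof (rule AE_I2)
      fix g assume "g \<in> space haar"
      then have g: "g \<in> SU2" by (simp add: space_haar)
      \<comment> \<open>The mean value theorem turns the bound on \<open>f'\<close> into a majorant
        of all difference quotients, as dominated convergence requires.\<close>
      have "\<exists>z>0. z < t n \<and> f (g ** expc j (t n)) - f (g ** expc j 0) = (t n - 0) * f' (g ** expc j z)"
        by (rule MVT2[OF t]) (use ddir_at[OF d g] in \<open>simp add: has_real_derivative_iff_has_vector_derivative\<close>)
      then obtain z where "h n g = f' (g ** expc j z)" using t[of n] by (auto simp: h_def expc_0)
      then show "norm (h n g) \<le> B" using B SU2_mult[OF g expc_SU2] by simp
    qed
  qed simp
  then show ?thesis using h0 LIMSEQ_unique[OF tendsto_const] by fastforce
qed

lemma ddir_Xd: "ddir j f f' \<Longrightarrow> g \<in> SU2 \<Longrightarrow> Xd j f g = f' g"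
  unfolding ddir_def Xd_eq by (simp add: vector_derivative_at)

lemma expc_else: "j \<notin> {1, 2} \<Longrightarrow> expc j = expc 3"
  by (auto simp: expc_def gen_def pauli_def fun_eq_iff)

text \<open>\<open>smooth_su2\<close> controls the directions 1, 2, 3 only; any other index denotes
  direction 3 by the default case of \<open>pauli\<close>.\<close>

lemma smooth_ddir:
  assumes "smooth_su2 \<psi>"
  shows "ddir j (Xit js \<psi>) (Xd j (Xit js \<psi>))"
proof (cases "j \<in> {1, 2}")
  case True
  then have j: "j \<in> {1, 2, 3}" by blast
  show ?thesis using assms j unfolding smooth_su2_def ddir_def mexp_gen by blast
next
  case False
  have "Xd j (Xit js \<psi>) = Xd 3 (Xit js \<psi>)" by (auto simp: Xd_eq expc_else[OF False])
  moreover have "ddir 3 (Xit js \<psi>) (Xd 3 (Xit js \<psi>))"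
    using assms unfolding smooth_su2_def ddir_def mexp_gen by blast
  ultimately show ?thesis by (simp add: ddir_def expc_else[OF False])
qed

text \<open>A class of continuous fields that is closed under differentiation contains smooth fields
  only, so iterated derivatives need not be computed. They agree with members of the class merely on
  \<open>SU2\<close>, which suffices because the curves stay in the group.\<close>

lemma smooth_coinduct:
  assumes "R f" and cont: "\<And>f. R f \<Longrightarrow> continuous_on SU2 f"
    and step: "\<And>f j. R f \<Longrightarrow> \<exists>f'. R f' \<and> ddir j f f'"
  shows "smooth_su2 f"
proof -
  have *: "\<exists>f'. R f' \<and> (\<forall>g\<in>SU2. Xit js f g = f' g)" for js
  proof (induction js)
    case Nil then show ?case using assms(1) by auto
  next
    case (Cons j js)
    then obtain f1 where f1: "R f1" "\<forall>g\<in>SU2. Xit js f g = f1 g" by blast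
    obtain f2 where f2: "R f2" "ddir j f1 f2" using step[OF f1(1)] by blast
    have "ddir j (Xit js f) f2"
      using f2(2) f1(2) SU2_mult[OF _ expc_SU2] by (simp add: ddir_def)
    then show ?case using f2(1) ddir_Xd by auto
  qed
  show ?thesis unfolding smooth_su2_def mexp_gen
  proof (intro allI conjI ballI)
    fix js
    show "continuous_on SU2 (Xit js f)"
      using *[of js] cont continuous_on_cong[OF refl] by metis
    fix j :: nat and g assume g: "g \<in> SU2"
    obtain f1 where f1: "R f1" "\<forall>g\<in>SU2. Xit js f g = f1 g" using * by blast
    obtain f2 where f2: "R f2" "ddir j f1 f2" using step[OF f1(1)] by blast
    have "ddir j (Xit js f) f2"
      using f2(2) f1(2) SU2_mult[OF _ expc_SU2] by (simp add: ddir_def)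
    then show "((\<lambda>t. Xit js f (g ** expc j t)) has_vector_derivative Xd j (Xit js f) g) (at 0)"
      using ddir_Xd[of j "Xit js f" f2 g] g by (simp add: ddir_def)
  qed
qed

lemma smooth_cont: "smooth_su2 \<psi> \<Longrightarrow> continuous_on SU2 \<psi>"
  unfolding smooth_su2_def by (metis Xit.simps(1))

lemma smooth_Xd_ddir: "smooth_su2 \<psi> \<Longrightarrow> ddir j \<psi> (Xd j \<psi>)"
  using smooth_ddir[of \<psi> j "[]"] by simp

lemma smooth_Xd: "smooth_su2 \<psi> \<Longrightarrow> smooth_su2 (Xd j \<psi>)"
proof -
  have "Xit js (Xd j \<psi>) = Xit (js @ [j]) \<psi>" for js by (induction js) auto
  then show "smooth_su2 \<psi> \<Longrightarrow> smooth_su2 (Xd j \<psi>)" unfolding smooth_su2_def by auto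
qed

lemma ddir_linear: "bounded_linear A \<Longrightarrow> ddir j f f' \<Longrightarrow> ddir j (\<lambda>g. A (f g)) (\<lambda>g. A (f' g))"
  unfolding ddir_def by (auto intro: bounded_linear.has_vector_derivative)

lemma ddir_add: "ddir j f f' \<Longrightarrow> ddir j h h' \<Longrightarrow> ddir j (\<lambda>g. f g + h g) (\<lambda>g. f' g + h' g)"
  unfolding ddir_def by (auto intro: has_vector_derivative_add)

lemma ddir_inner:
  "ddir j f f' \<Longrightarrow> ddir j h h' \<Longrightarrow> ddir j (\<lambda>g. inner (f g) (h g)) (\<lambda>g. inner (f g) (h' g) + inner (f' g) (h g))"
  unfolding ddir_def using bounded_bilinear.has_vector_derivative[OF bounded_bilinear_inner] by (fastforce simp: expc_0)

lemma smooth_linear: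
  assumes A: "bounded_linear A" and "smooth_su2 \<psi>"
  shows "smooth_su2 (\<lambda>g. A (\<psi> g))"
proof (rule smooth_coinduct[where R = "\<lambda>f. \<exists>\<phi>. smooth_su2 \<phi> \<and> f = (\<lambda>g. A (\<phi> g))"])
  show "\<exists>\<phi>. smooth_su2 \<phi> \<and> (\<lambda>g. A (\<psi> g)) = (\<lambda>g. A (\<phi> g))" using assms by blast
  fix f assume "\<exists>\<phi>. smooth_su2 \<phi> \<and> f = (\<lambda>g. A (\<phi> g))"
  then obtain \<phi> where \<phi>: "smooth_su2 \<phi>" "f = (\<lambda>g. A (\<phi> g))" by blast
  show "continuous_on SU2 f" unfolding \<phi>(2)
    by (intro bounded_linear.continuous_on[OF A] smooth_cont \<phi>)
  show "\<exists>f'. (\<exists>\<phi>. smooth_su2 \<phi> \<and> f' = (\<lambda>g. A (\<phi> g))) \<and> ddir j f f'" for j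
    using ddir_linear[OF A smooth_Xd_ddir[OF \<phi>(1)]] smooth_Xd[OF \<phi>(1)] unfolding \<phi>(2) by blast
qed

lemma smooth_add:
  assumes "smooth_su2 \<psi>" "smooth_su2 \<phi>"
  shows "smooth_su2 (\<lambda>g. \<psi> g + \<phi> g)"
proof (rule smooth_coinduct[where R = "\<lambda>f. \<exists>u v. smooth_su2 u \<and> smooth_su2 v \<and> f = (\<lambda>g. u g + v g)"])
  show "\<exists>u v. smooth_su2 u \<and> smooth_su2 v \<and> (\<lambda>g. \<psi> g + \<phi> g) = (\<lambda>g. u g + v g)" using assms by blast
  fix f assume "\<exists>u v. smooth_su2 u \<and> smooth_su2 v \<and> f = (\<lambda>g. u g + v g)"
  then obtain u v where uv: "smooth_su2 u" "smooth_su2 v" "f = (\<lambda>g. u g + v g)" by blast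
  show "continuous_on SU2 f" unfolding uv(3) by (intro continuous_intros smooth_cont uv)
  show "\<exists>f'. (\<exists>u v. smooth_su2 u \<and> smooth_su2 v \<and> f' = (\<lambda>g. u g + v g)) \<and> ddir j f f'" for j
    using ddir_add[OF smooth_Xd_ddir[OF uv(1)] smooth_Xd_ddir[OF uv(2)]] smooth_Xd[OF uv(1)] smooth_Xd[OF uv(2)]
    unfolding uv(3) by blast
qed

lemma bounded_linear_matrix_vector: "bounded_linear (\<lambda>v. (A :: mat2) *v v)"
  by (intro linear_conv_bounded_linear[THEN iffD1] linearI) (simp_all add: matrix_vector_right_distrib vec_eq_iff forall_2 mat2_mult_vec_nth scaleR_complex algebra_simps)

text \<open>As \<open>i sigma_j = - gen j\<close>, the operator can be written without complex
  scalars; in this form it visibly commutes with real-linear maps that commute with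
  \<open>gen j\<close>.\<close>

lemma Dsm_eq: "Dsm \<psi> g = - (\<Sum>j\<in>{1, 2, 3}. gen j *v Xd j \<psi> g) + (3/2) *\<^sub>R \<psi> g"
proof -
  have "msc \<i> (pauli j) *v v = - (gen j *v v)" for j v
    by (simp add: vec_eq_iff forall_2 mat2_mult_vec_nth gen_def msc_def)
  moreover have "(3/2 :: complex) *s v = (3/2) *\<^sub>R v" for v :: spinor
    by (simp add: vec_eq_iff scaleR_complex)
  ultimately show ?thesis unfolding Dsm_def by (simp add: sum_negf)
qed

lemma smooth_Dsm: "smooth_su2 \<psi> \<Longrightarrow> smooth_su2 (Dsm \<psi>)"
proof -
  assume s: "smooth_su2 \<psi>"
  have "bounded_linear (\<lambda>v :: spinor. - (gen j *v v))" for j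
    by (intro bounded_linear_minus bounded_linear_matrix_vector)
  then have "smooth_su2 (\<lambda>g. - (gen j *v Xd j \<psi> g))" for j
    by (rule smooth_linear) (rule smooth_Xd[OF s])
  then have "smooth_su2 (\<lambda>g. - (gen 1 *v Xd 1 \<psi> g) + - (gen 2 *v Xd 2 \<psi> g) + - (gen 3 *v Xd 3 \<psi> g) + (3/2) *\<^sub>R \<psi> g)"
    by (intro smooth_add smooth_linear[OF bounded_linear_scaleR_right] s)
  moreover have "Dsm \<psi> = (\<lambda>g. - (gen 1 *v Xd 1 \<psi> g) + - (gen 2 *v Xd 2 \<psi> g) + - (gen 3 *v Xd 3 \<psi> g) + (3/2) *\<^sub>R \<psi> g)"
    by (simp add: Dsm_eq fun_eq_iff algebra_simps)
  ultimately show ?thesis by simp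
qed

lemma smooth_L2: "smooth_su2 \<psi> \<Longrightarrow> \<psi> \<in> L2"
  by (intro L2_continuous smooth_cont)

lemma aeqI: "(\<And>g. g \<in> SU2 \<Longrightarrow> \<psi> g = \<phi> g) \<Longrightarrow> aeq \<psi> \<phi>"
  unfolding aeq_def by (rule AE_I2) (simp add: space_haar)

lemma inner_gen: "inner (gen j *v u) v = - inner u (gen j *v v)" for u v :: spinor
  by (simp add: inner_vec_def sum_2 mat2_mult_vec_nth gen_nth inner_complex_def algebra_simps)

text \<open>\<open>gen j\<close> is skew-adjoint on spinors and \<open>X_j\<close> is skew after
  integration by parts, so their product is symmetric.\<close>

lemma Dsm_symmetric:
  assumes s: "smooth_su2 \<psi>" "smooth_su2 \<phi>"
  shows "inner (cls (Dsm \<psi>)) (cls \<phi>) = inner (cls \<psi>) (cls (Dsm \<phi>))"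
proof -
  \<comment> \<open>Up to sign this is the derivative along \<open>X_j\<close> of the inner product
    of \<open>\<psi>\<close> and \<open>gen j *v \<phi>\<close>, hence its integral
    vanishes.\<close>
  define a where "a j g = inner (gen j *v Xd j \<psi> g) (\<phi> g) - inner (\<psi> g) (gen j *v Xd j \<phi> g)" for j g
  note cX = smooth_cont[OF smooth_Xd[OF s(1)]] smooth_cont[OF smooth_Xd[OF s(2)]]
  note cg = bounded_linear.continuous_on[OF bounded_linear_matrix_vector]
  have ca: "continuous_on SU2 (a j)" for j
    unfolding a_def by (intro continuous_intros cg cX smooth_cont s)
  have a0: "(\<integral>g. a j g \<partial>haar) = 0" for j
  proof -
    have "(\<integral>g. - a j g \<partial>haar) = 0"
    proof (rule integral_ddir_eq_0)
      have "ddir j (\<lambda>g. inner (\<psi> g) (gen j *v \<phi> g))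
          (\<lambda>g. inner (\<psi> g) (gen j *v Xd j \<phi> g) + inner (Xd j \<psi> g) (gen j *v \<phi> g))"
        by (intro ddir_inner ddir_linear[OF bounded_linear_matrix_vector] smooth_Xd_ddir s)
      then show "ddir j (\<lambda>g. inner (\<psi> g) (gen j *v \<phi> g)) (\<lambda>g. - a j g)"
        by (simp add: a_def inner_gen)
    qed (intro continuous_intros ca cg smooth_cont s)+
    then show ?thesis by simp
  qed
  have "inner (cls (Dsm \<psi>)) (cls \<phi>) - inner (cls \<psi>) (cls (Dsm \<phi>))
      = (\<integral>g. inner (Dsm \<psi> g) (\<phi> g) - inner (\<psi> g) (Dsm \<phi> g) \<partial>haar)"
    using s by (simp add: inner_cls smooth_L2 smooth_Dsm L2_integrable_inner)
  also have "\<dots> = (\<integral>g. - a 1 g - a 2 g - a 3 g \<partial>haar)"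
    by (simp add: Dsm_eq a_def inner_add_left inner_add_right inner_diff_left inner_diff_right algebra_simps)
  also have "\<dots> = 0" using integrable_haar[OF ca] by (simp add: a0)
  finally show ?thesis by simp
qed

text \<open>The condition concerns \<open>- i sigma_j\<close> rather than \<open>sigma_j\<close>, so
  that the conjugate-linear \<open>epsc\<close>, which anticommutes with \<open>sigma_j\<close>,
  qualifies.\<close>

lemma Dsm_linear:
  assumes A: "bounded_linear A" "\<And>j v. A (gen j *v v) = gen j *v A v" and s: "smooth_su2 \<psi>" and g: "g \<in> SU2"
  shows "Dsm (\<lambda>g. A (\<psi> g)) g = A (Dsm \<psi> g)"
proof -
  interpret bounded_linear A by fact
  have "Xd j (\<lambda>g. A (\<psi> g)) g = A (Xd j \<psi> g)" for j
    using ddir_linear[OF A(1) smooth_Xd_ddir[OF s]] g by (intro ddir_Xd)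
  then show ?thesis unfolding Dsm_eq by (simp add: add neg diff scaleR A(2))
qed

lemma Dsm_add:
  assumes "smooth_su2 \<psi>" "smooth_su2 \<phi>" "g \<in> SU2"
  shows "Dsm (\<lambda>g. \<psi> g + \<phi> g) g = Dsm \<psi> g + Dsm \<phi> g"
proof -
  have "Xd j (\<lambda>g. \<psi> g + \<phi> g) g = Xd j \<psi> g + Xd j \<phi> g" for j
    using ddir_add[OF smooth_Xd_ddir[OF assms(1)] smooth_Xd_ddir[OF assms(2)]] assms(3) by (intro ddir_Xd)
  then show ?thesis unfolding Dsm_eq by (simp add: matrix_vector_right_distrib scaleR_add_right)
qed

section \<open>The closed Dirac operator as a symmetric graph\<close>

definition smooth_graph :: "(spinor_l2 \<times> spinor_l2) set" where
  "smooth_graph = {(cls u, cls (Dsm u)) | u. smooth_su2 u}"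

definition dirac_graph :: "(spinor_l2 \<times> spinor_l2) set" where
  "dirac_graph = closure smooth_graph"

lemma dirac_iff:
  assumes "\<psi> \<in> L2" "\<phi> \<in> L2"
  shows "dirac \<psi> \<phi> \<longleftrightarrow> (cls \<psi>, cls \<phi>) \<in> dirac_graph"
proof
  assume "dirac \<psi> \<phi>"
  then obtain u where u: "\<And>n. smooth_su2 (u n)" "l2lim u \<psi>" "l2lim (\<lambda>n. Dsm (u n)) \<phi>"
    unfolding dirac_def by blast
  then have "(\<lambda>n. (cls (u n), cls (Dsm (u n)))) \<longlonglongrightarrow> (cls \<psi>, cls \<phi>)"
    using assms by (intro tendsto_Pair) (simp_all add: l2lim_iff smooth_L2 smooth_Dsm)
  then show "(cls \<psi>, cls \<phi>) \<in> dirac_graph"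
    unfolding dirac_graph_def closure_sequential smooth_graph_def using u(1)
    by (intro exI[of _ "\<lambda>n. (cls (u n), cls (Dsm (u n)))"]) blast
next
  assume "(cls \<psi>, cls \<phi>) \<in> dirac_graph"
  then obtain z where z: "\<And>n. z n \<in> smooth_graph" "z \<longlonglongrightarrow> (cls \<psi>, cls \<phi>)"
    unfolding dirac_graph_def closure_sequential by blast
  from z(1) have "\<exists>u. smooth_su2 u \<and> z n = (cls u, cls (Dsm u))" for n unfolding smooth_graph_def by blast
  then obtain u where u: "\<And>n. smooth_su2 (u n)" "\<And>n. z n = (cls (u n), cls (Dsm (u n)))" by metis
  have "(\<lambda>n. cls (u n)) \<longlonglongrightarrow> cls \<psi>" "(\<lambda>n. cls (Dsm (u n))) \<longlonglongrightarrow> cls \<phi>"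
    using tendsto_fst[OF z(2)] tendsto_snd[OF z(2)] by (simp_all add: u(2))
  then show "dirac \<psi> \<phi>" unfolding dirac_def
    using assms u(1) by (auto simp: l2lim_iff smooth_L2 smooth_Dsm intro!: exI[of _ u])
qed

lemma dirac_L2: "dirac \<psi> \<phi> \<Longrightarrow> \<psi> \<in> L2 \<and> \<phi> \<in> L2"
  by (simp add: dirac_def)

lemma smooth_in_graph: "smooth_su2 u \<Longrightarrow> (cls u, cls (Dsm u)) \<in> dirac_graph"
  unfolding dirac_graph_def smooth_graph_def by (rule subsetD[OF closure_subset]) blast

lemma subspace_smooth_graph: "subspace smooth_graph"
proof (rule subspaceI)
  have lin: "bounded_linear (\<lambda>v :: spinor. c *\<^sub>R v)" for c by (rule bounded_linear_scaleR_right)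
  have scale: "c *\<^sub>R x \<in> smooth_graph" if x: "x \<in> smooth_graph" for c x
  proof -
    obtain u where u: "smooth_su2 u" "x = (cls u, cls (Dsm u))" using x unfolding smooth_graph_def by blast
    have s: "smooth_su2 (\<lambda>g. c *\<^sub>R u g)" by (rule smooth_linear[OF lin u(1)])
    have "aeq (Dsm (\<lambda>g. c *\<^sub>R u g)) (\<lambda>g. c *\<^sub>R Dsm u g)"
      by (intro aeqI Dsm_linear[OF lin _ u(1)])
        (simp_all add: linear_scale[OF bounded_linear.linear[OF bounded_linear_matrix_vector]])
    then have "cls (Dsm (\<lambda>g. c *\<^sub>R u g)) = c *\<^sub>R cls (Dsm u)"
      by (subst cls_scaleR[symmetric]) (auto simp: cls_eq_iff smooth_L2 smooth_Dsm s u L2_scaleR)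
    then have "c *\<^sub>R x = (cls (\<lambda>g. c *\<^sub>R u g), cls (Dsm (\<lambda>g. c *\<^sub>R u g)))"
      using u by (simp add: cls_scaleR smooth_L2)
    then show ?thesis using s unfolding smooth_graph_def by blast
  qed
  then show "c *\<^sub>R x \<in> smooth_graph" if "x \<in> smooth_graph" for c x using that .
  have "smooth_su2 (\<lambda>g. 0)"
    by (rule smooth_coinduct[where R="\<lambda>f. f = (\<lambda>g. 0)"]) (auto simp: ddir_def)
  then have "(cls (\<lambda>g. 0), cls (Dsm (\<lambda>g. 0))) \<in> smooth_graph" unfolding smooth_graph_def by blast
  from scale[OF this, of 0] show "0 \<in> smooth_graph" by (simp add: zero_prod_def)
  fix x y assume "x \<in> smooth_graph" "y \<in> smooth_graph"
  then obtain u v where u: "smooth_su2 u" "x = (cls u, cls (Dsm u))" and v: "smooth_su2 v" "y = (cls v, cls (Dsm v))"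
    unfolding smooth_graph_def by blast
  have s: "smooth_su2 (\<lambda>g. u g + v g)" by (intro smooth_add u v)
  have "aeq (Dsm (\<lambda>g. u g + v g)) (\<lambda>g. Dsm u g + Dsm v g)" by (intro aeqI Dsm_add u v)
  then have "cls (Dsm (\<lambda>g. u g + v g)) = cls (Dsm u) + cls (Dsm v)"
    by (subst cls_add[symmetric]) (auto simp: cls_eq_iff smooth_L2 smooth_Dsm s u v L2_add)
  then have "x + y = (cls (\<lambda>g. u g + v g), cls (Dsm (\<lambda>g. u g + v g)))"
    using u v by (simp add: cls_add smooth_L2)
  then show "x + y \<in> smooth_graph" using s unfolding smooth_graph_def by blast
qed

lemma closed_dirac_graph: "closed dirac_graph"
  by (simp add: dirac_graph_def)

lemma subspace_dirac_graph: "subspace dirac_graph"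
  using subspace_closure_span[of smooth_graph] span_eq_iff[THEN iffD2, OF subspace_smooth_graph]
  by (simp only: dirac_graph_def)

lemma dirac_graph_symmetric:
  assumes "(x, x') \<in> dirac_graph" "(y, y') \<in> dirac_graph"
  shows "inner x y' = inner x' y"
proof -
  obtain a where a: "\<And>n. a n \<in> smooth_graph" "a \<longlonglongrightarrow> (x, x')"
    using assms(1) unfolding dirac_graph_def closure_sequential by blast
  obtain b where b: "\<And>n. b n \<in> smooth_graph" "b \<longlonglongrightarrow> (y, y')"
    using assms(2) unfolding dirac_graph_def closure_sequential by blast
  have eq: "inner (fst (a n)) (snd (b n)) = inner (snd (a n)) (fst (b n))" for n
    using a(1)[of n] b(1)[of n] Dsm_symmetric unfolding smooth_graph_def by fastforce
  have "(\<lambda>n. inner (fst (a n)) (snd (b n))) \<longlonglongrightarrow> inner x y'"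
    "(\<lambda>n. inner (snd (a n)) (fst (b n))) \<longlonglongrightarrow> inner x' y"
    using tendsto_inner[OF tendsto_fst[OF a(2)] tendsto_snd[OF b(2)]]
      tendsto_inner[OF tendsto_snd[OF a(2)] tendsto_fst[OF b(2)]] by simp_all
  then show ?thesis unfolding eq by (rule LIMSEQ_unique)
qed

lemma smooth_graph_invariant:
  assumes U: "bounded_linear U" "\<And>u. smooth_su2 u \<Longrightarrow> (U (cls u), U (cls (Dsm u))) \<in> dirac_graph"
    and "(x, y) \<in> dirac_graph"
  shows "(U x, U y) \<in> dirac_graph"
proof -
  obtain a where a: "\<And>n. a n \<in> smooth_graph" "a \<longlonglongrightarrow> (x, y)"
    using assms(3) unfolding dirac_graph_def closure_sequential by blast
  have "(U (fst (a n)), U (snd (a n))) \<in> dirac_graph" for n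
  proof -
    obtain u where "smooth_su2 u" "a n = (cls u, cls (Dsm u))" using a(1)[of n] unfolding smooth_graph_def by blast
    then show ?thesis using U(2) by simp
  qed
  moreover have "(\<lambda>n. (U (fst (a n)), U (snd (a n)))) \<longlonglongrightarrow> (U x, U y)"
    using bounded_linear.tendsto[OF U(1) tendsto_fst[OF a(2)]] bounded_linear.tendsto[OF U(1) tendsto_snd[OF a(2)]]
    by (intro tendsto_Pair) simp_all
  ultimately show ?thesis by (rule closed_sequentially[OF closed_dirac_graph])
qed

subsection \<open>Pointwise conjugate-linear and linear maps\<close>

text \<open>The quaternionic structure of \<open>C^2\<close>: conjugate-linear, isometric, of square
  -1, and commuting with SU(2) and its Lie algebra.\<close>

definition epsc :: "spinor \<Rightarrow> spinor" where
  "epsc v = epsm *v (\<chi> k. cnj (v $ k))"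

lemma epsc_nth: "epsc v $ 1 = cnj (v $ 2)" "epsc v $ 2 = - cnj (v $ 1)"
  by (simp_all add: epsc_def mat2_mult_vec_nth epsm_def)

lemma spinor_eq_iff: "(u :: spinor) = v \<longleftrightarrow> u$1 = v$1 \<and> u$2 = v$2"
  by (simp add: vec_eq_iff forall_2)

lemma bounded_linear_epsc: "bounded_linear epsc"
  by (intro linear_conv_bounded_linear[THEN iffD1] linearI) (simp_all add: spinor_eq_iff epsc_nth)

lemma epsc_epsc: "epsc (epsc v) = - v"
  by (simp add: spinor_eq_iff epsc_nth)

lemma norm_epsc: "norm (epsc v) = norm v"
  by (simp add: norm_vec_def L2_set_def sum_2 epsc_nth add.commute)

lemma epsc_gen: "epsc (gen j *v v) = gen j *v epsc v"
  by (simp add: spinor_eq_iff epsc_nth mat2_mult_vec_nth gen_nth)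

lemma epsc_SU2: "g \<in> SU2 \<Longrightarrow> epsc (g *v v) = g *v epsc v"
  using SU2_entries[of g] by (simp add: spinor_eq_iff epsc_nth mat2_mult_vec_nth algebra_simps)

lemma Cop_eq: "Cop \<psi> = (\<lambda>g. epsc (\<psi> g))"
  by (simp add: Cop_def epsc_def fun_eq_iff)

lemma norm_vscale: "norm (c *s v) = cmod c * norm (v :: spinor)"
  by (simp add: norm_vec_def L2_set_def sum_2 norm_mult power_mult_distrib real_sqrt_mult flip: distrib_left)

lemma bounded_linear_vscale: "bounded_linear (\<lambda>v :: spinor. c *s v)"
  by (intro linear_conv_bounded_linear[THEN iffD1] linearI) (simp_all add: spinor_eq_iff algebra_simps)

definition pointwise :: "(spinor \<Rightarrow> spinor) \<Rightarrow> spinor_l2 \<Rightarrow> spinor_l2" where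
  "pointwise A = lift_op (\<lambda>\<psi> g. A (\<psi> g))"

lemma
  assumes A: "bounded_linear A"
  shows L2_pointwise: "\<psi> \<in> L2 \<Longrightarrow> (\<lambda>g. A (\<psi> g)) \<in> L2"
    and pointwise_cls: "\<psi> \<in> L2 \<Longrightarrow> pointwise A (cls \<psi>) = cls (\<lambda>g. A (\<psi> g))"
    and norm_pointwise: "(\<And>v. norm (A v) = norm v) \<Longrightarrow> norm (pointwise A x) = norm x"
    and bounded_linear_pointwise: "(\<And>v. norm (A v) = norm v) \<Longrightarrow> bounded_linear (pointwise A)"
    and pointwise_graph: "(\<And>v. norm (A v) = norm v) \<Longrightarrow> (\<And>j v. A (gen j *v v) = gen j *v A v)
      \<Longrightarrow> (x, y) \<in> dirac_graph \<Longrightarrow> (pointwise A x, pointwise A y) \<in> dirac_graph"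
proof -
  interpret bounded_linear A by fact
  show L: "(\<lambda>g. A (\<psi> g)) \<in> L2" if \<psi>: "\<psi> \<in> L2" for \<psi>
  proof -
    obtain K where K: "\<And>v. norm (A v) \<le> norm v * K" using bounded by blast
    have m: "(\<lambda>g. A (\<psi> g)) \<in> borel_measurable haar"
      using borel_measurable_continuous_onI[OF linear_continuous_on[OF A]] L2_measurable[OF \<psi>]
      by (rule measurable_compose[rotated])
    have "integrable haar (\<lambda>g. (norm (A (\<psi> g)))\<^sup>2)"
    proof (rule Bochner_Integration.integrable_bound)
      show "integrable haar (\<lambda>g. (norm (\<psi> g))\<^sup>2 * K\<^sup>2)" using \<psi> by (simp add: L2_def)
      show "AE g in haar. norm ((norm (A (\<psi> g)))\<^sup>2) \<le> norm ((norm (\<psi> g))\<^sup>2 * K\<^sup>2)"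
        using power_mono[OF K, of _ 2] by (simp add: power_mult_distrib)
    qed (use m in measurable)
    with m show ?thesis by (simp add: L2_def)
  qed
  have c: "aeq (\<lambda>g. A (\<psi> g)) (\<lambda>g. A (\<phi> g))" if "aeq \<psi> \<phi>" for \<psi> \<phi>
    using that unfolding aeq_def by (auto elim: eventually_mono)
  show pc: "pointwise A (cls \<psi>) = cls (\<lambda>g. A (\<psi> g))" if "\<psi> \<in> L2" for \<psi>
    using that unfolding pointwise_def by (rule lift_op_cls[rotated 2]) (use L c in auto)
  assume n: "\<And>v. norm (A v) = norm v"
  have n': "l2norm (\<lambda>g. A (\<psi> g)) = l2norm \<psi>" for \<psi> by (simp add: l2norm_def n)
  show "norm (pointwise A x) = norm x" unfolding pointwise_def by (rule norm_lift_op) (use L c n' in auto)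
  show bl: "bounded_linear (pointwise A)" unfolding pointwise_def
    by (rule bounded_linear_lift_op) (use L c n' in \<open>auto simp: add scaleR\<close>)
  assume comm: "\<And>j v. A (gen j *v v) = gen j *v A v" and xy: "(x, y) \<in> dirac_graph"
  show "(pointwise A x, pointwise A y) \<in> dirac_graph"
  proof (rule smooth_graph_invariant[OF bl _ xy])
    fix u assume u: "smooth_su2 u"
    have s: "smooth_su2 (\<lambda>g. A (u g))" by (rule smooth_linear[OF A u])
    have "cls (\<lambda>g. A (Dsm u g)) = cls (Dsm (\<lambda>g. A (u g)))"
      using L[OF smooth_L2[OF smooth_Dsm[OF u]]] smooth_L2[OF smooth_Dsm[OF s]]
      by (auto simp: cls_eq_iff Dsm_linear[OF A comm u] intro!: aeqI)
    then show "(pointwise A (cls u), pointwise A (cls (Dsm u))) \<in> dirac_graph"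
      using smooth_in_graph[OF s] u by (simp add: pc smooth_L2 smooth_Dsm)
  qed
qed

section \<open>Polynomials in the matrix entries\<close>

definition entry :: "2 \<Rightarrow> 2 \<Rightarrow> mat2 \<Rightarrow> complex" where "entry i k = (\<lambda>g. g $ i $ k)"
text \<open>Scalars enter as constant functions, so that operator identities become identities in
  the commutative ring of functions and can be settled by ring normalisation.\<close>

definition cf :: "complex \<Rightarrow> mat2 \<Rightarrow> complex" where "cf c = (\<lambda>_. c)"

text \<open>Holomorphic polynomials on the whole matrix space, so that partial derivatives make
  sense. Conjugates of entries are covered because on \<open>SU2\<close> they are entries up to
  sign.\<close>

inductive_set Pol :: "(mat2 \<Rightarrow> complex) set" where
  cf [simp, intro]: "cf c \<in> Pol"
| entry [simp, intro]: "entry i k \<in> Pol"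
| add [simp, intro]: "f \<in> Pol \<Longrightarrow> h \<in> Pol \<Longrightarrow> f + h \<in> Pol"
| mult [simp, intro]: "f \<in> Pol \<Longrightarrow> h \<in> Pol \<Longrightarrow> f * h \<in> Pol"

lemma cf_simps: "cf (a + b) = cf a + cf b" "cf (a * b) = cf a * cf b" "cf (- a) = - cf a" "cf (a - b) = cf a - cf b"
    "cf 0 = 0" "cf 1 = 1"
  by (auto simp: cf_def fun_eq_iff)

lemma cf_numeral: "cf (numeral n) = numeral n"
proof -
  have "(numeral n :: mat2 \<Rightarrow> complex) x = numeral n" for x
    by (induction n) (simp_all add: numeral.simps)
  then show ?thesis by (auto simp: cf_def fun_eq_iff)
qed

lemma Pol_simps [simp, intro]: "0 \<in> Pol" "1 \<in> Pol" "numeral n \<in> Pol"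
  using Pol.cf[of 0] Pol.cf[of 1] Pol.cf[of "numeral n"] by (simp_all only: cf_simps cf_numeral)

lemma Pol_minus [simp, intro]: "f \<in> Pol \<Longrightarrow> - f \<in> Pol"
  using Pol.mult[OF Pol.cf[of "-1"], of f] by (simp add: cf_simps)

lemma Pol_diff [simp, intro]: "f \<in> Pol \<Longrightarrow> h \<in> Pol \<Longrightarrow> f - h \<in> Pol"
  using Pol.add[OF _ Pol_minus, of f h] by simp

lemma Pol_sum: "(\<And>i. i \<in> I \<Longrightarrow> f i \<in> Pol) \<Longrightarrow> (\<Sum>i\<in>I. f i) \<in> Pol"
  by (induction I rule: infinite_finite_induct) auto

text \<open>Asks for a complex-linear derivative, that is, holomorphy in the four entries; its
  coefficients are then the values on matrix units, where \<open>pd\<close> reads them off.\<close>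

definition grad :: "(mat2 \<Rightarrow> complex) \<Rightarrow> (2 \<Rightarrow> 2 \<Rightarrow> mat2 \<Rightarrow> complex) \<Rightarrow> bool" where
  "grad f d \<longleftrightarrow> (\<forall>g. (f has_derivative (\<lambda>H. \<Sum>i\<in>UNIV. \<Sum>k\<in>UNIV. d i k g * H $ i $ k)) (at g))"

definition pd :: "2 \<Rightarrow> 2 \<Rightarrow> (mat2 \<Rightarrow> complex) \<Rightarrow> mat2 \<Rightarrow> complex" where
  "pd i k f g = frechet_derivative f (at g) (\<chi> p q. if p = i \<and> q = k then 1 else 0)"

lemma grad_pd:
  assumes "grad f d"
  shows "pd i k f = d i k"
proof
  fix g
  have "frechet_derivative f (at g) = (\<lambda>H. \<Sum>i\<in>UNIV. \<Sum>k\<in>UNIV. d i k g * H $ i $ k)"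
    using assms unfolding grad_def by (intro frechet_derivative_at[symmetric]) blast
  then have "pd i k f g = (\<Sum>p\<in>UNIV. \<Sum>q\<in>UNIV. d p q g * (if p = i \<and> q = k then 1 else 0))"
    by (simp add: pd_def)
  then show "pd i k f g = d i k g" using exhaust_2[of i] exhaust_2[of k] by (auto simp: sum_2)
qed

lemma grad_cf: "grad (cf c) (\<lambda>i k. 0)"
  by (simp add: grad_def cf_def)

lemma grad_entry: "grad (entry p q) (\<lambda>i k. cf (if i = p \<and> k = q then 1 else 0))"
  unfolding grad_def
proof
  fix g :: mat2
  have "(entry p q has_derivative entry p q) (at g)"
    unfolding entry_def
    by (intro bounded_linear_imp_has_derivative bounded_linear_compose[OF bounded_linear_vec_nth bounded_linear_vec_nth])
  moreover have "(\<Sum>i\<in>UNIV. \<Sum>k\<in>UNIV. cf (if i = p \<and> k = q then 1 else 0) g * H $ i $ k) = entry p q H" for H :: mat2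
    using exhaust_2[of p] exhaust_2[of q] by (auto simp: sum_2 cf_def entry_def)
  ultimately show "(entry p q has_derivative (\<lambda>H. \<Sum>i\<in>UNIV. \<Sum>k\<in>UNIV. cf (if i = p \<and> k = q then 1 else 0) g * H $ i $ k)) (at g)"
    by presburger
qed

lemma grad_add:
  assumes "grad f d" "grad h e"
  shows "grad (f + h) (\<lambda>i k. d i k + e i k)"
  unfolding grad_def
proof
  fix g
  show "(f + h has_derivative (\<lambda>H. \<Sum>i\<in>UNIV. \<Sum>k\<in>UNIV. (d i k + e i k) g * H $ i $ k)) (at g)"
    using has_derivative_add[OF assms(1)[unfolded grad_def, rule_format, of g] assms(2)[unfolded grad_def, rule_format, of g]]
    by (simp add: plus_fun_def sum_2 algebra_simps)
qed

lemma grad_mult: "grad f d \<Longrightarrow> grad h e \<Longrightarrow> grad (f * h) (\<lambda>i k. d i k * h + f * e i k)"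
  unfolding grad_def
proof
  fix g assume a: "\<forall>g. (f has_derivative (\<lambda>H. \<Sum>i\<in>UNIV. \<Sum>k\<in>UNIV. d i k g * H $ i $ k)) (at g)"
    "\<forall>g. (h has_derivative (\<lambda>H. \<Sum>i\<in>UNIV. \<Sum>k\<in>UNIV. e i k g * H $ i $ k)) (at g)"
  show "(f * h has_derivative (\<lambda>H. \<Sum>i\<in>UNIV. \<Sum>k\<in>UNIV. (d i k * h + f * e i k) g * H $ i $ k)) (at g)"
    using has_derivative_mult[OF a(1)[rule_format, of g] a(2)[rule_format, of g]]
    by (simp add: times_fun_def plus_fun_def sum_2 algebra_simps)
qed

lemma grad_ex: "f \<in> Pol \<Longrightarrow> \<exists>d. grad f d \<and> (\<forall>i k. d i k \<in> Pol)"
proof (induction rule: Pol.induct)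
  case (cf c) show ?case using grad_cf by blast
next
  case (entry i k) show ?case using grad_entry by blast
next
  case (add f h) then show ?case using grad_add by blast
next
  case (mult f h) then show ?case using grad_mult by blast
qed

lemma grad_Pol: "f \<in> Pol \<Longrightarrow> grad f (\<lambda>i k. pd i k f)" and pd_Pol [simp, intro]: "f \<in> Pol \<Longrightarrow> pd i k f \<in> Pol"
proof -
  have "grad f (\<lambda>i k. pd i k f) \<and> (\<forall>i k. pd i k f \<in> Pol)" if f: "f \<in> Pol"
  proof -
    obtain d where d: "grad f d" "\<forall>i k. d i k \<in> Pol" using grad_ex[OF f] by blast
    have "pd i k f = d i k" for i k by (rule grad_pd[OF d(1)])
    then show ?thesis using d by simp
  qed
  then show "f \<in> Pol \<Longrightarrow> grad f (\<lambda>i k. pd i k f)" "f \<in> Pol \<Longrightarrow> pd i k f \<in> Pol" by blast+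
qed

lemma pd_simps:
  "pd i k (cf c) = 0" "pd i k (entry p q) = cf (if i = p \<and> k = q then 1 else 0)"
  "f \<in> Pol \<Longrightarrow> h \<in> Pol \<Longrightarrow> pd i k (f + h) = pd i k f + pd i k h"
  "f \<in> Pol \<Longrightarrow> h \<in> Pol \<Longrightarrow> pd i k (f * h) = pd i k f * h + f * pd i k h"
  by (simp_all only: grad_pd[OF grad_cf] grad_pd[OF grad_entry] grad_pd[OF grad_add[OF grad_Pol grad_Pol]]
    grad_pd[OF grad_mult[OF grad_Pol grad_Pol]])

text \<open>With \<open>X\<^sub>j\<close> the left-invariant fields, \<open>opZ = \<i> X\<^sub>3\<close>, \<open>opP = \<i> X\<^sub>1 + X\<^sub>2\<close> and \<open>opN = \<i> X\<^sub>1 - X\<^sub>2\<close>;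
  \<open>opL = - (X\<^sub>1\<^sup>2 + X\<^sub>2\<^sup>2 + X\<^sub>3\<^sup>2)\<close> is the Laplacian.\<close>

definition opZ where "opZ f = entry 1 1 * pd 1 1 f + entry 2 1 * pd 2 1 f - entry 1 2 * pd 1 2 f - entry 2 2 * pd 2 2 f"
definition opP where "opP f = 2 * (entry 1 2 * pd 1 1 f + entry 2 2 * pd 2 1 f)"
definition opN where "opN f = 2 * (entry 1 1 * pd 1 2 f + entry 2 1 * pd 2 2 f)"
definition opL where "opL f = opP (opN f) + 2 * opZ f + opZ (opZ f)"

text \<open>Derivations of the ring of polynomials; their effect is fixed by the values on the
  entries, which is how the commutators are verified.\<close>

definition Der :: "((mat2 \<Rightarrow> complex) \<Rightarrow> (mat2 \<Rightarrow> complex)) \<Rightarrow> bool" where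
  "Der D \<longleftrightarrow> (\<forall>f\<in>Pol. D f \<in> Pol) \<and> (\<forall>c. D (cf c) = 0) \<and>
     (\<forall>f\<in>Pol. \<forall>h\<in>Pol. D (f + h) = D f + D h \<and> D (f * h) = D f * h + f * D h)"

lemma Der_pd: "Der (pd i k)"
  by (simp add: Der_def pd_simps)

lemma Der_add: "Der D \<Longrightarrow> Der D' \<Longrightarrow> Der (\<lambda>f. D f + D' f)"
  by (simp add: Der_def algebra_simps)

lemma Der_mult: "h \<in> Pol \<Longrightarrow> Der D \<Longrightarrow> Der (\<lambda>f. h * D f)"
  by (simp add: Der_def algebra_simps)

lemma Der_ops: "Der opZ" "Der opP" "Der opN"
proof -
  have "opZ = (\<lambda>f. ((entry 1 1 * pd 1 1 f + entry 2 1 * pd 2 1 f) + (- entry 1 2) * pd 1 2 f) + (- entry 2 2) * pd 2 2 f)"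
    by (rule ext) (simp add: opZ_def)
  moreover have "Der \<dots>" by (intro Der_add Der_mult Der_pd Pol_minus Pol.entry)
  ultimately show "Der opZ" by simp
  show "Der opP" "Der opN" unfolding opP_def[abs_def] opN_def[abs_def]
    by (intro Der_add Der_mult Der_pd Pol_simps Pol.entry)+
qed

lemma Der_0:
  assumes "Der D"
  shows "D (cf c) = 0" "D 0 = 0" "D 1 = 0" "D (numeral n) = 0"
proof -
  show c: "D (cf c) = 0" for c using assms by (simp add: Der_def)
  show "D 0 = 0" "D 1 = 0" "D (numeral n) = 0" using c[of 0] c[of 1] c[of "numeral n"] by (simp_all add: cf_simps cf_numeral)
qed

lemma Der_2:
  assumes "Der D" "f \<in> Pol" "h \<in> Pol"
  shows "D (f + h) = D f + D h" "D (f * h) = D f * h + f * D h"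
  using assms by (auto simp: Der_def)

lemma Der_1:
  assumes "Der D" "f \<in> Pol"
  shows "D f \<in> Pol" "D (- f) = - D f"
proof -
  show "D f \<in> Pol" using assms by (auto simp: Der_def)
  show "D (- f) = - D f" using Der_2(2)[OF assms(1) Pol.cf assms(2), of "-1"] Der_0(1)[OF assms(1), of "-1"] by (simp add: cf_simps)
qed

lemma Der_diff: "Der D \<Longrightarrow> f \<in> Pol \<Longrightarrow> h \<in> Pol \<Longrightarrow> D (f - h) = D f - D h"
  using Der_2(1)[of D f "- h"] Der_1(2)[of D h] by simp

lemmas op_simps [simp] =
  Der_0[OF Der_ops(1)] Der_1[OF Der_ops(1)] Der_2[OF Der_ops(1)] Der_diff[OF Der_ops(1)]
  Der_0[OF Der_ops(2)] Der_1[OF Der_ops(2)] Der_2[OF Der_ops(2)] Der_diff[OF Der_ops(2)]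
  Der_0[OF Der_ops(3)] Der_1[OF Der_ops(3)] Der_2[OF Der_ops(3)] Der_diff[OF Der_ops(3)]

lemma op_entry [simp]:
  "opZ (entry i 1) = entry i 1" "opZ (entry i 2) = - entry i 2"
  "opP (entry i 1) = 2 * entry i 2" "opP (entry i 2) = 0"
  "opN (entry i 1) = 0" "opN (entry i 2) = 2 * entry i 1"
  using exhaust_2[of i] by (auto simp: opZ_def opP_def opN_def pd_simps cf_simps)

text \<open>The relations of sl(2): \<open>opZ\<close> measures a weight that \<open>opP\<close>
  lowers and \<open>opN\<close> raises by 2. They hold on the entries and pass to products because
  the mixed terms of the Leibniz rule cancel.\<close>

lemma commutators:
  assumes "f \<in> Pol"
  shows "opZ (opP f) = opP (opZ f) - 2 * opP f" "opZ (opN f) = opN (opZ f) + 2 * opN f"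
    "opP (opN f) = opN (opP f) - 4 * opZ f"
proof -
  define Q where "Q f \<longleftrightarrow> opZ (opP f) = opP (opZ f) - 2 * opP f \<and> opZ (opN f) = opN (opZ f) + 2 * opN f
    \<and> opP (opN f) = opN (opP f) - 4 * opZ f" for f
  have base: "Q (cf c)" "Q (entry i k)" for c i k
    using exhaust_2[of k] by (auto simp: Q_def)
  have step: "Q (f + h) \<and> Q (f * h)" if p: "f \<in> Pol" "h \<in> Pol" and "Q f" "Q h" for f h
  proof -
    have e: "opZ (opP f) = opP (opZ f) - 2 * opP f" "opZ (opN f) = opN (opZ f) + 2 * opN f"
      "opP (opN f) = opN (opP f) - 4 * opZ f"
      "opZ (opP h) = opP (opZ h) - 2 * opP h" "opZ (opN h) = opN (opZ h) + 2 * opN h"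
      "opP (opN h) = opN (opP h) - 4 * opZ h" using \<open>Q f\<close> \<open>Q h\<close> by (auto simp: Q_def)
    show ?thesis using p unfolding Q_def by (simp add: e algebra_simps)
  qed
  from assms have "Q f" by (induction rule: Pol.induct) (use base step in blast)+
  then show "opZ (opP f) = opP (opZ f) - 2 * opP f" "opZ (opN f) = opN (opZ f) + 2 * opN f"
    "opP (opN f) = opN (opP f) - 4 * opZ f" by (auto simp: Q_def)
qed

text \<open>On the spinor with components \<open>u\<close>, \<open>v\<close> the operator \<open>T = \<Sum> \<i> \<sigma>\<^sub>j X\<^sub>j\<close> has components \<open>T1 u v\<close>, \<open>T2 u v\<close>.\<close>

definition T1 where "T1 u v = opZ u + opP v"
definition T2 where "T2 u v = opN u - opZ v"

text \<open>The products \<open>sigma_j sigma_k\<close> with \<open>j \<noteq> k\<close> pair with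
  the brackets \<open>[X_j, X_k]\<close>, each twice a third field up to sign; this is the origin of
  the term with \<open>T\<close>.\<close>

lemma T_square:
  assumes "u \<in> Pol" "v \<in> Pol"
  shows "T1 (T1 u v) (T2 u v) = opL u - 2 * T1 u v" "T2 (T1 u v) (T2 u v) = opL v - 2 * T2 u v"
  using assms unfolding T1_def T2_def opL_def by (simp_all add: commutators algebra_simps)

text \<open>Product rule for the Laplacian: 3 is its eigenvalue on an entry, and the cross term,
  \<open>- 2 (X_j g) (X_j psi)\<close> summed over \<open>j\<close>, is \<open>2 g T psi\<close>
  because \<open>X_j g = - i g sigma_j\<close>.\<close>

lemma opL_row:
  assumes "u \<in> Pol" "v \<in> Pol"
  shows "opL (entry i 1 * u + entry i 2 * v)
    = entry i 1 * (opL u + 3 * u + 2 * T1 u v) + entry i 2 * (opL v + 3 * v + 2 * T2 u v)"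
  using assms unfolding T1_def T2_def opL_def by (simp add: commutators algebra_simps)

definition Teig :: "complex \<Rightarrow> (mat2 \<Rightarrow> complex) \<Rightarrow> (mat2 \<Rightarrow> complex) \<Rightarrow> bool" where
  "Teig m u v \<longleftrightarrow> u \<in> Pol \<and> v \<in> Pol \<and> T1 u v = cf m * u \<and> T2 u v = cf m * v"

text \<open>The eigenvalue is parametrised so that \<open>m\<close> and \<open>- m - 2\<close> name
  the same one; a complex parameter allows for this reflection.\<close>

definition Leig :: "complex \<Rightarrow> (mat2 \<Rightarrow> complex) \<Rightarrow> bool" where
  "Leig m f \<longleftrightarrow> f \<in> Pol \<and> opL f = cf (m * (m + 2)) * f"

text \<open>By \<open>L = T^2 + 2 T\<close> the components are Laplace eigenfunctions for
  \<open>m\<close>, and the product rule adds up to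
  \<open>m (m + 2) + 3 + 2 m = (m + 1) (m + 3)\<close>.\<close>

lemma Teig_row:
  assumes "Teig m u v"
  shows "Leig (m + 1) (entry i 1 * u + entry i 2 * v)"
proof -
  have p: "u \<in> Pol" "v \<in> Pol" and e: "T1 u v = cf m * u" "T2 u v = cf m * v" using assms by (auto simp: Teig_def)
  have s: "T1 (cf m * u) (cf m * v) = cf m * T1 u v" "T2 (cf m * u) (cf m * v) = cf m * T2 u v"
    unfolding T1_def T2_def using p by (simp_all add: algebra_simps)
  have "opL u = cf m * (cf m * u) + 2 * (cf m * u)" "opL v = cf m * (cf m * v) + 2 * (cf m * v)"
    using T_square[OF p] unfolding e s by (simp_all add: algebra_simps)
  then have "opL (entry i 1 * u + entry i 2 * v) = cf ((m + 1) * (m + 3)) * (entry i 1 * u + entry i 2 * v)"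
    unfolding opL_row[OF p] e by (simp add: cf_simps cf_numeral algebra_simps)
  then show ?thesis unfolding Leig_def using p by (simp add: add.assoc)
qed

text \<open>\<open>T\<^sup>2 + 2 T\<close> is the Laplacian, so \<open>T\<close> has eigenvalues \<open>m\<close> and \<open>- m - 2\<close> on spinors with Laplace eigenvalue \<open>m (m + 2)\<close>.\<close>

lemma Leig_split:
  assumes "Leig m f"
  shows "Teig m (opZ f + cf (m + 2) * f) (opN f)" "Teig (- m - 2) (cf m * f - opZ f) (- opN f)"
    "Teig m (opP f) (cf (m + 2) * f - opZ f)" "Teig (- m - 2) (- opP f) (cf m * f + opZ f)"
proof -
  have f: "f \<in> Pol" and "opL f = cf (m * (m + 2)) * f" using assms by (auto simp: Leig_def)
  then have e: "opZ (opZ f) = cf m * cf m * f + 2 * cf m * f - opP (opN f) - 2 * opZ f"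
    by (simp add: opL_def cf_simps cf_numeral algebra_simps)
  \<comment> \<open>The four spinors are \<open>T + m + 2\<close> and \<open>m - T\<close> applied
    to \<open>(f, 0)\<close> and to \<open>(0, f)\<close>; the product
    \<open>(T - m) (T + m + 2)\<close> annihilates both by the Laplace equation.\<close>
  show "Teig m (opZ f + cf (m + 2) * f) (opN f)" "Teig (- m - 2) (cf m * f - opZ f) (- opN f)"
    "Teig m (opP f) (cf (m + 2) * f - opZ f)" "Teig (- m - 2) (- opP f) (cf m * f + opZ f)"
    using f unfolding Teig_def T1_def T2_def
    by (simp_all add: e commutators cf_simps cf_numeral algebra_simps)
qed

lemma Leig_scale: "Leig m f \<Longrightarrow> Leig m (cf c * f)"
proof -
  assume "Leig m f"
  moreover have "opL (cf c * f) = cf c * opL f" if "f \<in> Pol" using that by (simp add: opL_def algebra_simps)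
  ultimately show ?thesis by (simp add: Leig_def ac_simps)
qed

lemma Leig_congL: "Leig m f \<Longrightarrow> m * (m + 2) = n * (n + 2) \<Longrightarrow> Leig n f"
  by (simp add: Leig_def)

section \<open>Polynomial eigenspinors\<close>

text \<open>The chain rule along \<open>g ** expc j t\<close>; it extends \<open>X_j\<close> to a
  map of polynomials on all matrices.\<close>

definition Xp :: "nat \<Rightarrow> (mat2 \<Rightarrow> complex) \<Rightarrow> mat2 \<Rightarrow> complex" where
  "Xp j f = (\<Sum>i\<in>UNIV. \<Sum>k\<in>UNIV. pd i k f * (entry i 1 * cf (gen j $ 1 $ k) + entry i 2 * cf (gen j $ 2 $ k)))"

lemma Xp_Pol [simp, intro]: "f \<in> Pol \<Longrightarrow> Xp j f \<in> Pol"
  unfolding Xp_def by (intro Pol_sum Pol.intros pd_Pol)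

lemma Pol_has_derivative:
  "f \<in> Pol \<Longrightarrow> (f has_derivative (\<lambda>H. \<Sum>i\<in>UNIV. \<Sum>k\<in>UNIV. pd i k f g * H $ i $ k)) (at g)"
  using grad_Pol unfolding grad_def by blast

lemma Pol_continuous: "f \<in> Pol \<Longrightarrow> continuous_on S f"
  using Pol_has_derivative has_derivative_continuous by (intro continuous_at_imp_continuous_on) blast

lemma Pol_ddir:
  assumes "f \<in> Pol"
  shows "ddir j f (Xp j f)"
  unfolding ddir_def
proof
  fix g
  let ?L = "\<lambda>H :: mat2. \<Sum>i\<in>UNIV. \<Sum>k\<in>UNIV. pd i k f g * H $ i $ k"
  have "(f has_derivative ?L) (at (g ** expc j 0))"
    using Pol_has_derivative[OF assms, of g] by (simp add: expc_0)
  then have "(f \<circ> (\<lambda>t. g ** expc j t) has_derivative ?L \<circ> (\<lambda>t. t *\<^sub>R (g ** gen j))) (at 0)"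
    by (intro diff_chain_at has_vector_derivative_expc[unfolded has_vector_derivative_def])
  moreover have "?L \<circ> (\<lambda>t. t *\<^sub>R (g ** gen j)) = (\<lambda>t. t *\<^sub>R Xp j f g)"
    by (simp add: fun_eq_iff Xp_def sum_2 mat2_mult_nth plus_fun_def times_fun_def cf_def entry_def scaleR_complex algebra_simps)
  ultimately show "((\<lambda>t. f (g ** expc j t)) has_vector_derivative Xp j f g) (at 0)"
    by (simp add: has_vector_derivative_def o_def)
qed

lemma Xp_op:
  "Xp 1 f = cf (- \<i> / 2) * (opP f + opN f)" "Xp 2 f = cf (1 / 2) * (opP f - opN f)" "Xp 3 f = cf (- \<i>) * opZ f"
proof -
  have n: "(numeral n :: mat2 \<Rightarrow> complex) g = numeral n" for n g
    using cf_numeral[of n] by (metis cf_def)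
  show "Xp 1 f = cf (- \<i> / 2) * (opP f + opN f)" "Xp 2 f = cf (1 / 2) * (opP f - opN f)" "Xp 3 f = cf (- \<i>) * opZ f"
    by (simp_all add: fun_eq_iff Xp_def sum_2 gen_nth plus_fun_def times_fun_def fun_diff_def cf_def entry_def
        opP_def opN_def opZ_def n algebra_simps)
qed

definition sp :: "(mat2 \<Rightarrow> complex) \<Rightarrow> (mat2 \<Rightarrow> complex) \<Rightarrow> sfield" where
  "sp u v g = (\<chi> k. if k = 1 then u g else v g)"

lemma sp_nth: "sp u v g $ 1 = u g" "sp u v g $ 2 = v g"
  by (simp_all add: sp_def)

lemma sp_eq: "sp u v = (\<lambda>g. u g *s axis 1 1 + v g *s axis 2 1)"
  by (simp add: fun_eq_iff spinor_eq_iff sp_nth axis_def)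

lemma sp_add: "sp (u + u') (v + v') = (\<lambda>g. sp u v g + sp u' v' g)"
  by (simp add: fun_eq_iff spinor_eq_iff sp_nth)

lemma bounded_linear_vscale_left: "bounded_linear (\<lambda>c :: complex. c *s (b :: spinor))"
  by (intro linear_conv_bounded_linear[THEN iffD1] linearI) (simp_all add: spinor_eq_iff algebra_simps)

lemma sp_ddir: "u \<in> Pol \<Longrightarrow> v \<in> Pol \<Longrightarrow> ddir j (sp u v) (sp (Xp j u) (Xp j v))"
  unfolding sp_eq by (intro ddir_add ddir_linear[OF bounded_linear_vscale_left] Pol_ddir)

lemma sp_smooth:
  assumes "u \<in> Pol" "v \<in> Pol"
  shows "smooth_su2 (sp u v)"
proof (rule smooth_coinduct[where R = "\<lambda>f. \<exists>u\<in>Pol. \<exists>v\<in>Pol. f = sp u v"])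
  show "\<exists>u'\<in>Pol. \<exists>v'\<in>Pol. sp u v = sp u' v'" using assms by blast
  fix f assume "\<exists>u\<in>Pol. \<exists>v\<in>Pol. f = sp u v"
  then obtain a b where ab: "a \<in> Pol" "b \<in> Pol" "f = sp a b" by blast
  show "continuous_on SU2 f" unfolding ab(3) sp_eq
    by (intro continuous_intros bounded_linear.continuous_on[OF bounded_linear_vscale_left] Pol_continuous ab)
  show "\<exists>f'. (\<exists>u\<in>Pol. \<exists>v\<in>Pol. f' = sp u v) \<and> ddir j f f'" for j
    using sp_ddir[OF ab(1,2)] Xp_Pol ab by blast
qed

lemma sp_L2: "u \<in> Pol \<Longrightarrow> v \<in> Pol \<Longrightarrow> sp u v \<in> L2"
  by (intro smooth_L2 sp_smooth)

lemma Dsm_sp: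
  assumes "u \<in> Pol" "v \<in> Pol" "g \<in> SU2"
  shows "Dsm (sp u v) g = sp (T1 u v + cf (3/2) * u) (T2 u v + cf (3/2) * v) g"
proof -
  have "Xd j (sp u v) g = sp (Xp j u) (Xp j v) g" for j by (rule ddir_Xd[OF sp_ddir[OF assms(1,2)] assms(3)])
  then show ?thesis
    unfolding Dsm_eq spinor_eq_iff
    by (simp add: sp_nth mat2_mult_vec_nth gen_nth Xp_op Xp_op(1)[unfolded One_nat_def] T1_def T2_def plus_fun_def times_fun_def fun_diff_def cf_def
        scaleR_complex algebra_simps)
qed

text \<open>Here \<open>(f, L f) = \<Sum> \<parallel>X\<^sub>j f\<parallel>\<^sup>2\<close> enters.\<close>

lemma harmonic_Xp_null:
  assumes "Leig 0 f"
  shows "AE g in haar. Xp 1 f g = 0 \<and> Xp 2 f g = 0 \<and> Xp 3 f g = 0"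
proof -
  have f: "f \<in> Pol" and L: "opL f = 0" using assms by (auto simp: Leig_def cf_simps)
  \<comment> \<open>The derivative along \<open>X_j\<close> of the real inner product of
    \<open>f\<close> and \<open>X_j f\<close>, so its integral is zero. Summed over \<open>j\<close>
    the second-order terms cancel by \<open>lap\<close> and the squared norms remain.\<close>
  define h where "h j g = inner (f g) (Xp j (Xp j f) g) + inner (Xp j f g) (Xp j f g)" for j g
  have ch: "continuous_on SU2 (h j)" for j
    unfolding h_def by (intro continuous_intros Pol_continuous Xp_Pol f)
  have h0: "(\<integral>g. h j g \<partial>haar) = 0" for j
  proof (rule integral_ddir_eq_0[OF _ ch])
    show "ddir j (\<lambda>g. inner (f g) (Xp j f g)) (h j)"
      unfolding h_def by (intro ddir_inner Pol_ddir Xp_Pol f)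
  qed (intro continuous_intros Pol_continuous Xp_Pol f)
  have lap: "Xp 1 (Xp 1 f) + Xp 2 (Xp 2 f) + Xp 3 (Xp 3 f) = 0"
  proof -
    have e: "opP (opN f) = - 2 * opZ f - opZ (opZ f)"
    proof -
      have "opP (opN f) = opL f - 2 * opZ f - opZ (opZ f)" by (simp add: opL_def)
      then show ?thesis by (simp add: L)
    qed
    have c: "opN (opP f) = opP (opN f) + 4 * opZ f" using commutators(3)[OF f] by simp
    have k: "cf (- \<i> / 2) * cf (- \<i> / 2) = - cf (1 / 4)" "cf (1 / 2) * cf (1 / 2) = cf (1 / 4)" "cf (- \<i>) * cf (- \<i>) = - 1"
        "4 * cf (1 / 4) = 1"
      by (simp_all add: cf_simps[symmetric] cf_numeral[symmetric])
    have "Xp 1 (Xp 1 f) + Xp 2 (Xp 2 f) + Xp 3 (Xp 3 f)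
        = (cf (- \<i> / 2) * cf (- \<i> / 2)) * (opP (opP f) + opP (opN f) + opN (opP f) + opN (opN f))
        + (cf (1 / 2) * cf (1 / 2)) * (opP (opP f) - opP (opN f) - opN (opP f) + opN (opN f))
        + (cf (- \<i>) * cf (- \<i>)) * opZ (opZ f)"
      unfolding Xp_op using f by (simp add: algebra_simps)
    also have "\<dots> = - (4 * cf (1 / 4)) * (opZ (opZ f)) - 2 * cf (1/4) * (opP (opN f) + opN (opP f)) "
      unfolding k(1-3) by (simp add: k(4) algebra_simps)
    also have "\<dots> = 0" unfolding c e by (simp add: algebra_simps)
    finally show ?thesis .
  qed
  let ?n = "\<lambda>g. (cmod (Xp 1 f g))\<^sup>2 + (cmod (Xp 2 f g))\<^sup>2 + (cmod (Xp 3 f g))\<^sup>2"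
  have "?n g = h 1 g + h 2 g + h 3 g" for g
  proof -
    have "Xp 1 (Xp 1 f) g + Xp 2 (Xp 2 f) g + Xp 3 (Xp 3 f) g = 0" using lap by (simp add: fun_eq_iff)
    then have "inner (f g) (Xp 1 (Xp 1 f) g) + inner (f g) (Xp 2 (Xp 2 f) g) + inner (f g) (Xp 3 (Xp 3 f) g) = 0"
      by (metis inner_add_right inner_zero_right)
    then show ?thesis by (simp add: h_def power2_norm_eq_inner)
  qed
  then have "(\<integral>g. ?n g \<partial>haar) = 0" using integrable_haar[OF ch] h0 by simp
  moreover have "integrable haar ?n" by (intro integrable_haar continuous_intros Pol_continuous Xp_Pol f)
  ultimately have "AE g in haar. ?n g = 0"
    by (subst (asm) integral_nonneg_eq_0_iff_AE) auto
  then show ?thesis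
    by (rule AE_mp) (auto simp: add_nonneg_eq_0_iff)
qed

lemma harmonic_op_null:
  assumes "Leig 0 f"
  shows "AE g in haar. opZ f g = 0 \<and> opP f g = 0 \<and> opN f g = 0"
  using harmonic_Xp_null[OF assms] unfolding Xp_op
  by (rule AE_mp) (auto simp: times_fun_def plus_fun_def fun_diff_def cf_def)

inductive Spec :: "(mat2 \<Rightarrow> complex) \<Rightarrow> bool" where
  eig: "Leig (of_nat m) f \<Longrightarrow> Spec f"
| null: "f \<in> Pol \<Longrightarrow> AE g in haar. f g = 0 \<Longrightarrow> Spec f"
| add: "Spec f \<Longrightarrow> Spec h \<Longrightarrow> Spec (f + h)"

lemma Spec_scale: "Spec f \<Longrightarrow> Spec (cf c * f)"
proof (induction rule: Spec.induct)
  case (eig m f) then show ?case by (intro Spec.eig Leig_scale)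
next
  case (null f)
  have "AE g in haar. (cf c * f) g = 0" using null(2) by (rule eventually_mono) simp
  then have "Spec (cf c * f)" using null(1) by (intro Spec.null) auto
  then show ?case .
next
  case (add f h) then show ?case unfolding distrib_left by (rule_tac Spec.add)
qed

text \<open>Pairing gives the parameter \<open>- m - 1\<close>, the reflection of
  \<open>m - 1\<close>. For \<open>m = 0\<close> this is -1 and no natural parameter fits, which is
  why the spinor is required to be null in that case.\<close>

lemma Teig_minus_row_Spec:
  assumes "Leig (of_nat m) f" "Teig (- of_nat m - 2) u v" "m = 0 \<Longrightarrow> AE g in haar. u g = 0 \<and> v g = 0"
  shows "Spec (entry i 1 * u + entry i 2 * v)"
proof (cases m)
  case 0
  have "u \<in> Pol" "v \<in> Pol" using assms(2) by (auto simp: Teig_def)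
  with assms(3)[OF 0] show ?thesis
    by (intro Spec.null) (auto elim: eventually_mono)
next
  case (Suc n)
  have "Leig (of_nat n) (entry i 1 * u + entry i 2 * v)"
    by (rule Leig_congL[OF Teig_row[OF assms(2)]]) (simp add: Suc algebra_simps)
  then show ?thesis by (rule Spec.eig)
qed

text \<open>\<open>(T + m + 2) + (m - T) = 2 m + 2\<close> is nonzero, so \<open>(f, 0)\<close> and
  \<open>(0, f)\<close> are, up to this factor, sums of two eigenspinors. Pairing with row
  \<open>i\<close> extracts \<open>f\<close> times the first or the second entry of that row, and
  each eigenspinor contributes a member of \<open>Spec\<close>.\<close>

lemma Spec_entry: "Spec f \<Longrightarrow> Spec (entry i k * f)"
proof (induction rule: Spec.induct)
  case (eig m f)
  have f: "f \<in> Pol" using eig by (simp add: Leig_def)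
  note s = Leig_split[OF eig]
  define a where "a = (2 * of_nat m + 2 :: complex)"
  have a: "a \<noteq> 0" unfolding a_def using of_nat_neq_0[of "2 * m + 1", where 'a = complex] by (simp add: add.commute)
  have n: "AE g in haar. opZ f g = 0 \<and> opP f g = 0 \<and> opN f g = 0" if "m = 0"
    using harmonic_op_null[of f] eig that by simp
  have minus: "Spec (entry i 1 * (cf (of_nat m) * f - opZ f) + entry i 2 * (- opN f))"
    "Spec (entry i 1 * (- opP f) + entry i 2 * (cf (of_nat m) * f + opZ f))"
  proof -
    show "Spec (entry i 1 * (cf (of_nat m) * f - opZ f) + entry i 2 * (- opN f))"
      by (rule Teig_minus_row_Spec[OF eig s(2)]) (use n in \<open>auto simp: cf_def elim: eventually_mono\<close>)
    show "Spec (entry i 1 * (- opP f) + entry i 2 * (cf (of_nat m) * f + opZ f))"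
      by (rule Teig_minus_row_Spec[OF eig s(4)]) (use n in \<open>auto simp: cf_def elim: eventually_mono\<close>)
  qed
  have plus: "Spec (entry i 1 * u + entry i 2 * v)" if "Teig (of_nat m) u v" for u v
    using Teig_row[OF that, of i] Spec.eig[of "Suc m"] by (simp add: add.commute)
  have "entry i 1 * (cf a * f) = (entry i 1 * (opZ f + cf (of_nat m + 2) * f) + entry i 2 * opN f)
      + (entry i 1 * (cf (of_nat m) * f - opZ f) + entry i 2 * (- opN f))"
    "entry i 2 * (cf a * f) = (entry i 1 * opP f + entry i 2 * (cf (of_nat m + 2) * f - opZ f))
      + (entry i 1 * (- opP f) + entry i 2 * (cf (of_nat m) * f + opZ f))"
    by (simp_all add: a_def cf_simps cf_numeral algebra_simps)
  then have "Spec (entry i 1 * (cf a * f))" "Spec (entry i 2 * (cf a * f))"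
    using Spec.add[OF plus[OF s(1)] minus(1)] Spec.add[OF plus[OF s(3)] minus(2)] by (simp_all only:)
  then have "Spec (entry i k * (cf a * f))" using exhaust_2[of k] by blast
  then have "Spec (cf (1 / a) * (entry i k * (cf a * f)))" by (rule Spec_scale)
  moreover have "cf (1 / a) * (entry i k * (cf a * f)) = entry i k * f"
    using a by (auto simp: fun_eq_iff cf_def)
  ultimately show ?case by (simp only:)
next
  case (null f)
  have "AE g in haar. (entry i k * f) g = 0" using null(2) by (rule eventually_mono) simp
  then have "Spec (entry i k * f)" using null(1) by (intro Spec.null) auto
  then show ?case .
next
  case (add f h) then show ?case unfolding distrib_left by (rule_tac Spec.add)
qed

text \<open>The induction runs over the multiplier: multiplication by \<open>f\<close> preserves
  \<open>Spec\<close>. The constant 1, an eigenfunction for \<open>m = 0\<close>, is then multiplied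
  by \<open>f\<close>.\<close>

lemma Pol_Spec:
  assumes "f \<in> Pol"
  shows "Spec f"
proof -
  define Q where "Q f \<longleftrightarrow> (\<forall>h. Spec h \<longrightarrow> Spec (f * h))" for f
  have base: "Q (cf c)" "Q (entry i k)" for c i k
    by (auto simp: Q_def Spec_scale Spec_entry)
  have step: "Q (f + h)" "Q (f * h)" if "Q f" "Q h" for f h
    using that by (auto simp: Q_def distrib_right mult.assoc intro: Spec.add)
  from assms have "Q f" by (induction rule: Pol.induct) (use base step in blast)+
  then have "\<forall>h. Spec h \<longrightarrow> Spec (f * h)" by (simp add: Q_def)
  moreover have "Leig (of_nat 0) 1" by (simp add: Leig_def opL_def cf_simps)
  ultimately show ?thesis using Spec.eig by (metis mult.right_neutral)
qed

text \<open>\<open>m + 3/2\<close> is the corresponding Dirac eigenvalue; excluding zero makes these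
  classes eligible for \<open>total\<close>.\<close>

definition eigenspinors :: "spinor_l2 set" where
  "eigenspinors = {cls (sp u v) | u v m. Teig (complex_of_real m) u v \<and> m + 3/2 \<noteq> 0}"

lemma Teig_scale: "Teig m u v \<Longrightarrow> Teig m (cf c * u) (cf c * v)"
proof -
  assume t: "Teig m u v"
  then have p: "u \<in> Pol" "v \<in> Pol" by (auto simp: Teig_def)
  have "T1 (cf c * u) (cf c * v) = cf c * T1 u v" "T2 (cf c * u) (cf c * v) = cf c * T2 u v"
    unfolding T1_def T2_def using p by (simp_all add: algebra_simps)
  then show ?thesis using t by (simp add: Teig_def ac_simps)
qed

lemma cls_sp_add:
  "u \<in> Pol \<Longrightarrow> v \<in> Pol \<Longrightarrow> u' \<in> Pol \<Longrightarrow> v' \<in> Pol \<Longrightarrow> cls (sp (u + u') (v + v')) = cls (sp u v) + cls (sp u' v')"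
  by (simp add: sp_add cls_add sp_L2)

text \<open>The splitting by \<open>T + m + 2\<close> and \<open>m - T\<close> again, divided by
  \<open>2 m + 2\<close>; null polynomials give the zero class.\<close>

lemma Spec_spinor: "Spec f \<Longrightarrow> f \<in> Pol \<and> cls (sp f 0) \<in> span eigenspinors \<and> cls (sp 0 f) \<in> span eigenspinors"
proof (induction rule: Spec.induct)
  case (eig m f)
  have f: "f \<in> Pol" using eig by (simp add: Leig_def)
  note s = Leig_split[OF eig]
  define a where "a = (2 * of_nat m + 2 :: complex)"
  have a: "a \<noteq> 0" unfolding a_def using of_nat_neq_0[of "2 * m + 1", where 'a = complex] by (simp add: add.commute)
  have ca: "cf (1 / a) * (cf a * f) = f" using a by (auto simp: fun_eq_iff times_fun_def cf_def)
  have sum: "cls (sp (cf c * (u + u')) (cf c * (v + v'))) \<in> span eigenspinors"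
    if t: "Teig (of_nat m) u v" "Teig (- of_nat m - 2) u' v'" for u v u' v' c
  proof -
    have "Teig (complex_of_real (real m)) (cf c * u) (cf c * v)" "Teig (complex_of_real (- real m - 2)) (cf c * u') (cf c * v')"
      using t[THEN Teig_scale] by simp_all
    moreover have "real m + 3/2 \<noteq> 0" "- real m - 2 + 3/2 \<noteq> 0" by linarith+
    ultimately have "cls (sp (cf c * u) (cf c * v)) \<in> eigenspinors" "cls (sp (cf c * u') (cf c * v')) \<in> eigenspinors"
      unfolding eigenspinors_def by blast+
    moreover have "cls (sp (cf c * (u + u')) (cf c * (v + v'))) = cls (sp (cf c * u) (cf c * v)) + cls (sp (cf c * u') (cf c * v'))"
      unfolding distrib_left using t by (intro cls_sp_add) (auto simp: Teig_def)
    ultimately show ?thesis by (simp add: span_add span_base)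
  qed
  have "opZ f + cf (of_nat m + 2) * f + (cf (of_nat m) * f - opZ f) = cf a * f"
    "cf (of_nat m + 2) * f - opZ f + (cf (of_nat m) * f + opZ f) = cf a * f"
    by (simp_all add: a_def cf_simps cf_numeral algebra_simps)
  then have "f \<in> Pol \<and> cls (sp f 0) \<in> span eigenspinors \<and> cls (sp 0 f) \<in> span eigenspinors"
    using f sum[OF s(1,2), of "1 / a"] sum[OF s(3,4), of "1 / a"] by (simp add: ca)
  then show ?case .
next
  case (null f)
  have "cls (sp f 0) = cls (\<lambda>g. 0)" "cls (sp 0 f) = cls (\<lambda>g. 0)"
    using null sp_L2[of f 0] sp_L2[of 0 f] L2_zero
    by (auto simp: cls_eq_iff aeq_def spinor_eq_iff sp_nth elim: eventually_mono)
  then have "f \<in> Pol \<and> cls (sp f 0) \<in> span eigenspinors \<and> cls (sp 0 f) \<in> span eigenspinors"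
    using null by (simp add: cls_zero span_zero)
  then show ?case .
next
  case (add f h)
  have "f \<in> Pol \<and> cls (sp f 0) \<in> span eigenspinors \<and> cls (sp 0 f) \<in> span eigenspinors"
    "h \<in> Pol \<and> cls (sp h 0) \<in> span eigenspinors \<and> cls (sp 0 h) \<in> span eigenspinors" by (fact add)+
  then have "f + h \<in> Pol \<and> cls (sp (f + h) 0) \<in> span eigenspinors \<and> cls (sp 0 (f + h)) \<in> span eigenspinors"
    using cls_sp_add[of f 0 h 0] cls_sp_add[of 0 f 0 h] by (simp add: span_add)
  then show ?case .
qed

lemma sp_in_span: "u \<in> Pol \<Longrightarrow> v \<in> Pol \<Longrightarrow> cls (sp u v) \<in> span eigenspinors"
  using Spec_spinor[OF Pol_Spec, of u] Spec_spinor[OF Pol_Spec, of v] cls_sp_add[of u 0 0 v] by (simp add: span_add)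

lemma eigenspinors_graph:
  assumes "Teig (complex_of_real m) u v"
  shows "(cls (sp u v), (m + 3/2) *\<^sub>R cls (sp u v)) \<in> dirac_graph"
    and "g \<in> SU2 \<Longrightarrow> Dsm (sp u v) g = (m + 3/2) *\<^sub>R sp u v g"
proof -
  have p: "u \<in> Pol" "v \<in> Pol" using assms by (auto simp: Teig_def)
  show D: "Dsm (sp u v) g = (m + 3/2) *\<^sub>R sp u v g" if "g \<in> SU2" for g
    using assms unfolding Dsm_sp[OF p that]
    by (simp add: Teig_def spinor_eq_iff sp_nth plus_fun_def times_fun_def cf_def scaleR_complex algebra_simps)
  have "cls (Dsm (sp u v)) = (m + 3/2) *\<^sub>R cls (sp u v)"
    using D p by (simp add: cls_scaleR[symmetric] sp_L2 cls_eq_iff L2_scaleR smooth_L2 smooth_Dsm sp_smooth aeqI)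
  then show "(cls (sp u v), (m + 3/2) *\<^sub>R cls (sp u v)) \<in> dirac_graph"
    using smooth_in_graph[OF sp_smooth[OF p]] by simp
qed

section \<open>Density of the eigenspinors in \<open>L^2\<close>\<close>

lemma cnj_entry_Pol: "\<exists>f\<in>Pol. \<forall>g\<in>SU2. f g = cnj (g $ i $ k)"
proof -
  have "\<forall>g\<in>SU2. entry 2 2 g = cnj (g $ 1 $ 1)" "\<forall>g\<in>SU2. entry 1 1 g = cnj (g $ 2 $ 2)"
    "\<forall>g\<in>SU2. (- entry 2 1) g = cnj (g $ 1 $ 2)" "\<forall>g\<in>SU2. (- entry 1 2) g = cnj (g $ 2 $ 1)"
    using SU2_entries by (auto simp: entry_def)
  then show ?thesis using exhaust_2[of i] exhaust_2[of k] Pol.entry Pol_minus by metis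
qed

text \<open>Bridge to Stone-Weierstrass, whose polynomials involve real and imaginary parts of the
  entries: conjugates of entries being polynomials on \<open>SU2\<close>, these parts are
  polynomials there too.\<close>

lemma real_polynomial_Pol:
  assumes "real_polynomial_function p"
  shows "\<exists>f\<in>Pol. \<forall>g\<in>SU2. f g = complex_of_real (p g)"
  using assms
proof (induction rule: real_polynomial_function.induct)
  case (linear l)
  interpret bounded_linear l by fact
  \<comment> \<open>Matrix units times 1 and \<open>\<i>\<close> form a real basis, in which the
    merely real-linear \<open>l\<close> is expanded.\<close>
  define E where "E i k c = (\<chi> p q. if p = i \<and> q = k then c else (0 :: complex))" for i k :: 2 and c
  have l: "l g = (\<Sum>i\<in>UNIV. \<Sum>k\<in>UNIV. Re (g $ i $ k) * l (E i k 1) + Im (g $ i $ k) * l (E i k \<i>))" for g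
  proof -
    have "g = (\<Sum>i\<in>UNIV. \<Sum>k\<in>UNIV. Re (g $ i $ k) *\<^sub>R E i k 1 + Im (g $ i $ k) *\<^sub>R E i k \<i>)"
      by (simp add: sum_2 mat2_eq_iff E_def complex_eq_iff)
    from arg_cong[OF this, of l] show ?thesis by (simp add: sum add scaleR)
  qed
  have re: "\<exists>f\<in>Pol. \<forall>g\<in>SU2. f g = complex_of_real (Re (g $ i $ k))"
    and im: "\<exists>f\<in>Pol. \<forall>g\<in>SU2. f g = complex_of_real (Im (g $ i $ k))" for i k
  proof -
    obtain f where f: "f \<in> Pol" "\<forall>g\<in>SU2. f g = cnj (g $ i $ k)" using cnj_entry_Pol by blast
    have "cf (1/2) * (entry i k + f) \<in> Pol" "cf (- \<i>/2) * (entry i k - f) \<in> Pol" using f(1) by simp_all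
    moreover have "\<forall>g\<in>SU2. (cf (1/2) * (entry i k + f)) g = complex_of_real (Re (g $ i $ k))" "\<forall>g\<in>SU2. (cf (- \<i>/2) * (entry i k - f)) g = complex_of_real (Im (g $ i $ k))"
      using f by (auto simp: cf_def entry_def complex_eq_iff)
    ultimately show "\<exists>f\<in>Pol. \<forall>g\<in>SU2. f g = complex_of_real (Re (g $ i $ k))"
      "\<exists>f\<in>Pol. \<forall>g\<in>SU2. f g = complex_of_real (Im (g $ i $ k))" by blast+
  qed
  obtain R where R: "\<And>i k. R i k \<in> Pol" "\<And>i k g. g \<in> SU2 \<Longrightarrow> R i k g = complex_of_real (Re (g $ i $ k))" using re by metis
  obtain I where I: "\<And>i k. I i k \<in> Pol" "\<And>i k g. g \<in> SU2 \<Longrightarrow> I i k g = complex_of_real (Im (g $ i $ k))" using im by metis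
  let ?f = "\<Sum>i\<in>UNIV. \<Sum>k\<in>UNIV. R i k * cf (l (E i k 1)) + I i k * cf (l (E i k \<i>))"
  have "?f \<in> Pol" by (intro Pol_sum Pol.intros R I)
  moreover have "?f g = complex_of_real (l g)" if "g \<in> SU2" for g
    unfolding l[of g] using R(2)[OF that] I(2)[OF that] by (simp add: sum_2 plus_fun_def times_fun_def cf_def)
  ultimately show ?case by blast
next
  case (const c)
  have "\<forall>g\<in>SU2. cf (of_real c) g = complex_of_real c" by (simp add: cf_def)
  then show ?case using Pol.cf by blast
next
  case (add p q)
  then obtain f h where "f \<in> Pol" "h \<in> Pol" "\<forall>g\<in>SU2. f g = complex_of_real (p g)" "\<forall>g\<in>SU2. h g = complex_of_real (q g)" by blast
  then have "f + h \<in> Pol" "\<forall>g\<in>SU2. (f + h) g = complex_of_real (p g + q g)" by auto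
  then show ?case by blast
next
  case (mult p q)
  then obtain f h where "f \<in> Pol" "h \<in> Pol" "\<forall>g\<in>SU2. f g = complex_of_real (p g)" "\<forall>g\<in>SU2. h g = complex_of_real (q g)" by blast
  then have "f * h \<in> Pol" "\<forall>g\<in>SU2. (f * h) g = complex_of_real (p g * q g)" by auto
  then show ?case by blast
qed

text \<open>A class orthogonal to all eigenspinors is orthogonal to \<open>p b\<close> for every
  real polynomial \<open>p\<close> and constant spinor \<open>b\<close>, so its component along
  \<open>b\<close> vanishes a.e.\<close>

lemma eigenspinors_total: "closure (span eigenspinors) = UNIV"
proof (rule closure_span_eq_UNIV)
  fix x assume x: "\<And>e. e \<in> eigenspinors \<Longrightarrow> inner x e = 0"
  obtain \<psi> where \<psi>: "\<psi> \<in> L2" "x = cls \<psi>" using rep by metis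
  have "AE g in haar. inner (\<psi> g) b = 0" for b
  proof (rule AE_zero_if_orthogonal_to_polynomials[OF _ sets_haar compact_SU2])
    show "finite_measure haar" by (rule haar.finite_measure_axioms)
    have "(\<lambda>g. b) \<in> L2" by (intro L2_continuous continuous_intros)
    then show "integrable haar (\<lambda>g. inner (\<psi> g) b)" by (rule L2_integrable_inner[OF \<psi>(1)])
    fix p :: "mat2 \<Rightarrow> real" assume "real_polynomial_function p"
    from real_polynomial_Pol[OF this] obtain f
      where f: "f \<in> Pol" "\<forall>g\<in>SU2. f g = complex_of_real (p g)" by blast
    let ?s = "sp (f * cf (b $ 1)) (f * cf (b $ 2))"
    have s: "?s g = p g *\<^sub>R b" if "g \<in> SU2" for g
      using f(2)[rule_format, OF that] by (simp add: spinor_eq_iff sp_nth cf_def scaleR_complex)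
    have L: "?s \<in> L2" by (rule sp_L2) (use f in auto)
    have "cls ?s \<in> closure (span eigenspinors)"
      by (rule subsetD[OF closure_subset], rule sp_in_span) (use f in auto)
    then have "inner x (cls ?s) = 0" using inner_zero_closure_span[of eigenspinors x] x by blast
    then have "(\<integral>g. inner (\<psi> g) (?s g) \<partial>haar) = 0" by (simp add: \<psi> inner_cls L)
    also have "(\<integral>g. inner (\<psi> g) (?s g) \<partial>haar) = (\<integral>g. p g * inner (\<psi> g) b \<partial>haar)"
      by (rule Bochner_Integration.integral_cong) (simp_all add: space_haar s)
    finally show "(\<integral>g. p g * inner (\<psi> g) b \<partial>haar) = 0" .
  qed
  \<comment> \<open>Finitely many \<open>b\<close> determine the spinor, so the exceptional null
    sets can be united.\<close>
  then have "AE g in haar. \<forall>b\<in>Basis. inner (\<psi> g) b = 0"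
    by (intro AE_finite_allI) auto
  then have "AE g in haar. \<psi> g = 0"
    by (rule eventually_mono) (simp add: euclidean_all_zero_iff)
  then have "cls \<psi> = cls (\<lambda>g. 0)" using \<psi> by (simp add: cls_eq_iff L2_zero aeq_def)
  then show "x = 0" using \<psi> by (simp add: cls_zero)
qed

section \<open>The representation \<open>\<rho>\<close>\<close>

lemma inner_adjoint: "inner (A *v u) w = inner u (cadj A *v w)" for u w :: spinor
  by (simp add: inner_vec_def sum_2 mat2_mult_vec_nth cadj_nth inner_complex_def algebra_simps)

lemma norm_SU2_mult:
  assumes "g \<in> SU2"
  shows "norm (g *v v) = norm (v :: spinor)"
  by (simp add: norm_eq_sqrt_inner inner_adjoint matrix_vector_mul_assoc SU2_cancel[OF assms])

lemma aeq_translate: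
  assumes "g \<in> SU2" "h \<in> SU2" "aeq \<psi> \<phi>"
  shows "aeq (\<lambda>x. \<psi> (g ** x ** h)) (\<lambda>x. \<phi> (g ** x ** h))"
proof -
  have "AE x in distr haar haar (\<lambda>x. g ** x ** h). \<psi> x = \<phi> x"
    using assms(3) unfolding aeq_def distr_haar_translate[OF assms(1,2)] .
  then show ?thesis unfolding aeq_def by (rule AE_distrD[OF measurable_haar_translate[OF assms(1,2)]])
qed

lemma L2_translate:
  assumes "g \<in> SU2" "h \<in> SU2" "\<psi> \<in> L2"
  shows "(\<lambda>x. \<psi> (g ** x ** h)) \<in> L2"
  using assms(3) measurable_compose[OF measurable_haar_translate[OF assms(1,2)], of \<psi> borel]
    integrable_distr[OF measurable_haar_translate[OF assms(1,2)], of "\<lambda>g. (norm (\<psi> g))\<^sup>2"]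
  by (simp add: L2_def distr_haar_translate[OF assms(1,2)])

lemma l2norm_translate:
  assumes "g \<in> SU2" "h \<in> SU2" "\<psi> \<in> L2"
  shows "l2norm (\<lambda>x. \<psi> (g ** x ** h)) = l2norm \<psi>"
  using integral_haar_translate[OF assms(1,2), of "\<lambda>g. (norm (\<psi> g))\<^sup>2"] assms(3)
  by (simp add: l2norm_def L2_def borel_measurable_integrable)

lemma
  assumes g: "g1 \<in> SU2" "g2 \<in> SU2"
  shows rho_L2: "\<psi> \<in> L2 \<Longrightarrow> rho g1 g2 \<psi> \<in> L2"
    and rho_cls: "\<psi> \<in> L2 \<Longrightarrow> lift_op (rho g1 g2) (cls \<psi>) = cls (rho g1 g2 \<psi>)"
    and bounded_linear_rho: "bounded_linear (lift_op (rho g1 g2))"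
proof -
  have eq: "rho g1 g2 \<psi> = (\<lambda>x. g2 *v \<psi> (cadj g1 ** x ** g2))" for \<psi> by (simp add: rho_def fun_eq_iff)
  have bl: "bounded_linear (\<lambda>v :: spinor. g2 *v v)" by (rule bounded_linear_matrix_vector)
  have L: "rho g1 g2 \<psi> \<in> L2" if "\<psi> \<in> L2" for \<psi>
    unfolding eq by (rule L2_pointwise[OF bl L2_translate[OF SU2_cadj[OF g(1)] g(2) that]])
  have c: "aeq (rho g1 g2 \<psi>) (rho g1 g2 \<phi>)" if "aeq \<psi> \<phi>" for \<psi> \<phi>
    using aeq_translate[OF SU2_cadj[OF g(1)] g(2) that] unfolding eq aeq_def by (auto elim: eventually_mono)
  have n: "l2norm (rho g1 g2 \<psi>) = l2norm \<psi>" if "\<psi> \<in> L2" for \<psi>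
    using l2norm_translate[OF SU2_cadj[OF g(1)] g(2) that] unfolding eq l2norm_def by (simp add: norm_SU2_mult[OF g(2)])
  show "\<psi> \<in> L2 \<Longrightarrow> rho g1 g2 \<psi> \<in> L2" by (rule L)
  show "\<psi> \<in> L2 \<Longrightarrow> lift_op (rho g1 g2) (cls \<psi>) = cls (rho g1 g2 \<psi>)"
    by (rule lift_op_cls) (use L c in auto)
  show "bounded_linear (lift_op (rho g1 g2))"
  proof (rule bounded_linear_lift_op)
    show "rho g1 g2 (\<lambda>g. \<psi> g + \<phi> g) g = rho g1 g2 \<psi> g + rho g1 g2 \<phi> g" for \<psi> \<phi> g
      by (simp add: rho_def matrix_vector_right_distrib)
    show "rho g1 g2 (\<lambda>g. c *\<^sub>R \<psi> g) g = c *\<^sub>R rho g1 g2 \<psi> g" for c \<psi> g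
      by (simp add: rho_def linear_scale[OF bounded_linear.linear[OF bl]])
  qed (use L c n in auto)
qed

definition translate :: "mat2 \<Rightarrow> mat2 \<Rightarrow> (mat2 \<Rightarrow> complex) \<Rightarrow> mat2 \<Rightarrow> complex" where
  "translate k h f = (\<lambda>g. f (k ** g ** h))"

lemma trans_entry: "translate k h (entry p q) = (\<Sum>i\<in>UNIV. \<Sum>j\<in>UNIV. cf (k $ p $ i * h $ j $ q) * entry i j)"
  by (simp add: translate_def fun_eq_iff entry_def cf_def sum_2 mat2_mult_nth algebra_simps)

lemma trans_Pol: "f \<in> Pol \<Longrightarrow> translate k h f \<in> Pol"
proof (induction rule: Pol.induct)
  case (cf c)
  have "translate k h (cf c) = cf c" by (simp add: translate_def cf_def)
  then have "translate k h (cf c) \<in> Pol" by simp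
  then show ?case .
next
  case (entry p q)
  have "translate k h (entry p q) \<in> Pol" unfolding trans_entry by (intro Pol_sum Pol.intros)
  then show ?case .
next
  case (add f f')
  have "translate k h (f + f') = translate k h f + translate k h f'" by (simp add: translate_def fun_eq_iff)
  then have "translate k h (f + f') \<in> Pol" using add by simp
  then show ?case .
next
  case (mult f f')
  have "translate k h (f * f') = translate k h f * translate k h f'" by (simp add: translate_def fun_eq_iff)
  then have "translate k h (f * f') \<in> Pol" using mult by simp
  then show ?case .
qed

lemma pd_trans:
  assumes "f \<in> Pol"
  shows "pd i j (translate k h f) = (\<Sum>p\<in>UNIV. \<Sum>q\<in>UNIV. cf (k $ p $ i * h $ j $ q) * translate k h (pd p q f))"
proof -
  let ?d = "\<lambda>i j. \<Sum>p\<in>UNIV. \<Sum>q\<in>UNIV. cf (k $ p $ i * h $ j $ q) * translate k h (pd p q f)"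
  have "(translate k h f has_derivative (\<lambda>H. \<Sum>i\<in>UNIV. \<Sum>j\<in>UNIV. ?d i j g * H $ i $ j)) (at g)" for g
  proof -
    have "linear (\<lambda>g. k ** g ** h)"
      by (rule linearI) (simp_all add: mat2_eq_iff mat2_mult_nth scaleR_complex algebra_simps)
    then have "((\<lambda>g. k ** g ** h) has_derivative (\<lambda>g. k ** g ** h)) (at g)"
      by (intro bounded_linear_imp_has_derivative linear_conv_bounded_linear[THEN iffD1])
    from diff_chain_at[OF this Pol_has_derivative[OF assms]]
    have "(translate k h f has_derivative
        (\<lambda>H. \<Sum>p\<in>UNIV. \<Sum>q\<in>UNIV. pd p q f (k ** g ** h) * (k ** H ** h) $ p $ q)) (at g)"
      by (simp add: translate_def o_def)
    moreover have "(\<Sum>p\<in>UNIV. \<Sum>q\<in>UNIV. pd p q f (k ** g ** h) * (k ** H ** h) $ p $ q)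
        = (\<Sum>i\<in>UNIV. \<Sum>j\<in>UNIV. ?d i j g * H $ i $ j)" for H :: mat2
      by (simp add: sum_2 mat2_mult_nth translate_def cf_def algebra_simps)
    ultimately show ?thesis by simp
  qed
  then have "grad (translate k h f) ?d" unfolding grad_def by blast
  then show ?thesis by (rule grad_pd)
qed

lemma numeral_fun_apply: "(numeral n :: mat2 \<Rightarrow> complex) g = numeral n"
  using cf_numeral[of n] by (metis cf_def)

text \<open>\<open>T\<close> is equivariant because its component \<open>c\<close> is \<open>\<Sum> 2 g\<^bsub>i d\<^esub> \<partial>\<^bsub>i c\<^esub> \<psi>\<^sub>d - \<Sum> g\<^bsub>i l\<^esub> \<partial>\<^bsub>i l\<^esub> \<psi>\<^sub>c\<close>.\<close>

lemma T_trans: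
  fixes h k :: mat2
  assumes "u \<in> Pol" "v \<in> Pol"
  defines "u' \<equiv> cf (h $ 1 $ 1) * translate k h u + cf (h $ 1 $ 2) * translate k h v"
    and "v' \<equiv> cf (h $ 2 $ 1) * translate k h u + cf (h $ 2 $ 2) * translate k h v"
  shows "T1 u' v' = cf (h $ 1 $ 1) * translate k h (T1 u v) + cf (h $ 1 $ 2) * translate k h (T2 u v)"
    and "T2 u' v' = cf (h $ 2 $ 1) * translate k h (T1 u v) + cf (h $ 2 $ 2) * translate k h (T2 u v)"
proof -
  have p: "pd i j u' = cf (h $ 1 $ 1) * pd i j (translate k h u) + cf (h $ 1 $ 2) * pd i j (translate k h v)"
    "pd i j v' = cf (h $ 2 $ 1) * pd i j (translate k h u) + cf (h $ 2 $ 2) * pd i j (translate k h v)" for i j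
    using assms(1,2) by (simp_all add: u'_def v'_def pd_simps trans_Pol)
  show "T1 u' v' = cf (h $ 1 $ 1) * translate k h (T1 u v) + cf (h $ 1 $ 2) * translate k h (T2 u v)"
    unfolding T1_def T2_def opZ_def opP_def opN_def p pd_trans[OF assms(1)] pd_trans[OF assms(2)]
    by (simp add: fun_eq_iff sum_2 translate_def entry_def cf_def numeral_fun_apply mat2_mult_nth algebra_simps)
  show "T2 u' v' = cf (h $ 2 $ 1) * translate k h (T1 u v) + cf (h $ 2 $ 2) * translate k h (T2 u v)"
    unfolding T1_def T2_def opZ_def opP_def opN_def p pd_trans[OF assms(1)] pd_trans[OF assms(2)]
    by (simp add: fun_eq_iff sum_2 translate_def entry_def cf_def numeral_fun_apply mat2_mult_nth algebra_simps)
qed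

lemma Teig_trans:
  assumes "Teig m u v"
  shows "Teig m (cf (h $ 1 $ 1) * translate k h u + cf (h $ 1 $ 2) * translate k h v)
    (cf (h $ 2 $ 1) * translate k h u + cf (h $ 2 $ 2) * translate k h v)"
proof -
  have p: "u \<in> Pol" "v \<in> Pol" and e: "T1 u v = cf m * u" "T2 u v = cf m * v" using assms by (auto simp: Teig_def)
  have "translate k h (cf m * f) = cf m * translate k h f" for f by (simp add: translate_def cf_def fun_eq_iff)
  then show ?thesis unfolding Teig_def T_trans[OF p] e using p by (simp add: trans_Pol algebra_simps)
qed

lemma rho_sp: "rho g1 g2 (sp u v) = sp (cf (g2 $ 1 $ 1) * translate (cadj g1) g2 u + cf (g2 $ 1 $ 2) * translate (cadj g1) g2 v)
    (cf (g2 $ 2 $ 1) * translate (cadj g1) g2 u + cf (g2 $ 2 $ 2) * translate (cadj g1) g2 v)"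
  by (simp add: rho_def fun_eq_iff spinor_eq_iff sp_nth mat2_mult_vec_nth translate_def cf_def)

section \<open>Projections onto the spectral subspaces\<close>

abbreviation mulI :: "spinor_l2 \<Rightarrow> spinor_l2" where "mulI \<equiv> pointwise (\<lambda>v. \<i> *s v)"
abbreviation conjC :: "spinor_l2 \<Rightarrow> spinor_l2" where "conjC \<equiv> pointwise epsc"

lemma mulI_cls: "\<psi> \<in> L2 \<Longrightarrow> mulI (cls \<psi>) = cls (\<lambda>g. \<i> *s \<psi> g)"
  by (rule pointwise_cls[OF bounded_linear_vscale])

lemma conjC_cls: "\<psi> \<in> L2 \<Longrightarrow> conjC (cls \<psi>) = cls (\<lambda>g. epsc (\<psi> g))"
  by (rule pointwise_cls[OF bounded_linear_epsc])

lemma gen_vscale: "gen j *v (c *s v) = c *s (gen j *v v)" for v :: spinor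
  by (simp add: spinor_eq_iff mat2_mult_vec_nth algebra_simps)

lemma L2_vscale: "\<psi> \<in> L2 \<Longrightarrow> (\<lambda>g. c *s \<psi> g) \<in> L2"
  by (rule L2_pointwise[OF bounded_linear_vscale])

lemma cls_vscale:
  assumes "\<psi> \<in> L2"
  shows "cls (\<lambda>g. c *s \<psi> g) = Re c *\<^sub>R cls \<psi> + Im c *\<^sub>R mulI (cls \<psi>)"
proof -
  have "(\<lambda>g. c *s \<psi> g) = (\<lambda>g. Re c *\<^sub>R \<psi> g + Im c *\<^sub>R (\<i> *s \<psi> g))"
    by (simp add: fun_eq_iff spinor_eq_iff complex_eq_iff)
  then show ?thesis
    using assms by (simp add: cls_add cls_scaleR mulI_cls L2_scaleR L2_vscale)
qed

lemma hinner_eq: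
  assumes "\<phi> \<in> L2" "\<psi> \<in> L2"
  shows "hinner \<phi> \<psi> = complex_of_real (inner (cls \<phi>) (cls \<psi>)) + \<i> * complex_of_real (inner (mulI (cls \<phi>)) (cls \<psi>))"
proof -
  note i = L2_integrable_inner[OF assms] L2_integrable_inner[OF L2_vscale[OF assms(1)] assms(2)]
  have "(\<Sum>k\<in>UNIV. cnj (\<phi> g $ k) * \<psi> g $ k)
      = complex_of_real (inner (\<phi> g) (\<psi> g)) + \<i> * complex_of_real (inner (\<i> *s \<phi> g) (\<psi> g))" for g
    by (simp add: sum_2 inner_vec_def inner_complex_def complex_eq_iff)
  then have "hinner \<phi> \<psi> = (\<integral>g. complex_of_real (inner (\<phi> g) (\<psi> g)) + \<i> * complex_of_real (inner (\<i> *s \<phi> g) (\<psi> g)) \<partial>haar)"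
    by (simp add: hinner_def)
  also have "\<dots> = complex_of_real (\<integral>g. inner (\<phi> g) (\<psi> g) \<partial>haar) + \<i> * complex_of_real (\<integral>g. inner (\<i> *s \<phi> g) (\<psi> g) \<partial>haar)"
    using i by (simp add: integral_complex_of_real)
  finally show ?thesis using assms by (simp add: mulI_cls inner_cls L2_vscale)
qed

section \<open>Complex closed spans of functions and real closed spans of classes\<close>

lemma combination_L2: "(\<And>k. k < n \<Longrightarrow> e k \<in> L2) \<Longrightarrow> (\<lambda>g. \<Sum>k<n. c k *s e k g) \<in> L2" for n :: nat
  by (induction n) (simp_all add: L2_zero L2_add L2_vscale)

text \<open>\<open>X\<close> is a set of classes and \<open>E\<close> the set of all their
  representatives. Closure of \<open>X\<close> under \<open>i\<close> makes the complex span of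
  \<open>E\<close>, on which \<open>cspan\<close> is built, agree with the real span of
  \<open>X\<close>.\<close>

context
  fixes X :: "spinor_l2 set" and E :: "sfield set"
  assumes E: "E = {e \<in> L2. cls e \<in> X}" and X: "\<And>x. x \<in> X \<Longrightarrow> mulI x \<in> X"
begin

lemma combination_span:
  "(\<And>k. k < n \<Longrightarrow> e k \<in> E) \<Longrightarrow> cls (\<lambda>g. \<Sum>k<n. c k *s e k g) \<in> span X" for n :: nat
proof (induction n)
  case 0 then show ?case by (simp add: cls_zero span_zero)
next
  case (Suc n)
  have L: "e k \<in> L2" if "k < Suc n" for k using Suc.prems[OF that] E by simp
  have "e n \<in> L2" "cls (e n) \<in> X" using Suc.prems[of n] E by auto
  then have "cls (\<lambda>g. c n *s e n g) \<in> span X"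
    by (simp add: cls_vscale span_add span_scale span_base X)
  moreover have "cls (\<lambda>g. \<Sum>k<Suc n. c k *s e k g) = cls (\<lambda>g. \<Sum>k<n. c k *s e k g) + cls (\<lambda>g. c n *s e n g)"
    using L by (simp add: cls_add combination_L2 L2_vscale)
  ultimately show ?case using Suc by (simp add: span_add)
qed

lemma span_combination:
  assumes "x \<in> span X"
  shows "\<exists>(n::nat) c e. (\<forall>k<n. e k \<in> E) \<and> cls (\<lambda>g. \<Sum>k<n. c k *s e k g) = x"
  using assms
proof (induction rule: span_induct_alt)
  case base
  show ?case by (rule exI[of _ 0]) (simp add: cls_zero)
next
  case (step r a y)
  obtain n :: nat and c e where y: "\<forall>k<n. e k \<in> E" "cls (\<lambda>g. \<Sum>k<n. c k *s e k g) = y" using step.IH by blast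
  let ?c = "c(n := complex_of_real r)" and ?e = "e(n := rep a)"
  have L: "(\<lambda>g. \<Sum>k<n. c k *s e k g) \<in> L2" using y(1) E by (intro combination_L2) auto
  have "(\<lambda>g. \<Sum>k<Suc n. ?c k *s ?e k g) = (\<lambda>g. (\<Sum>k<n. c k *s e k g) + complex_of_real r *s rep a g)"
    by (rule ext) simp
  then have "cls (\<lambda>g. \<Sum>k<Suc n. ?c k *s ?e k g) = r *\<^sub>R a + y"
    using L y(2) by (simp add: cls_add L2_vscale rep cls_vscale del: sum.lessThan_Suc)
  moreover have "\<forall>k<Suc n. ?e k \<in> E" using y(1) step.hyps rep[of a] E by (auto simp: less_Suc_eq)
  ultimately show ?case by blast
qed

lemma cspan_iff: "\<phi> \<in> cspan E \<longleftrightarrow> \<phi> \<in> L2 \<and> cls \<phi> \<in> closure (span X)"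
proof
  assume "\<phi> \<in> cspan E"
  then obtain u where \<phi>: "\<phi> \<in> L2" and lim: "l2lim u \<phi>"
    and u: "\<And>m. \<exists>n (c::nat \<Rightarrow> complex) e. (\<forall>k<n. e k \<in> E) \<and> u m = (\<lambda>g. \<Sum>k<n. c k *s e k g)"
    unfolding cspan_def by blast
  have uL: "u m \<in> L2 \<and> cls (u m) \<in> span X" for m
  proof -
    obtain n :: nat and c e where "\<forall>k<n. e k \<in> E" "u m = (\<lambda>g. \<Sum>k<n. c k *s e k g)" using u[of m] by blast
    then show ?thesis using combination_span[of n e c] combination_L2[of n e c] E by auto
  qed
  then have "(\<lambda>m. cls (u m)) \<longlonglongrightarrow> cls \<phi>" using lim \<phi> by (simp add: l2lim_iff)
  then show "\<phi> \<in> L2 \<and> cls \<phi> \<in> closure (span X)" using \<phi> uL unfolding closure_sequential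
    by (intro conjI exI[of _ "\<lambda>m. cls (u m)"]) auto
next
  assume a: "\<phi> \<in> L2 \<and> cls \<phi> \<in> closure (span X)"
  then obtain x where x: "\<And>m. x m \<in> span X" "x \<longlonglongrightarrow> cls \<phi>" unfolding closure_sequential by blast
  define Q where "Q u \<longleftrightarrow> (\<exists>n (c::nat \<Rightarrow> complex) e. (\<forall>k<n. e k \<in> E) \<and> u = (\<lambda>g. \<Sum>k<n. c k *s e k g))" for u
  have "\<exists>u. Q u \<and> cls u = x m" for m
    using span_combination[OF x(1)[of m]] unfolding Q_def by blast
  then obtain u where Q: "\<And>m. Q (u m)" and u: "\<And>m. cls (u m) = x m" by metis
  note u1 = Q[unfolded Q_def]
  have "u m \<in> L2" for m
  proof -
    obtain n :: nat and c e where "\<forall>k<n. e k \<in> E" "u m = (\<lambda>g. \<Sum>k<n. c k *s e k g)" using u1[of m] by blast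
    then show ?thesis using combination_L2[of n e c] E by auto
  qed
  then have "l2lim u \<phi>" using a x(2) u by (simp add: l2lim_iff)
  then show "\<phi> \<in> cspan E" unfolding cspan_def mem_Collect_eq
    by (intro conjI[OF conjunct1[OF a]] exI[of _ u] conjI[OF _ allI[OF u1]])
qed

text \<open>Complex orthogonality to \<open>e\<close> is real orthogonality to \<open>e\<close> and
  to \<open>i e\<close>; so the choice in \<open>proj\<close> ranges over the representatives of the
  real orthogonal projection.\<close>

lemma proj_cls:
  assumes "\<psi> \<in> L2"
  shows "proj E \<psi> \<in> L2" "cls (proj E \<psi>) = oproj (closure (span X)) (cls \<psi>)"
proof -
  let ?H = "closure (span X)"
  have H: "subspace ?H" "closed ?H" by (auto intro: subspace_closure_span)
  have orth: "(\<forall>e\<in>E. hinner e (\<lambda>g. \<psi> g - \<phi> g) = 0) \<longleftrightarrow> (\<forall>z\<in>?H. inner (cls \<psi> - cls \<phi>) z = 0)" if \<phi>: "\<phi> \<in> L2" for \<phi>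
  proof
    assume a: "\<forall>e\<in>E. hinner e (\<lambda>g. \<psi> g - \<phi> g) = 0"
    have "inner (cls \<psi> - cls \<phi>) x = 0" if x: "x \<in> X" for x
    proof -
      have "rep x \<in> E" using E rep[of x] x by simp
      then have "hinner (rep x) (\<lambda>g. \<psi> g - \<phi> g) = 0" using a by blast
      then have "inner x (cls \<psi> - cls \<phi>) = 0"
        using assms \<phi> rep[of x] by (simp add: hinner_eq L2_diff cls_diff complex_eq_iff)
      then show ?thesis by (simp add: inner_commute)
    qed
    then show "\<forall>z\<in>?H. inner (cls \<psi> - cls \<phi>) z = 0" using inner_zero_closure_span by blast
  next
    assume a: "\<forall>z\<in>?H. inner (cls \<psi> - cls \<phi>) z = 0"
    show "\<forall>e\<in>E. hinner e (\<lambda>g. \<psi> g - \<phi> g) = 0"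
    proof
      fix e assume "e \<in> E"
      then have e: "e \<in> L2" "cls e \<in> X" using E by auto
      then have "cls e \<in> ?H" "mulI (cls e) \<in> ?H" using X by (auto intro: subsetD[OF closure_subset] span_base)
      then have "inner (cls e) (cls \<psi> - cls \<phi>) = 0" "inner (mulI (cls e)) (cls \<psi> - cls \<phi>) = 0"
        using a by (auto simp: inner_commute)
      then show "hinner e (\<lambda>g. \<psi> g - \<phi> g) = 0" using assms \<phi> e by (simp add: hinner_eq L2_diff cls_diff)
    qed
  qed
  let ?P = "\<lambda>\<phi>. \<phi> \<in> cspan E \<and> (\<forall>e\<in>E. hinner e (\<lambda>g. \<psi> g - \<phi> g) = 0)"
  have "?P (rep (oproj ?H (cls \<psi>)))"
    unfolding cspan_iff orth[OF rep(1)] using oproj_in[OF H] oproj_orth[OF H] by (simp add: rep)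
  then have P: "?P (proj E \<psi>)" unfolding proj_def by (rule someI[where P = ?P])
  then show L: "proj E \<psi> \<in> L2" by (simp add: cspan_iff)
  then have "cls (proj E \<psi>) \<in> ?H" "\<And>z. z \<in> ?H \<Longrightarrow> inner (cls \<psi> - cls (proj E \<psi>)) z = 0"
    using P orth[OF L] by (auto simp: cspan_iff)
  then show "cls (proj E \<psi>) = oproj ?H (cls \<psi>)" using oproj_unique[OF H] by metis
qed

end

section \<open>The Dirac graph as an instance of the abstract setting\<close>

interpretation dirac: conjugated_graph dirac_graph conjC mulI
proof (intro conjugated_graph.intro symmetric_graph.intro conjugated_graph_axioms.intro)
  show "subspace dirac_graph" by (rule subspace_dirac_graph)
  show "closed dirac_graph" by (rule closed_dirac_graph)
  show "inner x y' = inner x' y" if "(x, x') \<in> dirac_graph" "(y, y') \<in> dirac_graph" for x x' y y'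
    by (rule dirac_graph_symmetric[OF that])
  have "eigenspinors \<subseteq> {x. \<exists>r. r \<noteq> 0 \<and> (x, r *\<^sub>R x) \<in> dirac_graph}"
    unfolding eigenspinors_def using eigenspinors_graph(1) by blast
  then have "closure (span eigenspinors) \<subseteq> closure (span {x. \<exists>r. r \<noteq> 0 \<and> (x, r *\<^sub>R x) \<in> dirac_graph})"
    by (intro closure_mono span_mono)
  then show "closure (span {x. \<exists>r. r \<noteq> 0 \<and> (x, r *\<^sub>R x) \<in> dirac_graph}) = UNIV"
    unfolding eigenspinors_total by blast
  show "bounded_linear conjC" by (rule bounded_linear_pointwise[OF bounded_linear_epsc norm_epsc])
  show "norm (conjC x) = norm x" for x by (rule norm_pointwise[OF bounded_linear_epsc norm_epsc])
  have ni: "norm (\<i> *s v) = norm v" for v :: spinor by (simp add: norm_vscale)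
  show "bounded_linear mulI" by (rule bounded_linear_pointwise[OF bounded_linear_vscale ni])
  show "(conjC x, conjC y) \<in> dirac_graph" if "(x, y) \<in> dirac_graph" for x y
    by (rule pointwise_graph[OF bounded_linear_epsc norm_epsc epsc_gen that])
  show "(mulI x, mulI y) \<in> dirac_graph" if "(x, y) \<in> dirac_graph" for x y
    by (rule pointwise_graph[OF bounded_linear_vscale ni _ that]) (simp add: gen_vscale)
  note Le = L2_pointwise[OF bounded_linear_epsc]
  fix x
  obtain \<psi> where \<psi>: "\<psi> \<in> L2" "x = cls \<psi>" using rep by metis
  show "conjC (conjC x) = - x"
    using \<psi> by (simp add: conjC_cls Le epsc_epsc cls_uminus)
  show "conjC (mulI x) = - mulI (conjC x)"
  proof -
    have "epsc (\<i> *s v) = - (\<i> *s epsc v)" for v by (simp add: spinor_eq_iff epsc_nth)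
    then show ?thesis using \<psi> by (simp add: conjC_cls mulI_cls Le L2_vscale cls_uminus)
  qed
qed

lemma Eig_iff:
  "EigPos = {e \<in> L2. cls e \<in> dirac.Epos}" "EigNeg = {e \<in> L2. cls e \<in> dirac.Eneg}"
proof -
  have "dirac e (\<lambda>g. complex_of_real r *s e g) \<longleftrightarrow> e \<in> L2 \<and> (cls e, r *\<^sub>R cls e) \<in> dirac_graph" for e r
    using dirac_L2[of e] dirac_iff[of e "\<lambda>g. complex_of_real r *s e g"] by (auto simp: cls_vscale L2_vscale)
  then show "EigPos = {e \<in> L2. cls e \<in> dirac.Epos}" "EigNeg = {e \<in> L2. cls e \<in> dirac.Eneg}"
    by (auto simp: EigPos_def EigNeg_def dirac.Epos_def dirac.Eneg_def)
qed

lemma p_cls: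
  assumes "\<psi> \<in> L2"
  shows "pplus \<psi> \<in> L2" "cls (pplus \<psi>) = dirac.Ppos (cls \<psi>)"
    and "pminus \<psi> \<in> L2" "cls (pminus \<psi>) = dirac.Pneg (cls \<psi>)"
  using proj_cls[OF Eig_iff(1) _ assms] proj_cls[OF Eig_iff(2) _ assms]
    dirac.eigen_image[OF bounded_linear.linear[OF dirac.J(1)] dirac.J(2)]
  by (auto simp: pplus_def pminus_def dirac.Ppos_def dirac.Pneg_def dirac.Hpos_def dirac.Hneg_def)

lemma Fop_cls:
  assumes "\<psi> \<in> L2"
  shows "Fop \<psi> \<in> L2" "cls (Fop \<psi>) = dirac.F (cls \<psi>)"
proof -
  have F: "Fop \<psi> = (\<lambda>g. pplus \<psi> g + epsc (pminus \<psi> g))" by (simp add: Fop_def Cop_eq fun_eq_iff)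
  note p = p_cls[OF assms]
  note Le = L2_pointwise[OF bounded_linear_epsc p(3)]
  show "Fop \<psi> \<in> L2" unfolding F by (rule L2_add[OF p(1) Le])
  show "cls (Fop \<psi>) = dirac.F (cls \<psi>)" unfolding F cls_add[OF p(1) Le] dirac.F_def p(2,4)[symmetric] conjC_cls[OF p(3)] ..
qed

lemma jmul_cls:
  assumes "u \<in> L2"
  shows "jmul c u \<in> L2" "cls (jmul c u) = Re c *\<^sub>R cls u + Im c *\<^sub>R mulI (dirac.Ppos (cls u) - dirac.Pneg (cls u))"
proof -
  note p = p_cls[OF assms]
  have S: "Sop u = (\<lambda>g. pplus u g - pminus u g)" by (simp add: Sop_def fun_eq_iff)
  have SL: "Sop u \<in> L2" "cls (Sop u) = dirac.Ppos (cls u) - dirac.Pneg (cls u)"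
    unfolding S using p by (simp_all add: L2_diff cls_diff)
  have j: "jmul c u = (\<lambda>g. complex_of_real (Re c) *s u g + (complex_of_real (Im c) * \<i>) *s Sop u g)"
    by (simp add: jmul_def fun_eq_iff)
  show "jmul c u \<in> L2" unfolding j by (intro L2_add L2_vscale assms SL)
  show "cls (jmul c u) = Re c *\<^sub>R cls u + Im c *\<^sub>R mulI (dirac.Ppos (cls u) - dirac.Pneg (cls u))"
    unfolding j using assms SL by (simp add: cls_add L2_vscale cls_vscale)
qed

text \<open>Tested on polynomial eigenspinors, which \<open>rho\<close> maps to polynomial
  eigenspinors with the same eigenvalue of \<open>T\<close>.\<close>

lemma rho_graph:
  assumes g: "g1 \<in> SU2" "g2 \<in> SU2" and xy: "(x, y) \<in> dirac_graph"
  shows "(lift_op (rho g1 g2) x, lift_op (rho g1 g2) y) \<in> dirac_graph"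
proof (rule dirac.graph_invariant_if_eigenpairs[OF _ eigenspinors_total bounded_linear_rho[OF g] _ xy])
  show "\<exists>r. (e, r *\<^sub>R e) \<in> dirac_graph" if "e \<in> eigenspinors" for e
    using that eigenspinors_graph(1) unfolding eigenspinors_def by blast
  fix e r assume "e \<in> eigenspinors" and r: "(e, r *\<^sub>R e) \<in> dirac_graph"
  then obtain u v m where e: "e = cls (sp u v)" and t: "Teig (complex_of_real m) u v" unfolding eigenspinors_def by blast
  let ?U = "lift_op (rho g1 g2)"
  have m: "(e, (m + 3/2) *\<^sub>R e) \<in> dirac_graph" using eigenspinors_graph(1)[OF t] e by simp
  \<comment> \<open>The number \<open>r\<close> is given independently of \<open>m\<close>; symmetry
    of the graph forces \<open>r = m + 3/2\<close> unless \<open>e = 0\<close>.\<close>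
  have "(r - (m + 3/2)) * inner e e = 0" using dirac_graph_symmetric[OF r m] by (simp add: algebra_simps)
  then have re: "r *\<^sub>R e = (m + 3/2) *\<^sub>R e" by auto
  have "sp u v \<in> L2" using t by (intro sp_L2) (auto simp: Teig_def)
  then have "?U e = cls (rho g1 g2 (sp u v))" unfolding e by (rule rho_cls[OF g])
  then have "(?U e, (m + 3/2) *\<^sub>R ?U e) \<in> dirac_graph"
    using eigenspinors_graph(1)[OF Teig_trans[OF t]] by (simp only: rho_sp)
  then show "(?U e, ?U (r *\<^sub>R e)) \<in> dirac_graph"
    unfolding re linear_scale[OF bounded_linear.linear[OF bounded_linear_rho[OF g]]] .
qed

lemma rho_conjC:
  assumes g: "g1 \<in> SU2" "g2 \<in> SU2"
  shows "conjC (lift_op (rho g1 g2) x) = lift_op (rho g1 g2) (conjC x)"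
proof -
  obtain \<psi> where \<psi>: "\<psi> \<in> L2" "x = cls \<psi>" using rep by metis
  have "(\<lambda>g. epsc (rho g1 g2 \<psi> g)) = rho g1 g2 (\<lambda>g. epsc (\<psi> g))"
    by (simp add: rho_def fun_eq_iff epsc_SU2[OF g(2)])
  then show ?thesis
    using \<psi> by (simp add: rho_cls[OF g] conjC_cls rho_L2[OF g] L2_pointwise[OF bounded_linear_epsc])
qed

theorem theorem1:
  shows "(\<forall>\<psi>\<in>L2. Fop \<psi> \<in> L2)
    \<and> (\<forall>\<psi>\<in>L2. \<forall>\<phi>\<in>L2. aeq (Fop (\<lambda>g. \<psi> g + \<phi> g)) (\<lambda>g. Fop \<psi> g + Fop \<phi> g))
    \<and> (\<forall>c \<psi>. \<psi> \<in> L2 \<longrightarrow> aeq (Fop (\<lambda>g. c *s \<psi> g)) (jmul c (Fop \<psi>)))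
    \<and> (\<forall>\<psi>\<in>L2. l2norm (Fop \<psi>) = l2norm \<psi>)
    \<and> (\<forall>u\<in>L2. \<exists>\<psi>\<in>L2. aeq (Fop \<psi>) u)
    \<and> (\<forall>g1\<in>SU2. \<forall>g2\<in>SU2. \<forall>\<psi>\<in>L2. aeq (Fop (rho g1 g2 \<psi>)) (rhoH g1 g2 (Fop \<psi>)))
    \<and> (\<forall>\<psi> \<phi>. dirac \<psi> \<phi> \<longrightarrow> dirac (Fop \<psi>) (Fop \<phi>))"
proof (intro conjI ballI allI impI)
  note lin = bounded_linear.linear[OF dirac.bounded_linear_F]
  show "Fop \<psi> \<in> L2" if "\<psi> \<in> L2" for \<psi> by (rule Fop_cls[OF that])
  show "aeq (Fop (\<lambda>g. \<psi> g + \<phi> g)) (\<lambda>g. Fop \<psi> g + Fop \<phi> g)" if "\<psi> \<in> L2" "\<phi> \<in> L2" for \<psi> \<phi>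
    using that by (simp add: cls_eq_iff[symmetric] Fop_cls L2_add cls_add linear_add[OF lin])
  \<comment> \<open>On classes \<open>c\<close> acts as \<open>Re c + Im c i\<close>; real linearity
    handles the sum, and \<open>F_J\<close> turns \<open>i\<close> into \<open>j\<close>.\<close>
  show "aeq (Fop (\<lambda>g. c *s \<psi> g)) (jmul c (Fop \<psi>))" if "\<psi> \<in> L2" for c \<psi>
    using that by (simp add: cls_eq_iff[symmetric] Fop_cls L2_vscale cls_vscale jmul_cls
        linear_add[OF lin] linear_scale[OF lin] dirac.F_J)
  show "l2norm (Fop \<psi>) = l2norm \<psi>" if "\<psi> \<in> L2" for \<psi>
    using that by (simp add: norm_cls[symmetric] Fop_cls dirac.norm_F)
  show "\<exists>\<psi>\<in>L2. aeq (Fop \<psi>) u" if "u \<in> L2" for u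
  proof
    let ?\<psi> = "rep (dirac.Ppos (cls u) - conjC (dirac.Pneg (cls u)))"
    show "?\<psi> \<in> L2" by (rule rep)
    show "aeq (Fop ?\<psi>) u"
      using that by (simp add: cls_eq_iff[symmetric] Fop_cls rep dirac.surj_F)
  qed
  show "aeq (Fop (rho g1 g2 \<psi>)) (rhoH g1 g2 (Fop \<psi>))" if g: "g1 \<in> SU2" "g2 \<in> SU2" and "\<psi> \<in> L2" for g1 g2 \<psi>
    using that(3) dirac.F_commute[OF bounded_linear_rho[OF g] rho_graph[OF g] rho_conjC[OF g], of "cls \<psi>"]
    by (simp add: rhoH_def cls_eq_iff[symmetric] Fop_cls rho_L2[OF g] rho_cls[OF g, symmetric])
  show "dirac (Fop \<psi>) (Fop \<phi>)" if "dirac \<psi> \<phi>" for \<psi> \<phi>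
    using that dirac_L2[OF that] dirac.F_graph by (simp add: dirac_iff Fop_cls)
qed

end
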